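(* Assume $\mathsf M$ is uniformly $\Delta$-absorbing. (a) For every $\pi\in\mathbf\Pi$ there exists a chattering Markov policy $\gamma=\{\gamma_n\}_{n\in\mathbb N}$ with $\gamma_n\in\mathbb C_{2d+1}$ for all $n$ such that $\mu_\pi(r)=\mu_\gamma(r)$. (b) If moreover $\mathsf M$ is atomless, then for every $\pi\in\mathbf\Pi$ there exists a deterministic Markov policy $\Phi$ such that $\mu_\pi(r)=\mu_\Phi(r)$.
   Context: Model. $(\mathbf X,\mathfrak X)$ is a measurable space (state space), $\mathbf A$ is a Borel space (action space) with Borel $\sigma$-algebra $\mathfrak B(\mathbf A)$; for each $x\in\mathbf X$, $\mathbf A(x)\subseteq\mathbf A$ is a nonempty measurable set of admissible actions; $\mathbf K=\{(x,a)\in\mathbf X\times\mathbf A: a\in\mathbf A(x)\}$; $Q$ is a stochastic kernel on $\mathbf X$ given $(\mathbf X\times\mathbf A,\mathfrak X\otimes\mathfrak B(\mathbf A))$; $\eta$ is a probability measure on $\mathbf X$; $r:\mathbf X\times\mathbf A\to\mathbb R^d$ ($d\ge1$) is bounded measurable. The model $\mathsf M=(\mathbf X,\mathbf A,\{\mathbf A(x)\}_{x},Q,\eta,r)$ satisfies the measurability conditions: $\mathbf K\in\mathfrak X\otimes\mathfrak B(\mathbf A)$, and there is a measurable $\theta:\mathbf X\to\mathbf A$ with $\theta(x)\in\mathbf A(x)$ for all $x$. Policies. $\mathbf H_0=\mathbf X$, $\mathbf H_n=\mathbf H_{n-1}\times\mathbf A\times\mathbf X$. A policy $\pi=\{\pi_n\}_{n\ge0}$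 is a sequence of stochastic kernels $\pi_n$ on $\mathbf A$ given $\mathbf H_n$ with $\pi_n(\mathbf A(x_n)|h_n)=1$ for all $h_n=(x_0,a_0,\dots,x_n)$; $\mathbf\Pi$ is the set of all policies. For $\pi\in\mathbf\Pi$, $\mathbb P_\pi$ is the unique probability on $\Omega=(\mathbf X\times\mathbf A)^\infty$ (product $\sigma$-algebra, coordinate processes $X_n,A_n$, histories $H_n$) with $X_0\sim\eta$, $\mathbb P_\pi(A_n\in\cdot\,|H_n)=\pi_n(\cdot|H_n)$ and $\mathbb P_\pi(X_{n+1}\in\cdot\,|H_n,A_n)=Q(\cdot|X_n,A_n)$; $\mathbb E_\pi$ is its expectation. $\mathbb S$ is the set of stochastic kernels $\varphi$ on $\mathbf A$ given $\mathbf X$ with $\varphi(\mathbf A(x)|x)=1$ for all $x$; $\mathbb D$ is the set of measurable $\phi:\mathbf X\to\mathbf A$ with $\phi(x)\in\mathbf A(x)$ for all $x$. For $q\ge1$, $\mathbb C_q$ is the set of $\varphi\in\mathbb S$ of the form $\varphi(da|x)=\sum_{i=1}^q\beta_i(x)\delta_{\phi_i(x)}(da)$ with measurable $\phi_i:\mathbf X\to\mathbf A$ and measurable $\beta=(\beta_1,\dots,\beta_q):\mathbf X\to\{b\in\mathbb R_+^q:\sum_ib_i=1\}$. A chattering Markov policy is a policy with $\pi_n(\cdot|h_n)=\gamma_n(\cdot|x_n)$ where each $\gamma_n\in\mathbb C_q$ for some $q$; a deterministic Markov policy is one with $\pi_n(\cdot|h_n)=\delta_{\phi_n(x_n)}$,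 $\phi_n\in\mathbb D$. Absorbing models. For $\Delta\in\mathfrak X$ let $T_\Delta=\min\{n\ge0:X_n\in\Delta\}$ ($\min\emptyset=\infty$). $\mathsf M$ is $\Delta$-absorbing if $Q(\Delta|x,a)=1$ and $r(x,a)=0$ for all $(x,a)\in\Delta\times\mathbf A$, and $\mathbb E_\pi[T_\Delta]<\infty$ for all $\pi\in\mathbf\Pi$; it is uniformly $\Delta$-absorbing if moreover $\lim_{n\to\infty}\sup_{\pi\in\mathbf\Pi}\sum_{t\ge n}\mathbb P_\pi(T_\Delta>t)=0$. Atomless: $\mathsf M$ is atomless if the measure $B\mapsto\eta(B\cap\Delta^c)$ is atomless and there is a countably generated sub-$\sigma$-algebra $\mathfrak X_0\subseteq\mathfrak X$ such that for every $(x,a)\in\Delta^c\times\mathbf A$ the measure $B\mapsto Q(B\cap\Delta^c|x,a)$ restricted to $\mathfrak X_0$ is atomless. Occupation measures. $\mu_\pi(\Gamma)=\mathbb E_\pi\big[\sum_{t\ge0}\mathbf 1_{\{T_\Delta>t\}}\mathbf 1_{\{(X_t,A_t)\in\Gamma\}}\big]$ for $\Gamma\in\mathfrak X\otimes\mathfrak B(\mathbf A)$, and $\mu(r)=(\int r_1d\mu,\dots,\int r_dd\mu)$; note $\mu_\pi(r)=\mathbb E_\pi[\sum_{t\ge0}r(X_t,A_t)]$. *)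

theory Defs
  imports "HOL-Probability.Probability"
begin

definition ActM :: "'a::polish_space set \<Rightarrow> 'a measure" where
  "ActM SA = restrict_space borel SA"

definition XA :: "'x measure \<Rightarrow> 'a::polish_space set \<Rightarrow> ('x \<times> 'a) measure" where
  "XA X SA = X \<Otimes>\<^sub>M ActM SA"

definition Hist :: "'x measure \<Rightarrow> 'a::polish_space set \<Rightarrow> nat \<Rightarrow> ((nat \<Rightarrow> 'x \<times> 'a) \<times> 'x) measure" where
  "Hist X SA n = (\<Pi>\<^sub>M i\<in>{..<n}. XA X SA) \<Otimes>\<^sub>M X"

definition mdp_model ::
  "'x measure \<Rightarrow> 'a::polish_space set \<Rightarrow> ('x \<Rightarrow> 'a set) \<Rightarrow> ('x \<times> 'a \<Rightarrow> 'x measure)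
   \<Rightarrow> 'x measure \<Rightarrow> ('x \<times> 'a \<Rightarrow> real^'d) \<Rightarrow> bool" where
  "mdp_model X SA Adm Q \<eta> r \<longleftrightarrow>
     SA \<in> sets borel \<and>
     (\<forall>x\<in>space X. Adm x \<noteq> {} \<and> Adm x \<in> sets (ActM SA)) \<and>
     Q \<in> measurable (XA X SA) (prob_algebra X) \<and>
     prob_space \<eta> \<and> sets \<eta> = sets X \<and>
     r \<in> borel_measurable (XA X SA) \<and> bounded (r ` space (XA X SA)) \<and>
     {(x, a). x \<in> space X \<and> a \<in> Adm x} \<in> sets (XA X SA) \<and>
     (\<exists>\<theta>. \<theta> \<in> measurable X (ActM SA) \<and> (\<forall>x\<in>space X. \<theta> x \<in> Adm x))"

definition policies ::
  "'x measure \<Rightarrow> 'a::polish_space set \<Rightarrow> ('x \<Rightarrow> 'a set)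
   \<Rightarrow> (nat \<Rightarrow> (nat \<Rightarrow> 'x \<times> 'a) \<times> 'x \<Rightarrow> 'a measure) set" where
  "policies X SA Adm = {\<pi>. \<forall>n. \<pi> n \<in> measurable (Hist X SA n) (prob_algebra (ActM SA)) \<and>
        (\<forall>h\<in>space (Hist X SA n). emeasure (\<pi> n h) (Adm (snd h)) = 1)}"

text \<open>Joint law under P_pi of ((X_0,A_0),...,(X_{n-1},A_{n-1})) (finite-dimensional
  distributions of P_pi, built by the Ionescu-Tulcea recursion).\<close>
primrec traj ::
  "'x measure \<Rightarrow> 'a::polish_space set \<Rightarrow> ('x \<times> 'a \<Rightarrow> 'x measure) \<Rightarrow> 'x measure
   \<Rightarrow> (nat \<Rightarrow> (nat \<Rightarrow> 'x \<times> 'a) \<times> 'x \<Rightarrow> 'a measure) \<Rightarrow> nat \<Rightarrow> (nat \<Rightarrow> 'x \<times> 'a) measure" where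
  "traj X SA Q \<eta> \<pi> 0 = return (\<Pi>\<^sub>M i\<in>{..<0}. XA X SA) (\<lambda>_. undefined)"
| "traj X SA Q \<eta> \<pi> (Suc n) =
     traj X SA Q \<eta> \<pi> n \<bind> (\<lambda>h.
       (if n = 0 then \<eta> else Q (h (n - 1))) \<bind> (\<lambda>x.
         \<pi> n (h, x) \<bind> (\<lambda>a.
           return (\<Pi>\<^sub>M i\<in>{..<Suc n}. XA X SA) (h(n := (x, a))))))"

text \<open>P_pi(T_Delta > t) = P_pi(X_0,...,X_t all outside Delta).\<close>
definition prob_not_absorbed ::
  "'x measure \<Rightarrow> 'a::polish_space set \<Rightarrow> ('x \<times> 'a \<Rightarrow> 'x measure) \<Rightarrow> 'x measure
   \<Rightarrow> 'x set \<Rightarrow> (nat \<Rightarrow> (nat \<Rightarrow> 'x \<times> 'a) \<times> 'x \<Rightarrow> 'a measure) \<Rightarrow> nat \<Rightarrow> ennreal" where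
  "prob_not_absorbed X SA Q \<eta> \<Delta> \<pi> t =
     emeasure (traj X SA Q \<eta> \<pi> (Suc t))
       {h \<in> space (traj X SA Q \<eta> \<pi> (Suc t)). \<forall>s\<le>t. fst (h s) \<notin> \<Delta>}"

text \<open>mu_pi(r) = E_pi[sum_t 1{T_Delta > t} r(X_t, A_t)].\<close>
definition occ_reward ::
  "'x measure \<Rightarrow> 'a::polish_space set \<Rightarrow> ('x \<times> 'a \<Rightarrow> 'x measure) \<Rightarrow> 'x measure
   \<Rightarrow> 'x set \<Rightarrow> ('x \<times> 'a \<Rightarrow> real^'d) \<Rightarrow> (nat \<Rightarrow> (nat \<Rightarrow> 'x \<times> 'a) \<times> 'x \<Rightarrow> 'a measure) \<Rightarrow> real^'d" where
  "occ_reward X SA Q \<eta> \<Delta> r \<pi> =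
     (\<Sum>t. \<integral>h. indicator {h. \<forall>s\<le>t. fst (h s) \<notin> \<Delta>} h *\<^sub>R r (h t) \<partial>traj X SA Q \<eta> \<pi> (Suc t))"

text \<open>Delta-absorbing (E_pi[T_Delta] = sum_t P_pi(T_Delta > t)).\<close>
definition absorbing ::
  "'x measure \<Rightarrow> 'a::polish_space set \<Rightarrow> ('x \<Rightarrow> 'a set) \<Rightarrow> ('x \<times> 'a \<Rightarrow> 'x measure)
   \<Rightarrow> 'x measure \<Rightarrow> ('x \<times> 'a \<Rightarrow> real^'d) \<Rightarrow> 'x set \<Rightarrow> bool" where
  "absorbing X SA Adm Q \<eta> r \<Delta> \<longleftrightarrow>
     \<Delta> \<in> sets X \<and>
     (\<forall>x\<in>\<Delta>. \<forall>a\<in>space (ActM SA). emeasure (Q (x, a)) \<Delta> = 1 \<and> r (x, a) = 0) \<and>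
     (\<forall>\<pi>\<in>policies X SA Adm. (\<Sum>t. prob_not_absorbed X SA Q \<eta> \<Delta> \<pi> t) < \<infinity>)"

definition uniformly_absorbing ::
  "'x measure \<Rightarrow> 'a::polish_space set \<Rightarrow> ('x \<Rightarrow> 'a set) \<Rightarrow> ('x \<times> 'a \<Rightarrow> 'x measure)
   \<Rightarrow> 'x measure \<Rightarrow> ('x \<times> 'a \<Rightarrow> real^'d) \<Rightarrow> 'x set \<Rightarrow> bool" where
  "uniformly_absorbing X SA Adm Q \<eta> r \<Delta> \<longleftrightarrow>
     absorbing X SA Adm Q \<eta> r \<Delta> \<and>
     ((\<lambda>n. SUP \<pi>\<in>policies X SA Adm. (\<Sum>t. prob_not_absorbed X SA Q \<eta> \<Delta> \<pi> (t + n)))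
        \<longlonglongrightarrow> 0)"

definition atomless_on :: "'x set set \<Rightarrow> ('x set \<Rightarrow> ennreal) \<Rightarrow> bool" where
  "atomless_on F m \<longleftrightarrow>
     \<not> (\<exists>B\<in>F. m B > 0 \<and> (\<forall>C\<in>F. C \<subseteq> B \<longrightarrow> m C = 0 \<or> m C = m B))"

definition atomless_model ::
  "'x measure \<Rightarrow> 'a::polish_space set \<Rightarrow> ('x \<times> 'a \<Rightarrow> 'x measure) \<Rightarrow> 'x measure \<Rightarrow> 'x set \<Rightarrow> bool" where
  "atomless_model X SA Q \<eta> \<Delta> \<longleftrightarrow>
     atomless_on (sets X) (\<lambda>B. emeasure \<eta> (B \<inter> (space X - \<Delta>))) \<and>
     (\<exists>G. countable G \<and> G \<subseteq> sets X \<and>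
        (\<forall>x\<in>space X - \<Delta>. \<forall>a\<in>space (ActM SA).
           atomless_on (sigma_sets (space X) G) (\<lambda>B. emeasure (Q (x, a)) (B \<inter> (space X - \<Delta>)))))"

definition stoch_kernels ::
  "'x measure \<Rightarrow> 'a::polish_space set \<Rightarrow> ('x \<Rightarrow> 'a set) \<Rightarrow> ('x \<Rightarrow> 'a measure) set" where
  "stoch_kernels X SA Adm = {\<phi>. \<phi> \<in> measurable X (prob_algebra (ActM SA)) \<and>
       (\<forall>x\<in>space X. emeasure (\<phi> x) (Adm x) = 1)}"

definition chattering ::
  "'x measure \<Rightarrow> 'a::polish_space set \<Rightarrow> ('x \<Rightarrow> 'a set) \<Rightarrow> nat \<Rightarrow> ('x \<Rightarrow> 'a measure) set" where
  "chattering X SA Adm q = {\<gamma>. \<gamma> \<in> stoch_kernels X SA Adm \<and>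
     (\<exists>\<phi> \<beta>. (\<forall>i<q. \<phi> i \<in> measurable X (ActM SA) \<and> \<beta> i \<in> borel_measurable X) \<and>
        (\<forall>x\<in>space X. (\<forall>i<q. \<beta> i x \<ge> 0) \<and> (\<Sum>i<q. \<beta> i x) = 1 \<and>
           (\<forall>B\<in>sets (ActM SA). measure (\<gamma> x) B = (\<Sum>i<q. \<beta> i x * indicator B (\<phi> i x)))))}"

definition deterministic ::
  "'x measure \<Rightarrow> 'a::polish_space set \<Rightarrow> ('x \<Rightarrow> 'a set) \<Rightarrow> ('x \<Rightarrow> 'a) set" where
  "deterministic X SA Adm = {\<phi>. \<phi> \<in> measurable X (ActM SA) \<and> (\<forall>x\<in>space X. \<phi> x \<in> Adm x)}"

end

(*
  Let the noise u be uniform on (0, 1]. Every law of a state-action pair is the law of (x, a(x, u))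
  for a measurable a, which turns every policy into a Markov policy with the same laws of
  (X_t, A_t). Fix a Markov policy and a time n. As a function of the kernel used at time n, the
  vector of the 2d expected totals of the positive and negative parts of r is affine, so it is the
  average over u of the vectors obtained from the selectors x |-> a(x, u), and hence lies in the
  convex hull of the vectors of selectors. By Caratheodory, a mixture of 2d+1 selectors with
  constant weights therefore gives the same vector; no measurable selection theorem is needed. In
  the atomless case the vectors of selectors form a convex set by Lyapunov's theorem, so a single
  selector suffices. Kernels are replaced at times 0, 1, 2, ... in turn, and uniform absorption
  makes the error of the limit policy vanish.
*)
theory Submission
  imports Defs
begin

text \<open>The expected totals are not affine in the whole sequence of kernels, only in each kernel
  with the others held fixed; this forces the replacement of one time at a time. Positive and
  negative parts of the d components of \<open>r\<close> are kept apart: all quantities are then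
  nonnegative, Tonelli and densities apply directly, and the vectors have dimension 2d, so that
  Caratheodory yields 2d+1 terms. A mean must be placed in the convex hull itself and not only in
  its closure, since the hull of the selector vectors is not known to be closed.

  The state space is an arbitrary measurable space. Disintegration is therefore carried out on the
  Polish action coordinate, and Lyapunov's theorem is derived from a real function \<open>U\<close>
  of the state whose level sets are null outside \<Delta>. A mixture of atomless measures can have
  atoms; the countably generated sub-\<sigma>-algebra shared by all \<open>Q (x, a)\<close> with x
  outside \<Delta> is what gives one \<open>U\<close> for all of them, and hence for the state laws
  at positive times.\<close>

section \<open>Means in convex sets and Lyapunov's convexity theorem\<close>

text \<open>Induction on the dimension of \<open>D\<close>. If 0 were outside \<open>D\<close>, a
  hyperplane through 0 with normal \<open>a\<close> would have \<open>D\<close> on one side; as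
  \<open>a \<bullet> F x\<close> is nonnegative with mean 0, \<open>F\<close> lies in the hyperplane
  almost surely. Passing to the part of \<open>D\<close> in the hyperplane lowers the dimension
  because \<open>a\<close> is chosen in \<open>span D\<close>.\<close>

lemma zero_in_convex_if_mean_zero:
  fixes F :: "'b \<Rightarrow> 'a::euclidean_space"
  assumes "prob_space M" and F: "integrable M F" and mean: "integral\<^sup>L M F = 0"
    and "convex D" "AE x in M. F x \<in> D"
  shows "0 \<in> D"
  using assms(4,5)
proof (induction "dim D" arbitrary: D rule: less_induct)
  case less
  interpret prob_space M by fact
  show ?case
  proof (rule ccontr)
    assume 0: "0 \<notin> D"
    have "D \<noteq> {}"
      using less.prems(2) by (auto simp: AE_False)
    then obtain a where a: "a \<in> span D" "a \<noteq> 0" "\<And>x. x \<in> D \<Longrightarrow> 0 \<le> a \<bullet> x"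
      using separating_hyperplane_set_0_inspan[OF less.prems(1) _ 0] by metis
    have int: "integrable M (\<lambda>x. a \<bullet> F x)"
      using F by simp
    have "integral\<^sup>L M (\<lambda>x. a \<bullet> F x) = 0"
      using F mean by simp
    moreover have "AE x in M. 0 \<le> a \<bullet> F x"
      using less.prems(2) by eventually_elim (use a in auto)
    ultimately have "AE x in M. a \<bullet> F x = 0"
      using integral_nonneg_eq_0_iff_AE[OF int] by auto
    then have AE: "AE x in M. F x \<in> D \<inter> {x. a \<bullet> x = 0}"
      using less.prems(2) by eventually_elim auto
    have conv: "convex (D \<inter> {x. a \<bullet> x = 0})"
      by (intro convex_Int less.prems convex_hyperplane)
    have "span (D \<inter> {x. a \<bullet> x = 0}) \<subseteq> {x. a \<bullet> x = 0}"
      by (rule span_minimal) (auto simp: subspace_hyperplane)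
    then have "a \<notin> span (D \<inter> {x. a \<bullet> x = 0})"
      using a(2) by auto
    then have "span (D \<inter> {x. a \<bullet> x = 0}) \<subset> span D"
      using a(1) span_mono[of "D \<inter> {x. a \<bullet> x = 0}" D] by blast
    then have "dim (D \<inter> {x. a \<bullet> x = 0}) < dim D"
      by (rule dim_psubset)
    from less.hyps[OF this conv AE] 0 show False by simp
  qed
qed

lemma mean_in_convex_set:
  fixes F :: "'b \<Rightarrow> 'a::euclidean_space"
  assumes "prob_space M" and F: "integrable M F" and "convex C" "AE x in M. F x \<in> C"
  shows "integral\<^sup>L M F \<in> C"
proof -
  interpret prob_space M by fact
  let ?v = "integral\<^sup>L M F"
  have "0 \<in> (\<lambda>x. x - ?v) ` C"
  proof (rule zero_in_convex_if_mean_zero[OF \<open>prob_space M\<close>, where F = "\<lambda>x. F x - ?v"])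
    show "convex ((\<lambda>x. x - ?v) ` C)"
      using convex_translation_subtract[OF \<open>convex C\<close>, of ?v] by simp
    show "AE x in M. F x - ?v \<in> (\<lambda>x. x - ?v) ` C"
      using assms(4) by eventually_elim auto
  qed (use F in \<open>auto simp: prob_space\<close>)
  then show ?thesis by auto
qed

text \<open>One set \<open>B\<close> has to halve all members of \<open>F\<close> at once. In this
  form the property can be extended by one density at a time, which is the induction behind
  Lyapunov's theorem.\<close>

definition halvable :: "'x measure \<Rightarrow> ('x \<Rightarrow> ennreal) set \<Rightarrow> bool" where
  "halvable S F \<longleftrightarrow> (\<forall>E\<in>sets S. \<exists>B\<in>sets S. B \<subseteq> E \<and>
     (\<forall>f\<in>F. measure (density S f) B = measure (density S f) E / 2))"

text \<open>Repeated halving produces sets for all dyadic fractions of \<open>E\<close>, nested in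
  the order of the fractions; unions along the dyadic approximations from below reach every t in
  [0, 1].\<close>

lemma halvable_imp_increasing_family:
  assumes F: "\<And>f. f \<in> F \<Longrightarrow> f \<in> borel_measurable S" "\<And>f. f \<in> F \<Longrightarrow> (\<integral>\<^sup>+x. f x \<partial>S) < \<infinity>"
    and "halvable S F" and E: "E \<in> sets S"
  obtains B :: "real \<Rightarrow> 'x set" where "\<And>t. B t \<in> sets S" "\<And>t. B t \<subseteq> E"
    "\<And>s t. s \<le> t \<Longrightarrow> B s \<subseteq> B t"
    "\<And>f t. f \<in> F \<Longrightarrow> 0 \<le> t \<Longrightarrow> t \<le> 1 \<Longrightarrow> measure (density S f) (B t) = t * measure (density S f) E"
proof -
  obtain h where h: "\<And>A. A \<in> sets S \<Longrightarrow> h A \<in> sets S" "\<And>A. A \<in> sets S \<Longrightarrow> h A \<subseteq> A"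
    "\<And>A f. A \<in> sets S \<Longrightarrow> f \<in> F \<Longrightarrow> measure (density S f) (h A) = measure (density S f) A / 2"
    using \<open>halvable S F\<close> unfolding halvable_def by metis
  \<comment> \<open>\<open>C k j\<close> is the set of fraction j / 2 ^ k. Even indices repeat the
    previous level, odd ones add half of the layer between two neighbours. Indices above 2 ^ k give
    \<open>E\<close>, so that monotonicity and inclusion hold for all \<open>j\<close>.\<close>
  define C where "C = rec_nat (\<lambda>j::nat. if j = 0 then {} else E)
    (\<lambda>k c j. if even j then c (j div 2) else c (j div 2) \<union> h (c (Suc (j div 2)) - c (j div 2)))"
  have C0: "C 0 j = (if j = 0 then {} else E)" for j
    by (simp add: C_def)
  have CS: "C (Suc k) j = (if even j then C k (j div 2) else
      C k (j div 2) \<union> h (C k (Suc (j div 2)) - C k (j div 2)))" for k j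
    by (simp add: C_def)
  have sets: "C k j \<in> sets S" for k j
    by (induction k arbitrary: j) (auto simp: C0 CS E intro!: h sets.Un)
  have h': "h (C k i - C k j) \<subseteq> C k i - C k j" for k i j
    by (intro h sets.Diff sets)
  have mono1: "C k j \<subseteq> C k (Suc j)" for k j
  proof (induction k arbitrary: j)
    case (Suc k)
    show ?case
    proof (cases "even j")
      case False
      then have "Suc j div 2 = Suc (j div 2)" by simp
      then show ?thesis
        using False h'[of k "Suc (j div 2)" "j div 2"] Suc[of "j div 2"] by (auto simp: CS)
    qed (auto simp: CS)
  qed (auto simp: C0)
  have mono: "C k i \<subseteq> C k j" if "i \<le> j" for k i j
    using lift_Suc_mono_le[of "C k", OF mono1 that] .
  have sub: "C k j \<subseteq> E" for k j
  proof (induction k arbitrary: j)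
    case (Suc k)
    show ?case
      using Suc[of "j div 2"] Suc[of "Suc (j div 2)"] h'[of k "Suc (j div 2)" "j div 2"]
      by (auto simp: CS)
  qed (auto simp: C0)
  have fin: "finite_measure (density S f)" if "f \<in> F" for f
    using F[OF that] by (intro finite_measureI) (simp add: emeasure_density)
  have meas: "measure (density S f) (C k j) = j / 2 ^ k * measure (density S f) E"
    if f: "f \<in> F" and "j \<le> 2 ^ k" for f k j
    using that(2)
  proof (induction k arbitrary: j)
    case 0
    then show ?case by (cases j) (auto simp: C0)
  next
    case (Suc k)
    interpret finite_measure "density S f" by (rule fin[OF f])
    obtain m where m: "j = 2 * m \<or> j = Suc (2 * m)" by (metis oddE evenE Suc_eq_plus1)
    show ?case
    proof (cases "j = 2 * m")
      case True
      then show ?thesis using Suc by (simp add: CS field_simps)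
    next
      case False
      then have j: "j = Suc (2 * m)" using m by simp
      then have "Suc m \<le> 2 ^ k" using Suc.prems by simp
      note IH = Suc.IH[OF this] Suc.IH[of m]
      have "measure (density S f) (C (Suc k) j) =
        measure (density S f) (C k m) + measure (density S f) (h (C k (Suc m) - C k m))"
        unfolding CS j using h'[of k "Suc m" m] sets[of k] h(1)
        by (simp, subst finite_measure_Union) auto
      also have "measure (density S f) (h (C k (Suc m) - C k m)) =
          (measure (density S f) (C k (Suc m)) - measure (density S f) (C k m)) / 2"
        using mono1[of k m] sets[of k] f by (subst h(3)) (auto simp: finite_measure_Diff)
      finally show ?thesis
        using IH \<open>Suc m \<le> 2 ^ k\<close> j by (simp add: field_simps)
    qed
  qed
  \<comment> \<open>Rounding down makes the sets increase with \<open>k\<close>, since twice a floor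
    is at most the floor of the double; hence continuity from below gives the measure of
    \<open>B t\<close>.\<close>
  define B where "B t = (\<Union>k. C k (nat \<lfloor>t * 2 ^ k\<rfloor>))" for t :: real
  have inc: "C k (nat \<lfloor>t * 2 ^ k\<rfloor>) \<subseteq> C (Suc k) (nat \<lfloor>t * 2 ^ Suc k\<rfloor>)" for k and t :: real
  proof -
    have "C k (nat \<lfloor>t * 2 ^ k\<rfloor>) = C (Suc k) (2 * nat \<lfloor>t * 2 ^ k\<rfloor>)"
      by (simp add: CS)
    also have "\<dots> \<subseteq> C (Suc k) (nat \<lfloor>t * 2 ^ Suc k\<rfloor>)"
    proof (rule mono)
      have "2 * \<lfloor>t * 2 ^ k\<rfloor> \<le> \<lfloor>t * 2 ^ Suc k\<rfloor>"
        by (simp add: le_floor_iff)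
      then show "2 * nat \<lfloor>t * 2 ^ k\<rfloor> \<le> nat \<lfloor>t * 2 ^ Suc k\<rfloor>" by linarith
    qed
    finally show ?thesis .
  qed
  show thesis
  proof
    show "B t \<in> sets S" for t unfolding B_def using sets by auto
    show "B t \<subseteq> E" for t unfolding B_def using sub by auto
    show "B s \<subseteq> B t" if "s \<le> t" for s t
      unfolding B_def using that
      by (intro UN_mono mono nat_mono floor_mono mult_right_mono) auto
    show "measure (density S f) (B t) = t * measure (density S f) E"
      if f: "f \<in> F" and t: "0 \<le> t" "t \<le> 1" for f t
    proof -
      interpret finite_measure "density S f" by (rule fin[OF f])
      have "(\<lambda>k. measure (density S f) (C k (nat \<lfloor>t * 2 ^ k\<rfloor>))) \<longlonglongrightarrow> measure (density S f) (B t)"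
        unfolding B_def using sets inc by (intro finite_Lim_measure_incseq incseq_SucI inc) auto
      moreover have "(\<lambda>k. measure (density S f) (C k (nat \<lfloor>t * 2 ^ k\<rfloor>))) \<longlonglongrightarrow> t * measure (density S f) E"
      proof -
        have le: "nat \<lfloor>t * 2 ^ k\<rfloor> \<le> 2 ^ k" for k
        proof -
          have "\<lfloor>t * 2 ^ k\<rfloor> \<le> \<lfloor>2 ^ k :: real\<rfloor>" using t by (intro floor_mono) simp
          also have "\<dots> = 2 ^ k" by simp
          finally have "\<lfloor>t * 2 ^ k\<rfloor> \<le> 2 ^ k" .
          then show ?thesis by (simp add: nat_le_iff)
        qed
        have "(\<lambda>k. real (nat \<lfloor>t * 2 ^ k\<rfloor>) / 2 ^ k) \<longlonglongrightarrow> t"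
        proof (rule tendsto_sandwich)
          show "\<forall>\<^sub>F k in sequentially. t - (1/2) ^ k \<le> real (nat \<lfloor>t * 2 ^ k\<rfloor>) / 2 ^ k"
          proof (intro always_eventually allI)
            fix k
            have "(t * 2 ^ k - 1) / 2 ^ k \<le> real (nat \<lfloor>t * 2 ^ k\<rfloor>) / 2 ^ k"
              by (intro divide_right_mono) (linarith, simp)
            then show "t - (1/2) ^ k \<le> real (nat \<lfloor>t * 2 ^ k\<rfloor>) / 2 ^ k"
              by (simp add: diff_divide_distrib power_one_over)
          qed
          show "\<forall>\<^sub>F k in sequentially. real (nat \<lfloor>t * 2 ^ k\<rfloor>) / 2 ^ k \<le> t"
            using t by (intro always_eventually allI) (simp add: field_simps)
          have "(\<lambda>k. t - (1/2) ^ k) \<longlonglongrightarrow> t - 0"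
            by (intro tendsto_diff tendsto_const LIMSEQ_power_zero) auto
          then show "(\<lambda>k. t - (1/2) ^ k) \<longlonglongrightarrow> t" by simp
        qed auto
        then have "(\<lambda>k. real (nat \<lfloor>t * 2 ^ k\<rfloor>) / 2 ^ k * measure (density S f) E) \<longlonglongrightarrow> t * measure (density S f) E"
          by (intro tendsto_mult tendsto_const)
        then show ?thesis using meas[OF f le] by simp
      qed
      ultimately show ?thesis by (rule LIMSEQ_unique)
    qed
  qed
qed

text \<open>Along the family \<open>B t\<close>, which is linear in \<open>t\<close> for all members
  of \<open>F\<close>, the measure with density \<open>f\<close> is Lipschitz because it is
  dominated by that of \<open>g\<close>. The intermediate value theorem then finds a window of
  length 1/2 in \<open>t\<close> that carries half of the \<open>f\<close>-measure.\<close>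

lemma halvable_insert_dominated:
  assumes F: "\<And>f. f \<in> F \<Longrightarrow> f \<in> borel_measurable S" "\<And>f. f \<in> F \<Longrightarrow> (\<integral>\<^sup>+x. f x \<partial>S) < \<infinity>"
    and half: "halvable S F" and g: "g \<in> F" and f: "f \<in> borel_measurable S" "\<And>x. f x \<le> g x"
  shows "halvable S (insert f F)"
  unfolding halvable_def
proof
  fix E assume E: "E \<in> sets S"
  from halvable_imp_increasing_family[OF F half E] obtain B :: "real \<Rightarrow> 'a set" where
    B: "\<And>t. B t \<in> sets S" "\<And>t. B t \<subseteq> E" "\<And>s t. s \<le> t \<Longrightarrow> B s \<subseteq> B t"
    "\<And>f t. f \<in> F \<Longrightarrow> 0 \<le> t \<Longrightarrow> t \<le> 1 \<Longrightarrow> measure (density S f) (B t) = t * measure (density S f) E"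
    by metis
  have fin: "finite_measure (density S f)" if "f \<in> F" for f
    using F[OF that] by (intro finite_measureI) (simp add: emeasure_density)
  have "(\<integral>\<^sup>+x. f x \<partial>S) \<le> (\<integral>\<^sup>+x. g x \<partial>S)" using f by (intro nn_integral_mono) auto
  then have "(\<integral>\<^sup>+x. f x \<partial>S) < \<infinity>" using F(2)[OF g] by (auto intro: le_less_trans)
  then interpret f: finite_measure "density S f"
    using f by (intro finite_measureI) (simp add: emeasure_density)
  interpret g: finite_measure "density S g" by (rule fin[OF g])
  have dom: "measure (density S f) A \<le> measure (density S g) A" if "A \<in> sets S" for A
  proof -
    have "emeasure (density S f) A \<le> emeasure (density S g) A"
      using that f F(1)[OF g]
      by (subst (1 2) emeasure_density) (auto intro!: nn_integral_mono mult_right_mono)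
    then show ?thesis by (simp add: f.emeasure_eq_measure g.emeasure_eq_measure)
  qed
  let ?f = "\<lambda>A. measure (density S f) A" and ?g = "\<lambda>A. measure (density S g) A"
  have lip: "\<bar>?f (B t) - ?f (B s)\<bar> \<le> \<bar>t - s\<bar> * ?g E" if "s \<in> {0..1}" "t \<in> {0..1}" for s t
    using that
  proof (induction s t rule: linorder_wlog)
    case (le s t)
    then have sub: "B s \<subseteq> B t" by (intro B(3)) auto
    have "?f (B t) - ?f (B s) = ?f (B t - B s)"
      using B(1) sub by (simp add: f.finite_measure_Diff)
    moreover have "?f (B t - B s) \<le> ?g (B t - B s)"
      using B(1) by (intro dom sets.Diff)
    moreover have "?g (B t - B s) = ?g (B t) - ?g (B s)"
      using B(1) sub by (simp add: g.finite_measure_Diff)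
    moreover have "\<dots> = (t - s) * ?g E"
      using B(4)[OF g, of s] B(4)[OF g, of t] le by (simp add: algebra_simps)
    ultimately show ?case using le measure_nonneg[of "density S f" "B t - B s"] by simp
  next
    case (sym s t)
    then show ?case by (simp add: abs_minus_commute)
  qed
  have cont: "continuous_on {0..1} (\<lambda>t. ?f (B t))"
  proof (rule continuous_onI)
    fix x e :: real assume x: "x \<in> {0..1}" and e: "0 < e"
    show "\<exists>d>0. \<forall>x'\<in>{0..1}. dist x' x < d \<longrightarrow> dist (?f (B x')) (?f (B x)) \<le> e"
    proof (intro exI[of _ "e / (?g E + 1)"] conjI ballI impI)
      have pos: "0 < ?g E + 1" using measure_nonneg[of "density S g" E] by linarith
      then show "0 < e / (?g E + 1)" using e by simp
      fix x' :: real assume x': "x' \<in> {0..1}" "dist x' x < e / (?g E + 1)"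
      have "dist (?f (B x')) (?f (B x)) \<le> \<bar>x' - x\<bar> * ?g E"
        using lip[OF x x'(1)] by (simp add: dist_real_def)
      also have "\<dots> \<le> \<bar>x' - x\<bar> * (?g E + 1)" by (intro mult_left_mono) auto
      also have "\<dots> \<le> e" using x'(2) pos by (simp add: dist_real_def field_simps)
      finally show "dist (?f (B x')) (?f (B x)) \<le> e" .
    qed
  qed
  \<comment> \<open>\<open>?p 0\<close> and \<open>?p (1/2)\<close> add up to the
    \<open>f\<close>-measure of \<open>E\<close>, so one is at most and the other at least half of
    it. Every \<open>B (s + 1/2) - B s\<close> already halves the members of \<open>F\<close>, as
    the two parameters differ by 1/2.\<close>
  let ?p = "\<lambda>s. ?f (B (s + 1/2)) - ?f (B s)"
  have cp: "continuous_on {0..1/2} ?p"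
    by (intro continuous_intros continuous_on_compose2[OF cont]) auto
  have z: "?f (B 0) = 0"
    using dom[OF B(1), of 0] B(4)[OF g, of 0] measure_nonneg[of "density S f" "B 0"] by simp
  \<comment> \<open>\<open>B 1\<close> may be smaller than \<open>E\<close>, but the difference is
    null for \<open>g\<close> and hence for the dominated \<open>f\<close>.\<close>
  have o: "?f (B 1) = ?f E"
  proof -
    have "?f E - ?f (B 1) = ?f (E - B 1)" using B E by (simp add: f.finite_measure_Diff)
    moreover have "?f (E - B 1) \<le> ?g (E - B 1)" using B E by (intro dom) auto
    moreover have "?g (E - B 1) = 0" using B E g by (simp add: g.finite_measure_Diff)
    ultimately show ?thesis using measure_nonneg[of "density S f" "E - B 1"] by linarith
  qed
  have "\<exists>s\<ge>0. s \<le> 1/2 \<and> ?p s = ?f E / 2"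
  proof (cases "?p 0 \<le> ?f E / 2")
    case True
    then show ?thesis using cp z o by (intro IVT') auto
  next
    case False
    then show ?thesis using cp z o by (intro IVT2') auto
  qed
  then obtain s where s: "0 \<le> s" "s \<le> 1/2" "?p s = ?f E / 2" by auto
  have sub: "B s \<subseteq> B (s + 1/2)" by (intro B) auto
  show "\<exists>B\<in>sets S. B \<subseteq> E \<and>
     (\<forall>f\<in>insert f F. measure (density S f) B = measure (density S f) E / 2)"
  proof (intro bexI[of _ "B (s + 1/2) - B s"] conjI ballI)
    fix f' assume "f' \<in> insert f F"
    then show "measure (density S f') (B (s + 1/2) - B s) = measure (density S f') E / 2"
    proof
      assume "f' = f" then show ?thesis using s B(1) sub by (simp add: f.finite_measure_Diff)
    next
      assume f': "f' \<in> F"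
      interpret f': finite_measure "density S f'" by (rule fin[OF f'])
      show ?thesis using s B(1) sub B(4)[OF f', of s] B(4)[OF f', of "s + 1/2"]
        by (simp add: f'.finite_measure_Diff algebra_simps)
    qed
  qed (use B in auto)
qed

text \<open>On \<open>E\<close> the distribution function of \<open>U\<close> under the density
  \<open>f\<close> is continuous, because no level set of \<open>U\<close> has mass. It therefore
  passes through half of the total mass, and a sublevel set does the halving.\<close>

lemma halvable_singleton:
  assumes f: "f \<in> borel_measurable S" "(\<integral>\<^sup>+x. f x \<partial>S) < \<infinity>" and U: "U \<in> borel_measurable S"
    and null: "\<And>c::real. AE x in S. U x = c \<longrightarrow> f x = 0"
  shows "halvable S {f}"
  unfolding halvable_def
proof
  fix E assume E: "E \<in> sets S"
  define g where "g x = f x * indicator E x" for x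
  have [measurable]: "f \<in> borel_measurable S" "U \<in> borel_measurable S" "E \<in> sets S" by fact+
  have g[measurable]: "g \<in> borel_measurable S" unfolding g_def by measurable
  have "(\<integral>\<^sup>+x. g x \<partial>S) \<le> (\<integral>\<^sup>+x. f x \<partial>S)"
    by (intro nn_integral_mono) (auto simp: g_def indicator_def)
  then have "(\<integral>\<^sup>+x. g x \<partial>S) < \<infinity>" using f(2) by (auto intro: le_less_trans)
  then interpret g: finite_measure "density S g"
    by (intro finite_measureI) (simp add: emeasure_density)
  interpret f: finite_measure "density S f"
    using f by (intro finite_measureI) (simp add: emeasure_density)
  define N where "N = distr (density S g) borel U"
  interpret N: finite_borel_measure N
    unfolding N_def by (intro finite_borel_measure.intro g.finite_measure_distr)
      (auto simp: finite_borel_measure_axioms_def)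
  have cdf: "cdf N t = measure (density S f) (E \<inter> (U -` {..t} \<inter> space S))" for t
  proof -
    have "emeasure (density S g) (U -` {..t} \<inter> space S) =
        emeasure (density S f) (E \<inter> (U -` {..t} \<inter> space S))"
      by (subst (1 2) emeasure_density)
        (auto intro!: nn_integral_cong simp: g_def indicator_def)
    then show ?thesis
      unfolding cdf_def N_def by (subst measure_distr) (auto simp: measure_def)
  qed
  have tot: "measure N (space N) = measure (density S f) E"
  proof -
    have "emeasure (density S g) (space S) = emeasure (density S f) E"
      using sets.sets_into_space[OF E]
      by (subst (1 2) emeasure_density) (auto intro!: nn_integral_cong simp: g_def indicator_def)
    then show ?thesis
      unfolding N_def by (subst measure_distr) (auto simp: measure_def)
  qed
  have "isCont (cdf N) t" for t
  proof -
    have "emeasure (density S g) (U -` {t} \<inter> space S) =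
        (\<integral>\<^sup>+x. g x * indicator (U -` {t} \<inter> space S) x \<partial>S)"
      by (rule emeasure_density) auto
    also have "\<dots> = (\<integral>\<^sup>+x. 0 \<partial>S)"
    proof (rule nn_integral_cong_AE)
      show "AE x in S. g x * indicator (U -` {t} \<inter> space S) x = 0"
        using null[of t] by eventually_elim (auto simp: g_def indicator_def)
    qed
    finally have "emeasure (density S g) (U -` {t} \<inter> space S) = 0" by simp
    then have "measure N {t} = 0"
      unfolding N_def by (subst measure_distr) (auto simp: measure_def)
    then show ?thesis by (simp add: N.isCont_cdf)
  qed
  then have cont: "\<And>a b. continuous_on {a..b} (cdf N)"
    by (simp add: continuous_at_imp_continuous_on)
  let ?m = "measure (density S f) E"
  show "\<exists>B\<in>sets S. B \<subseteq> E \<and> (\<forall>f\<in>{f}. measure (density S f) B = measure (density S f) E / 2)"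
  proof (cases "?m = 0")
    case True
    then show ?thesis by (intro bexI[of _ E]) (auto simp: E)
  next
    case False
    then have pos: "0 < ?m" using zero_less_measure_iff by blast
    have "\<forall>\<^sub>F t in at_bot. cdf N t < ?m / 2"
      using order_tendstoD(2)[OF N.cdf_lim_at_bot, of "?m / 2"] pos by simp
    moreover have "\<forall>\<^sub>F t in at_top. ?m / 2 < cdf N t"
      using order_tendstoD(1)[OF N.cdf_lim_at_top, of "?m / 2"] pos tot by simp
    ultimately obtain a b where a: "\<And>t. t \<le> a \<Longrightarrow> cdf N t < ?m / 2" and b: "\<And>t. t \<ge> b \<Longrightarrow> ?m / 2 < cdf N t"
      unfolding eventually_at_top_linorder eventually_at_bot_linorder by auto
    have "\<exists>t\<ge>min a b. t \<le> max a b \<and> cdf N t = ?m / 2"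
      using a[of "min a b"] b[of "max a b"] by (intro IVT' cont) auto
    then obtain t where "cdf N t = ?m / 2" by auto
    then show ?thesis
      by (intro bexI[of _ "E \<inter> (U -` {..t} \<inter> space S)"]) (auto simp: cdf)
  qed
qed

text \<open>The sum \<open>g\<close> of all densities dominates each of them and inherits their null
  level sets, so \<open>{g}\<close> is halvable and the members of \<open>F\<close> can be inserted
  one by one. The set for the fraction \<open>t\<close> is then read off from the increasing
  family.\<close>

lemma lyapunov:
  fixes U :: "'x \<Rightarrow> real" and t :: real
  assumes "finite F" and F: "\<And>f. f \<in> F \<Longrightarrow> f \<in> borel_measurable S" "\<And>f. f \<in> F \<Longrightarrow> (\<integral>\<^sup>+x. f x \<partial>S) < \<infinity>"
    and U: "U \<in> borel_measurable S"
    and null: "\<And>f c. f \<in> F \<Longrightarrow> AE x in S. U x = c \<longrightarrow> f x = 0"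
    and t: "0 \<le> t" "t \<le> 1"
  obtains B where "B \<in> sets S"
    "\<And>f. f \<in> F \<Longrightarrow> measure (density S f) B = t * measure (density S f) (space S)"
proof -
  define g where "g x = (\<Sum>f\<in>F. f x)" for x
  have gm: "g \<in> borel_measurable S" unfolding g_def using F by measurable
  have gi: "(\<integral>\<^sup>+x. g x \<partial>S) < \<infinity>"
    unfolding g_def using F \<open>finite F\<close> by (subst nn_integral_sum) auto
  have gn: "AE x in S. U x = c \<longrightarrow> g x = 0" for c
    using AE_finite_allI[where Q = "\<lambda>f x. U x = c \<longrightarrow> f x = 0", OF \<open>finite F\<close> null]
    by (auto elim!: eventually_mono simp: g_def intro!: sum.neutral)
  have le: "f x \<le> g x" if "f \<in> F" for f x
    unfolding g_def using \<open>finite F\<close> that by (intro member_le_sum) auto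
  have "halvable S (insert g G)" if "G \<subseteq> F" "finite G" for G
    using that(2,1)
  proof (induction G rule: finite_induct)
    case empty
    then show ?case using halvable_singleton[OF gm gi U gn] by simp
  next
    case (insert f G)
    have "halvable S (insert f (insert g G))"
    proof (rule halvable_insert_dominated[where g = g])
      show "halvable S (insert g G)" using insert by auto
      fix h assume "h \<in> insert g G"
      then have "h = g \<or> h \<in> F" using insert.prems by auto
      then show "h \<in> borel_measurable S" "(\<integral>\<^sup>+x. h x \<partial>S) < \<infinity>" using F gm gi by auto
    qed (use insert.prems F le in auto)
    then show ?case by (simp add: insert_commute)
  qed
  from this[OF _ \<open>finite F\<close>] have "halvable S (insert g F)" by simp
  from halvable_imp_increasing_family[OF _ _ this sets.top] obtain B :: "real \<Rightarrow> 'x set" where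
    "\<And>t. B t \<in> sets S"
    "\<And>f t. f \<in> insert g F \<Longrightarrow> 0 \<le> t \<Longrightarrow> t \<le> 1 \<Longrightarrow> measure (density S f) (B t) = t * measure (density S f) (space S)"
    using F gm gi by (metis insert_iff)
  then show thesis using t by (intro that[of "B t"]) auto
qed

section \<open>Separating families of measurable sets\<close>

text \<open>Base 3 with digits 0 and 1 only: everything after the first digit contributes at most
  1/6, so the first digit is 1 iff the value is at least 1/3. Digits can thus be read off by a
  threshold, without the double expansions of base 2.\<close>

definition ternary_code :: "(nat \<Rightarrow> bool) \<Rightarrow> real" where
  "ternary_code b = (\<Sum>n. of_bool (b n) * (1/3) ^ Suc n)"

text \<open>If \<open>y\<close> codes \<open>b\<close>, then \<open>b k\<close> holds iff \<open>ternary_tail k y \<ge> 1/3\<close>.\<close>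
primrec ternary_tail :: "nat \<Rightarrow> real \<Rightarrow> real" where
  "ternary_tail 0 y = y"
| "ternary_tail (Suc k) y = 3 * ternary_tail k y - of_bool (ternary_tail k y \<ge> 1/3)"

lemma ternary_summable: "summable (\<lambda>n. of_bool (b n) * (1/3) ^ Suc n :: real)"
  by (rule summable_comparison_test'[OF summable_mult[OF summable_geometric[of "1/3::real"], of "1/3"]])
    (auto simp: of_bool_def)

lemma ternary_code_nonneg: "0 \<le> ternary_code b"
  unfolding ternary_code_def by (intro suminf_nonneg ternary_summable) auto

lemma ternary_code_le: "ternary_code b \<le> 1/2"
proof -
  have "(\<lambda>n. (1/3) ^ n :: real) sums (1 / (1 - 1/3))" by (rule geometric_sums) simp
  then have "(\<lambda>n. (1/3) * (1/3) ^ n :: real) sums (1/3 * (1 / (1 - 1/3)))" by (rule sums_mult)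
  then have s: "(\<lambda>n. (1/3) ^ Suc n :: real) sums (1/2)" by simp
  have "ternary_code b \<le> (\<Sum>n. (1/3) ^ Suc n)"
    unfolding ternary_code_def by (intro suminf_le ternary_summable sums_summable[OF s]) auto
  then show ?thesis using sums_unique[OF s] by simp
qed

lemma ternary_code_split: "3 * ternary_code b = of_bool (b 0) + ternary_code (\<lambda>n. b (Suc n))"
proof -
  have "ternary_code b = of_bool (b 0) * (1/3) + (\<Sum>n. of_bool (b (Suc n)) * (1/3) ^ Suc (Suc n))"
    unfolding ternary_code_def by (subst suminf_split_head[OF ternary_summable]) (simp add: power_Suc)
  also have "(\<Sum>n. of_bool (b (Suc n)) * (1/3) ^ Suc (Suc n)) =
      (1/3) * ternary_code (\<lambda>n. b (Suc n))"
    unfolding ternary_code_def by (subst suminf_mult[OF ternary_summable, symmetric]) (simp add: ac_simps)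
  finally show ?thesis by simp
qed

lemma ternary_code_ge_third: "1/3 \<le> ternary_code b \<longleftrightarrow> b 0"
  using ternary_code_split[of b] ternary_code_nonneg[of "\<lambda>n. b (Suc n)"]
    ternary_code_le[of "\<lambda>n. b (Suc n)"] by (cases "b 0") auto

lemma ternary_tail_code: "ternary_tail k (ternary_code b) = ternary_code (\<lambda>n. b (n + k))"
proof (induction k)
  case (Suc k)
  show ?case
    using ternary_code_split[of "\<lambda>n. b (n + k)"] ternary_code_ge_third[of "\<lambda>n. b (n + k)"]
    by (simp add: Suc)
qed simp

lemma ternary_digit_code: "1/3 \<le> ternary_tail k (ternary_code b) \<longleftrightarrow> b k"
  using ternary_code_ge_third[of "\<lambda>n. b (n + k)"] by (simp add: ternary_tail_code)

lemma measurable_ternary_tail[measurable]: "ternary_tail k \<in> borel_measurable borel"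
  by (induction k) (auto intro!: borel_measurable_diff borel_measurable_times simp: of_bool_def)

lemma measurable_ternary_code[measurable]:
  assumes "\<And>n. Measurable.pred M (\<lambda>x. b x n)"
  shows "(\<lambda>x. ternary_code (b x)) \<in> borel_measurable M"
  unfolding ternary_code_def using assms by measurable

text \<open>The Marczewski function of the family: membership in countably many sets is coded by one
  real number, so each level set of \<open>U\<close> stays inside a class of points lying in the
  same members of \<open>G\<close>.\<close>

lemma ex_code_of_countable_family:
  assumes "countable G" "G \<subseteq> sets M"
  obtains U :: "'a \<Rightarrow> real" where "U \<in> borel_measurable M"
    "\<And>x y A. U x = U y \<Longrightarrow> A \<in> G \<Longrightarrow> x \<in> A \<longleftrightarrow> y \<in> A"
proof
  \<comment> \<open>The added empty set makes the family nonempty, so that it can be enumerated, and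
    separates no points.\<close>
  define e where "e = from_nat_into (insert {} G)"
  have G: "range e = insert {} G"
    unfolding e_def using assms by (intro range_from_nat_into) auto
  have e: "e n \<in> sets M" for n using G assms by (metis insert_subset rangeI sets.empty_sets subsetD)
  show "(\<lambda>x. ternary_code (\<lambda>n. x \<in> e n)) \<in> borel_measurable M"
    using e by measurable
  fix x y A assume "ternary_code (\<lambda>n. x \<in> e n) = ternary_code (\<lambda>n. y \<in> e n)" "A \<in> G"
  moreover obtain n where "e n = A" using G \<open>A \<in> G\<close> by (metis insertI2 imageE)
  ultimately show "x \<in> A \<longleftrightarrow> y \<in> A"
    using ternary_digit_code[of n "\<lambda>n. x \<in> e n"] ternary_digit_code[of n "\<lambda>n. y \<in> e n"] by simp
qed

lemma (in sigma_algebra) same_members_in_sets: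
  assumes "countable G" "G \<subseteq> M"
  shows "{y\<in>\<Omega>. \<forall>A\<in>G. y \<in> A \<longleftrightarrow> x \<in> A} \<in> M"
proof (rule sets_Collect_countable_All'[OF _ assms(1)])
  fix A assume "A \<in> G"
  then have A: "A \<in> M" "A \<subseteq> \<Omega>" using assms space_closed by auto
  show "{y\<in>\<Omega>. y \<in> A \<longleftrightarrow> x \<in> A} \<in> M"
  proof (cases "x \<in> A")
    case True
    then have "{y\<in>\<Omega>. y \<in> A \<longleftrightarrow> x \<in> A} = A" using A by auto
    with A show ?thesis by argo
  next
    case False
    then have "{y\<in>\<Omega>. y \<in> A \<longleftrightarrow> x \<in> A} = \<Omega> - A" by auto
    then show ?thesis using compl_sets[OF A(1)] by argo
  qed
qed

lemma atomless_on_cong: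
  assumes "\<And>B. B \<in> F \<Longrightarrow> m B = m' B" shows "atomless_on F m = atomless_on F m'"
  by (simp add: atomless_on_def assms cong: bex_cong)

text \<open>No set generated by \<open>G\<close> separates two points of such a class. The class
  belongs to the generated \<sigma>-algebra as \<open>G\<close> is countable, so with positive mass
  it would be an atom.\<close>

lemma atomless_generated_imp_null_class:
  assumes G: "countable G" "G \<subseteq> Pow \<Omega>" and "m {} = 0" "atomless_on (sigma_sets \<Omega> G) m" and x: "x \<in> \<Omega>"
  shows "m {y\<in>\<Omega>. \<forall>A\<in>G. y \<in> A \<longleftrightarrow> x \<in> A} = 0"
proof (rule ccontr)
  define B where "B = {y\<in>\<Omega>. \<forall>A\<in>G. y \<in> A \<longleftrightarrow> x \<in> A}"
  assume "m {y\<in>\<Omega>. \<forall>A\<in>G. y \<in> A \<longleftrightarrow> x \<in> A} \<noteq> 0"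
  then have "0 < m B" unfolding B_def by (rule zero_less_iff_neq_zero[THEN iffD2])
  interpret sigma_algebra \<Omega> "sigma_sets \<Omega> G" by (rule sigma_algebra_sigma_sets[OF G(2)])
  have B: "B \<in> sigma_sets \<Omega> G"
    unfolding B_def by (rule same_members_in_sets) (use G in auto)
  have C: "C = {} \<or> C = B" if C: "C \<in> sigma_sets \<Omega> G" "C \<subseteq> B" for C
  proof -
    have "x \<in> C \<longleftrightarrow> y \<in> C" if "y \<in> B" for y
      using C(1)
    proof induction
      case (Basic A)
      then show ?case using that by (simp add: B_def)
    next
      case (Compl A)
      then show ?case using that x by (simp add: B_def)
    qed auto
    then show ?thesis using C(2) by blast
  qed
  have "\<not> (\<forall>C\<in>sigma_sets \<Omega> G. C \<subseteq> B \<longrightarrow> m C = 0 \<or> m C = m B)"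
    using assms(4) B \<open>0 < m B\<close> unfolding atomless_on_def by blast
  moreover have "\<forall>C\<in>sigma_sets \<Omega> G. C \<subseteq> B \<longrightarrow> m C = 0 \<or> m C = m B"
    using C assms(3) by metis
  ultimately show False ..
qed

text \<open>The family \<open>G\<close> minimises the product measure of the relation
  ``\<open>x\<close> and \<open>y\<close> lie in the same members of the family'': an equivalence class of positive
  measure could be split, and adding a piece to \<open>G\<close> would decrease that measure.\<close>
lemma atomless_imp_ex_separating_family:
  assumes "finite_measure \<nu>" and atomless: "atomless_on (sets \<nu>) (emeasure \<nu>)"
  obtains G where "countable G" "G \<subseteq> sets \<nu>"
    "\<And>x. x \<in> space \<nu> \<Longrightarrow> emeasure \<nu> {y\<in>space \<nu>. \<forall>A\<in>G. y \<in> A \<longleftrightarrow> x \<in> A} = 0"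
proof -
  interpret finite_measure \<nu> by fact
  interpret PP: finite_measure "\<nu> \<Otimes>\<^sub>M \<nu>"
    by (rule finite_measure_pair_measure[OF assms(1) assms(1)])
  define R where "R G = {p\<in>space (\<nu> \<Otimes>\<^sub>M \<nu>). \<forall>A\<in>G. fst p \<in> A \<longleftrightarrow> snd p \<in> A}" for G
  define \<psi> where "\<psi> G = measure (\<nu> \<Otimes>\<^sub>M \<nu>) (R G)" for G
  let ?\<G> = "{G. countable G \<and> G \<subseteq> sets \<nu>}"
  have R: "R G \<in> sets (\<nu> \<Otimes>\<^sub>M \<nu>)" if "G \<in> ?\<G>" for G
    unfolding R_def
  proof (rule sets.sets_Collect_countable_All')
    fix A assume "A \<in> G"
    then have [measurable]: "A \<in> sets \<nu>" using that by auto
    have "Measurable.pred (\<nu> \<Otimes>\<^sub>M \<nu>) (\<lambda>p. fst p \<in> A)" "Measurable.pred (\<nu> \<Otimes>\<^sub>M \<nu>) (\<lambda>p. snd p \<in> A)"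
      by measurable
    then have "Measurable.pred (\<nu> \<Otimes>\<^sub>M \<nu>) (\<lambda>p. fst p \<in> A \<longleftrightarrow> snd p \<in> A)"
      by (rule pred_intros_logic)
    then show "{p\<in>space (\<nu> \<Otimes>\<^sub>M \<nu>). fst p \<in> A \<longleftrightarrow> snd p \<in> A} \<in> sets (\<nu> \<Otimes>\<^sub>M \<nu>)"
      by (simp add: pred_def)
  qed (use that in auto)
  define s where "s = (INF G\<in>?\<G>. \<psi> G)"
  have bdd: "bdd_below (\<psi> ` ?\<G>)" by (intro bdd_belowI[of _ 0]) (auto simp: \<psi>_def)
  have s: "s \<le> \<psi> G" if "G \<in> ?\<G>" for G unfolding s_def using bdd that by (intro cINF_lower)
  have "\<exists>G\<in>?\<G>. \<psi> G < s + 1 / Suc n" for n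
    unfolding s_def using bdd by (intro cINF_less_iff[THEN iffD1]) (auto intro!: exI[of _ "{}"])
  then obtain g where g: "\<And>n. g n \<in> ?\<G>" "\<And>n. \<psi> (g n) < s + 1 / Suc n" by metis
  \<comment> \<open>Enlarging a family shrinks its relation, so the union of a minimising sequence
    attains the infimum.\<close>
  define G where "G = (\<Union>n. g n)"
  have G: "G \<in> ?\<G>" using g unfolding G_def by auto
  have "\<psi> G \<le> s"
  proof (rule field_le_epsilon)
    fix e :: real assume "0 < e"
    then obtain n where n: "1 / Suc n < e" using nat_approx_posE by blast
    have "\<psi> G \<le> \<psi> (g n)" unfolding \<psi>_def
      by (intro PP.finite_measure_mono R g) (auto simp: R_def G_def)
    then show "\<psi> G \<le> s + e" using g(2)[of n] n by linarith
  qed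
  show thesis
  proof
    show "countable G" "G \<subseteq> sets \<nu>" using G by auto
    fix x assume x: "x \<in> space \<nu>"
    define B where "B = {y\<in>space \<nu>. \<forall>A\<in>G. y \<in> A \<longleftrightarrow> x \<in> A}"
    have "emeasure \<nu> B = 0"
    proof (rule ccontr)
      assume pos: "emeasure \<nu> B \<noteq> 0"
      have B: "B \<in> sets \<nu>" using pos emeasure_notin_sets by blast
      obtain C where C: "C \<in> sets \<nu>" "C \<subseteq> B" "emeasure \<nu> C \<noteq> 0" "emeasure \<nu> C \<noteq> emeasure \<nu> B"
      proof -
        have "0 < emeasure \<nu> B" using pos by (rule zero_less_iff_neq_zero[THEN iffD2])
        with atomless B have "\<not> (\<forall>C\<in>sets \<nu>. C \<subseteq> B \<longrightarrow> emeasure \<nu> C = 0 \<or> emeasure \<nu> C = emeasure \<nu> B)"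
          unfolding atomless_on_def by blast
        then show thesis using that by blast
      qed
      have D: "measure \<nu> (B - C) = measure \<nu> B - measure \<nu> C"
        using B C by (intro finite_measure_Diff)
      have "0 < measure \<nu> C" using C(3) by (simp add: emeasure_eq_measure zero_less_measure_iff)
      moreover have "0 < measure \<nu> (B - C)"
      proof -
        have "measure \<nu> C \<noteq> measure \<nu> B" using C(4) by (auto simp: emeasure_eq_measure)
        then show ?thesis using D finite_measure_mono[OF C(2) B] by linarith
      qed
      ultimately have p: "0 < measure \<nu> C * measure \<nu> (B - C)" by simp
      have pr: "measure (\<nu> \<Otimes>\<^sub>M \<nu>) (C \<times> (B - C)) = measure \<nu> C * measure \<nu> (B - C)"
        using B C by (simp add: measure_def emeasure_pair_measure_Times enn2real_mult)
      \<comment> \<open>All of \<open>B\<close> is one class under \<open>G\<close>, hence the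
        rectangle belongs to the relation; once \<open>C\<close> is added to the family, these pairs
        are separated and their positive mass is lost.\<close>
      have sub: "C \<times> (B - C) \<subseteq> R G"
        using C(2) by (auto simp: R_def B_def space_pair_measure)
      have "\<psi> (insert C G) \<le> measure (\<nu> \<Otimes>\<^sub>M \<nu>) (R G - C \<times> (B - C))"
        unfolding \<psi>_def using R[OF G] B C
        by (intro PP.finite_measure_mono) (auto simp: R_def)
      also have "\<dots> = \<psi> G - measure \<nu> C * measure \<nu> (B - C)"
        unfolding \<psi>_def pr[symmetric] using R[OF G] B C sub by (intro PP.finite_measure_Diff) auto
      finally have "\<psi> (insert C G) < s" using p \<open>\<psi> G \<le> s\<close> by linarith
      moreover have "s \<le> \<psi> (insert C G)" using G C by (intro s) auto
      ultimately show False by linarith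
    qed
    then show "emeasure \<nu> {y\<in>space \<nu>. \<forall>A\<in>G. y \<in> A \<longleftrightarrow> x \<in> A} = 0" unfolding B_def .
  qed
qed

section \<open>Representing a joint law by uniform noise\<close>

text \<open>Splitting a set along g \<le> f shows that \<open>max f g\<close> and \<open>g\<close>
  have the same integral over every measurable set; on a finite measure space these integrals
  determine the density almost everywhere, even with infinite values.\<close>

lemma (in finite_measure) AE_le_if_set_nn_integral_le:
  assumes [measurable]: "f \<in> borel_measurable M" "g \<in> borel_measurable M"
    and le: "\<And>A. A \<in> sets M \<Longrightarrow> (\<integral>\<^sup>+x. f x * indicator A x \<partial>M) \<le> (\<integral>\<^sup>+x. g x * indicator A x \<partial>M)"
  shows "AE x in M. f x \<le> (g x :: ennreal)"
proof -
  have "AE x in M. max (f x) (g x) = g x"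
  proof (rule density_unique_finite_measure)
    fix A assume [measurable]: "A \<in> sets M"
    let ?C = "{x\<in>space M. g x \<le> f x}"
    have "(\<integral>\<^sup>+x. max (f x) (g x) * indicator A x \<partial>M) =
      (\<integral>\<^sup>+x. f x * indicator (A \<inter> ?C) x + g x * indicator (A - ?C) x \<partial>M)"
      by (intro nn_integral_cong) (auto simp: indicator_def max_def)
    also have "\<dots> = (\<integral>\<^sup>+x. f x * indicator (A \<inter> ?C) x \<partial>M) + (\<integral>\<^sup>+x. g x * indicator (A - ?C) x \<partial>M)"
      by (intro nn_integral_add) auto
    also have "\<dots> \<le> (\<integral>\<^sup>+x. g x * indicator (A \<inter> ?C) x \<partial>M) + (\<integral>\<^sup>+x. g x * indicator (A - ?C) x \<partial>M)"
      by (intro add_mono le order_refl) measurable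
    also have "\<dots> = (\<integral>\<^sup>+x. g x * indicator (A \<inter> ?C) x + g x * indicator (A - ?C) x \<partial>M)"
      by (intro nn_integral_add[symmetric]) auto
    also have "\<dots> = (\<integral>\<^sup>+x. g x * indicator A x \<partial>M)"
      by (intro nn_integral_cong) (auto simp: indicator_def)
    finally have "(\<integral>\<^sup>+x. max (f x) (g x) * indicator A x \<partial>M) \<le> (\<integral>\<^sup>+x. g x * indicator A x \<partial>M)" .
    moreover have "(\<integral>\<^sup>+x. g x * indicator A x \<partial>M) \<le> (\<integral>\<^sup>+x. max (f x) (g x) * indicator A x \<partial>M)"
      by (intro nn_integral_mono mult_right_mono) auto
    ultimately show "(\<integral>\<^sup>+x. max (f x) (g x) * indicator A x \<partial>M) = (\<integral>\<^sup>+x. g x * indicator A x \<partial>M)"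
      by (rule antisym)
  qed auto
  then show ?thesis by eventually_elim (auto simp: max_def split: if_splits)
qed

lemma finite_measure_eqI_rectangles:
  assumes "finite_measure m" and sets: "sets m = sets (S \<Otimes>\<^sub>M T)" "sets m' = sets (S \<Otimes>\<^sub>M T)"
    and eq: "\<And>A B. A \<in> sets S \<Longrightarrow> B \<in> sets T \<Longrightarrow> emeasure m (A \<times> B) = emeasure m' (A \<times> B)"
  shows "m = m'"
proof (rule measure_eqI_generator_eq[OF Int_stable_pair_measure_generator[of S T]])
  interpret finite_measure m by fact
  let ?E = "{a \<times> b |a b. a \<in> sets S \<and> b \<in> sets T}"
  show "?E \<subseteq> Pow (space S \<times> space T)"
    using sets.space_closed[of S] sets.space_closed[of T] by auto
  show "sets m = sigma_sets (space S \<times> space T) ?E" "sets m' = sigma_sets (space S \<times> space T) ?E"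
    by (simp_all add: sets sets_pair_measure)
  show "range (\<lambda>_::nat. space S \<times> space T) \<subseteq> ?E" "(\<Union>_::nat. space S \<times> space T) = space S \<times> space T"
    by auto
  show "emeasure m (space S \<times> space T) \<noteq> \<infinity>" by simp
  show "emeasure m A = emeasure m' A" if "A \<in> ?E" for A using that eq by auto
qed

abbreviation noise :: "real measure" where
  "noise \<equiv> uniform_measure lborel {0<..1}"

lemma prob_space_noise: "prob_space noise"
  by (rule prob_space_uniform_measure) auto

text \<open>Within (0, 1] this set is an interval from 0 to the supremum, with or without its right
  end; the open and the half-open interval enclose it and have equal length.\<close>

lemma emeasure_noise_sublevels:
  assumes "countable I" and le: "\<And>q. q \<in> I \<Longrightarrow> F q \<le> (1::ennreal)"
  shows "emeasure noise {u. \<exists>q\<in>I. ennreal u \<le> F q} = (SUP q\<in>I. F q)"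
proof -
  define s where "s = (SUP q\<in>I. F q)"
  let ?A = "{u. \<exists>q\<in>I. ennreal u \<le> F q}"
  have "s \<le> 1" unfolding s_def using le by (auto intro: SUP_least)
  then obtain t where t: "s = ennreal t" "0 \<le> t" "t \<le> 1"
    by (cases s) (auto simp: top_unique)
  have "?A = (\<Union>q\<in>I. {u. ennreal u \<le> F q})" by auto
  then have [measurable]: "?A \<in> sets borel" using assms(1) by (auto intro!: sets.countable_UN' simp: )
  have "{0<..<t} \<subseteq> {0<..1} \<inter> ?A"
  proof
    fix u assume u: "u \<in> {0<..<t}"
    then have "ennreal u < s" using t by (simp add: ennreal_lessI)
    then obtain q where "q \<in> I" "ennreal u < F q" unfolding s_def by (auto simp: less_SUP_iff)
    then show "u \<in> {0<..1} \<inter> ?A" using u t by (auto intro: less_imp_le)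
  qed
  then have "emeasure lborel {0<..<t} \<le> emeasure lborel ({0<..1} \<inter> ?A)"
    by (intro emeasure_mono) auto
  moreover have "{0<..1} \<inter> ?A \<subseteq> {0<..t}"
  proof
    fix u assume u: "u \<in> {0<..1} \<inter> ?A"
    then obtain q where "q \<in> I" "ennreal u \<le> F q" by auto
    then have "ennreal u \<le> s" unfolding s_def by (auto intro: SUP_upper2)
    then show "u \<in> {0<..t}" using u t by auto
  qed
  then have "emeasure lborel ({0<..1} \<inter> ?A) \<le> emeasure lborel {0<..t}"
    by (intro emeasure_mono) auto
  ultimately have "emeasure lborel ({0<..1} \<inter> ?A) = s" using t by simp
  then show ?thesis by (simp add: s_def divide_ennreal_def)
qed

text \<open>The function \<open>y\<close> is the conditional quantile function of the second coordinate given the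
  first.\<close>
lemma ex_quantile_representation:
  fixes m :: "('x \<times> real) measure"
  assumes "prob_space m" and sets: "sets m = sets (S \<Otimes>\<^sub>M borel)" and marg: "distr m S fst = S"
    and range: "AE p in m. 0 \<le> snd p \<and> snd p \<le> 1"
  obtains y where "y \<in> borel_measurable (S \<Otimes>\<^sub>M borel)"
    "distr (S \<Otimes>\<^sub>M noise) (S \<Otimes>\<^sub>M borel) (\<lambda>p. (fst p, y p)) = m"
proof -
  interpret m: prob_space m by fact
  have fst_m[measurable]: "fst \<in> m \<rightarrow>\<^sub>M S" and snd_m[measurable]: "snd \<in> m \<rightarrow>\<^sub>M borel"
    using measurable_cong_sets[OF sets refl] by auto
  have "prob_space S" using m.prob_space_distr[OF fst_m] marg by simp
  then interpret S: prob_space S .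
  interpret N: prob_space noise by (rule prob_space_noise)
  have spm: "space m = space S \<times> UNIV" using sets_eq_imp_space_eq[OF sets] by (simp add: space_pair_measure)
  have rect[measurable]: "B \<times> A \<in> sets m" if "B \<in> sets S" "A \<in> sets borel" for A :: "real set" and B
    using that unfolding sets by auto
  have mfull: "emeasure m (B \<times> UNIV) = emeasure S B" if B: "B \<in> sets S" for B
  proof -
    have "emeasure S B = emeasure (distr m S fst) B" using marg by simp
    also have "\<dots> = emeasure m (fst -` B \<inter> space m)" using B by (simp add: emeasure_distr)
    also have "fst -` B \<inter> space m = B \<times> UNIV" using sets.sets_into_space[OF B] by (auto simp: spm)
    finally show ?thesis by simp
  qed
  have "\<exists>F. F \<in> borel_measurable S \<and>
      (\<forall>B\<in>sets S. emeasure m (B \<times> {q<..}) = (\<integral>\<^sup>+x. F x * indicator B x \<partial>S))" for q :: real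
  proof -
    \<comment> \<open>\<open>mq\<close> is absolutely continuous with respect to \<open>S\<close>,
      and its derivative serves as the conditional probability, given the first coordinate, that the
      second exceeds \<open>q\<close>. For different \<open>q\<close> these versions are ordered
      only almost everywhere.\<close>
    define mq where "mq = distr (density m (indicator (space S \<times> {q<..}))) S fst"
    have mq: "emeasure mq B = emeasure m (B \<times> {q<..})" if B: "B \<in> sets S" for B
    proof -
      have "emeasure mq B = emeasure (density m (indicator (space S \<times> {q<..}))) (fst -` B \<inter> space m)"
        unfolding mq_def using B by (subst emeasure_distr) auto
      also have "\<dots> = (\<integral>\<^sup>+p. indicator (space S \<times> {q<..}) p * indicator (fst -` B \<inter> space m) p \<partial>m)"
        using B by (intro emeasure_density) auto
      also have "\<dots> = (\<integral>\<^sup>+p. indicator (B \<times> {q<..}) p \<partial>m)"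
        using sets.sets_into_space[OF B] by (intro nn_integral_cong) (auto simp: indicator_def spm)
      finally show ?thesis using B by simp
    qed
    have ac: "absolutely_continuous S mq"
      unfolding absolutely_continuous_def
    proof
      fix B assume "B \<in> null_sets S"
      then have B: "B \<in> sets S" "emeasure S B = 0" by auto
      have "emeasure mq B \<le> emeasure m (B \<times> UNIV)"
        unfolding mq[OF B(1)] using B by (intro emeasure_mono) auto
      then show "B \<in> null_sets mq" using B mfull[OF B(1)] by (auto simp: mq_def)
    qed
    have dens: "density S (RN_deriv S mq) = mq"
      by (rule S.density_RN_deriv[OF ac]) (simp add: mq_def)
    show ?thesis
    proof (intro exI[of _ "RN_deriv S mq"] conjI ballI)
      fix B assume B: "B \<in> sets S"
      then show "emeasure m (B \<times> {q<..}) = (\<integral>\<^sup>+x. RN_deriv S mq x * indicator B x \<partial>S)"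
        using emeasure_density[of "RN_deriv S mq" S B] dens mq[OF B] by simp
    qed auto
  qed
  then obtain G where [measurable]: "\<And>q. G q \<in> borel_measurable S" and
    G: "\<And>q B. B \<in> sets S \<Longrightarrow> emeasure m (B \<times> {q<..}) = (\<integral>\<^sup>+x. G q x * indicator B x \<partial>S)"
    by metis
  have G1: "AE x in S. G q x \<le> 1" for q
  proof (rule S.AE_le_if_set_nn_integral_le)
    fix B assume B: "B \<in> sets S"
    have "emeasure m (B \<times> {q<..}) \<le> emeasure m (B \<times> UNIV)" using B by (intro emeasure_mono) auto
    then show "(\<integral>\<^sup>+x. G q x * indicator B x \<partial>S) \<le> (\<integral>\<^sup>+x. 1 * indicator B x \<partial>S)"
      using B by (simp add: G mfull)
  qed auto
  have Gmono: "AE x in S. G q x \<le> G c x" if "c \<le> q" for c q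
  proof (rule S.AE_le_if_set_nn_integral_le)
    fix B assume B: "B \<in> sets S"
    have "emeasure m (B \<times> {q<..}) \<le> emeasure m (B \<times> {c<..})" using B that by (intro emeasure_mono) auto
    then show "(\<integral>\<^sup>+x. G q x * indicator B x \<partial>S) \<le> (\<integral>\<^sup>+x. G c x * indicator B x \<partial>S)"
      using B by (simp add: G)
  qed auto
  \<comment> \<open>Rational thresholds keep the supremum countable. The point -1 lies below the
    range [0, 1] of the second coordinate; it keeps \<open>I\<close> nonempty and is the value of
    \<open>y\<close> when no threshold passes.\<close>
  define I :: "real set" where "I = {q\<in>\<rat>. -1 \<le> q \<and> q \<le> 1}"
  have cI: "countable J" if "J \<subseteq> I" for J
    using that countable_rat by (auto simp: I_def intro: countable_subset)
  define y where "y p = (SUP q\<in>I. if ennreal (snd p) \<le> G q (fst p) then q else -1)" for p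
  have bdd: "bdd_above ((\<lambda>q. if P q then q else -1) ` I)" for P
    by (rule bdd_aboveI2[where M = 1]) (simp add: I_def)
  have ym: "y \<in> borel_measurable (S \<Otimes>\<^sub>M borel)"
    unfolding y_def
  proof (rule borel_measurable_cSUP)
    show "bdd_above ((\<lambda>q. if ennreal (snd p) \<le> G q (fst p) then q else -1) ` I)" for p
      by (rule bdd)
    show "countable I" by (rule cI) (rule order_refl)
  qed measurable
  \<comment> \<open>The strict inequality turns the supremum into a union over thresholds, whose
    noise measure is given by \<open>emeasure_noise_sublevels\<close>.\<close>
  have yless: "c < y p \<longleftrightarrow> c < -1 \<or> (\<exists>q\<in>{q\<in>I. c < q}. ennreal (snd p) \<le> G q (fst p))" for c p
  proof -
    have "-1 \<in> I" by (auto simp: I_def)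
    then have ne: "I \<noteq> {}" by auto
    have "c < y p \<longleftrightarrow> (\<exists>q\<in>I. c < (if ennreal (snd p) \<le> G q (fst p) then q else -1))"
      unfolding y_def by (rule less_cSUP_iff[OF ne]) (rule bdd)
    also have "\<dots> \<longleftrightarrow> c < -1 \<or> (\<exists>q\<in>{q\<in>I. c < q}. ennreal (snd p) \<le> G q (fst p))"
    proof (cases "c < -1")
      case True
      have "c < (if ennreal (snd p) \<le> G (-1) (fst p) then -1 else -1)" using True by simp
      then show ?thesis using True \<open>-1 \<in> I\<close> by blast
    next
      case False
      then show ?thesis by (auto split: if_splits)
    qed
    finally show ?thesis .
  qed
  let ?law = "distr (S \<Otimes>\<^sub>M noise) (S \<Otimes>\<^sub>M borel) (\<lambda>p. (fst p, y p))"
  have sets_SN: "sets (S \<Otimes>\<^sub>M noise) = sets (S \<Otimes>\<^sub>M borel)"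
    by (intro sets_pair_measure_cong) auto
  have ym'[measurable]: "y \<in> borel_measurable (S \<Otimes>\<^sub>M noise)"
    using ym measurable_cong_sets[OF sets_SN refl] by blast
  interpret SN: pair_prob_space S noise ..
  have lawm: "(\<lambda>p. (fst p, y p)) \<in> S \<Otimes>\<^sub>M noise \<rightarrow>\<^sub>M S \<Otimes>\<^sub>M borel" by measurable
  have key: "emeasure ?law (B \<times> {c<..}) = emeasure m (B \<times> {c<..})" if B[measurable]: "B \<in> sets S" for B c
  proof -
    let ?Ic = "{q\<in>I. c < q}"
    have "emeasure ?law (B \<times> {c<..}) = emeasure (S \<Otimes>\<^sub>M noise) {p\<in>space (S \<Otimes>\<^sub>M noise). fst p \<in> B \<and> c < y p}"
      using lawm by (subst emeasure_distr) (auto intro!: arg_cong[where f = "emeasure _"])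
    also have "\<dots> = (\<integral>\<^sup>+x. emeasure noise (Pair x -` {p\<in>space (S \<Otimes>\<^sub>M noise). fst p \<in> B \<and> c < y p}) \<partial>S)"
      by (rule N.emeasure_pair_measure_alt) measurable
    also have "\<dots> = (\<integral>\<^sup>+x. emeasure noise {u. c < y (x, u)} * indicator B x \<partial>S)"
      using sets.sets_into_space[OF B]
      by (intro nn_integral_cong) (auto simp: indicator_def space_pair_measure intro!: arg_cong[where f = "emeasure _"])
    finally have law: "emeasure ?law (B \<times> {c<..}) = (\<integral>\<^sup>+x. emeasure noise {u. c < y (x, u)} * indicator B x \<partial>S)" .
    show ?thesis
    proof (cases "c < -1")
      case True
      have "emeasure noise UNIV = 1" using N.emeasure_space_1 by simp
      then have "emeasure ?law (B \<times> {c<..}) = emeasure S B"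
        unfolding law yless using True B by simp
      also have "\<dots> = emeasure m (B \<times> UNIV)" using mfull B by simp
      also have "\<dots> = emeasure m (B \<times> {c<..})"
        using range True by (intro emeasure_eq_AE) (auto elim!: eventually_mono)
      finally show ?thesis .
    next
      case False
      define s where "s x = (SUP q\<in>?Ic. G q x)" for x
      have [measurable]: "s \<in> borel_measurable S"
        unfolding s_def using cI[of ?Ic] by (intro borel_measurable_SUP) auto
      have "AE x in S. \<forall>q\<in>?Ic. G q x \<le> 1"
        using cI[of ?Ic] G1 by (subst AE_ball_countable) auto
      then have "AE x in S. emeasure noise {u. c < y (x, u)} = s x"
      proof eventually_elim
        case (elim x)
        have "{u. c < y (x, u)} = {u. \<exists>q\<in>?Ic. ennreal u \<le> G q x}" using False by (simp add: yless)
        also have "emeasure noise \<dots> = (SUP q\<in>?Ic. G q x)"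
          using elim cI[of ?Ic] by (intro emeasure_noise_sublevels) auto
        finally show ?case by (simp add: s_def)
      qed
      then have "emeasure ?law (B \<times> {c<..}) = (\<integral>\<^sup>+x. s x * indicator B x \<partial>S)"
        unfolding law by (intro nn_integral_cong_AE) (auto elim!: eventually_mono)
      \<comment> \<open>The supremum over rational q > c recovers the mass beyond c: it is at most
        \<open>G c\<close> by almost sure monotonicity, and its integral is large enough by
        continuity of \<open>m\<close> from below along the half-lines starting at c + 1 / Suc
        n.\<close>
      also have "\<dots> = emeasure m (B \<times> {c<..})"
      proof (rule antisym)
        have "AE x in S. \<forall>q\<in>?Ic. G q x \<le> G c x"
          using cI[of ?Ic] Gmono by (subst AE_ball_countable) auto
        then have "AE x in S. s x * indicator B x \<le> G c x * indicator B x"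
          by eventually_elim (auto simp: s_def indicator_def intro: SUP_least)
        then show "(\<integral>\<^sup>+x. s x * indicator B x \<partial>S) \<le> emeasure m (B \<times> {c<..})"
          unfolding G[OF B] by (rule nn_integral_mono_AE)
        show "emeasure m (B \<times> {c<..}) \<le> (\<integral>\<^sup>+x. s x * indicator B x \<partial>S)"
        proof (cases "c < 1")
          case False
          have "AE p in m. p \<notin> B \<times> {c<..}" using range by eventually_elim (use False in auto)
          then have "emeasure m (B \<times> {c<..}) = 0" using B AE_iff_measurable[of "B \<times> {c<..}" m "\<lambda>p. p \<notin> B \<times> {c<..}"]
              sets.sets_into_space[OF rect[OF B, of "{c<..}"]] by auto
          then show ?thesis by simp
        next
          case True
          have eq: "(\<Union>n. B \<times> {c + 1 / Suc n<..}) = B \<times> {c<..}"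
          proof -
            have *: "\<exists>n. c + 1 / Suc n < v" if v: "c < v" for v
            proof -
              obtain n where "1 / Suc n < v - c" using nat_approx_posE[of "v - c"] v by auto
              then show ?thesis by (intro exI[of _ n]) linarith
            qed
            have "c < v" if "c + 1 / Suc n < v" for v and n :: nat
            proof -
              have "0 < 1 / real (Suc n)" by simp
              then show ?thesis using that by linarith
            qed
            with * show ?thesis by blast
          qed
          have "incseq (\<lambda>n. B \<times> {c + 1 / Suc n<..})"
          proof (rule incseq_SucI)
            fix n
            have "1 / real (Suc (Suc n)) \<le> 1 / real (Suc n)" by (intro divide_left_mono) auto
            then have "{c + 1 / Suc n<..} \<subseteq> {c + 1 / Suc (Suc n)<..}" by (simp only: greaterThan_subset_iff)
            then show "B \<times> {c + 1 / Suc n<..} \<subseteq> B \<times> {c + 1 / Suc (Suc n)<..}" by (rule Sigma_mono[OF order_refl])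
          qed
          then have "(\<lambda>n. emeasure m (B \<times> {c + 1 / Suc n<..})) \<longlonglongrightarrow> emeasure m (B \<times> {c<..})"
            unfolding eq[symmetric] using B by (intro Lim_emeasure_incseq) auto
          then show ?thesis
          proof (rule LIMSEQ_le_const2, intro exI allI impI)
            fix n
            \<comment> \<open>The cap at 1 keeps the rational \<open>q\<close> inside
              \<open>I\<close>.\<close>
            obtain q where q: "q \<in> \<rat>" "c < q" "q < min 1 (c + 1 / Suc n)"
              using Rats_dense_in_real[of c "min 1 (c + 1 / Suc n)"] True by auto
            then have "q \<in> ?Ic" using \<open>\<not> c < -1\<close> by (auto simp: I_def)
            have "emeasure m (B \<times> {c + 1 / Suc n<..}) \<le> emeasure m (B \<times> {q<..})"
              using q B by (intro emeasure_mono) auto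
            also have "\<dots> \<le> (\<integral>\<^sup>+x. s x * indicator B x \<partial>S)"
              unfolding G[OF B] s_def using \<open>q \<in> ?Ic\<close>
              by (intro nn_integral_mono mult_right_mono SUP_upper) auto
            finally show "emeasure m (B \<times> {c + 1 / Suc n<..}) \<le> (\<integral>\<^sup>+x. s x * indicator B x \<partial>S)" .
          qed
        qed
      qed
      finally show ?thesis .
    qed
  qed
  have "?law = m"
  proof (rule finite_measure_eqI_rectangles[of _ S borel])
    show "finite_measure ?law"
      using SN.P.prob_space_distr[OF lawm] by (rule prob_space.finite_measure)
    fix B and A :: "real set" assume B: "B \<in> sets S" and A: "A \<in> sets borel"
    \<comment> \<open>With \<open>B\<close> fixed, both sides become finite measures in the second
      coordinate, and those are determined by the half-lines {c<..}.\<close>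
    have *: "emeasure (distr (density M (indicator (B \<times> UNIV))) borel snd) A = emeasure M (B \<times> A)"
      if M: "sets M = sets (S \<Otimes>\<^sub>M borel)" and A: "A \<in> sets borel" for M and A :: "real set"
    proof -
      have [measurable]: "snd \<in> M \<rightarrow>\<^sub>M borel" "B \<times> UNIV \<in> sets M" "B \<times> A \<in> sets M"
        using measurable_cong_sets[OF M refl] M B A by auto
      have sp: "space M = space S \<times> UNIV" using sets_eq_imp_space_eq[OF M] by (simp add: space_pair_measure)
      have "emeasure (distr (density M (indicator (B \<times> UNIV))) borel snd) A =
          emeasure (density M (indicator (B \<times> UNIV))) (snd -` A \<inter> space M)"
        using A by (subst emeasure_distr) auto
      also have "\<dots> = (\<integral>\<^sup>+p. indicator (B \<times> UNIV) p * indicator (snd -` A \<inter> space M) p \<partial>M)"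
        using A by (intro emeasure_density) auto
      also have "\<dots> = (\<integral>\<^sup>+p. indicator (B \<times> A) p \<partial>M)"
        using sets.sets_into_space[OF B] by (intro nn_integral_cong) (auto simp: indicator_def sp)
      finally show ?thesis by simp
    qed
    have "distr (density ?law (indicator (B \<times> UNIV))) borel snd = distr (density m (indicator (B \<times> UNIV))) borel snd"
    proof (rule measure_eqI_lessThan)
      fix c :: real
      have "emeasure ?law (B \<times> {c<..}) < \<infinity>"
        unfolding key[OF B] using m.emeasure_finite[of "B \<times> {c<..}"] by (simp add: less_top[symmetric])
      then show "emeasure (distr (density ?law (indicator (B \<times> UNIV))) borel snd) {c<..} < \<infinity>"
        by (subst *) auto
      show "emeasure (distr (density ?law (indicator (B \<times> UNIV))) borel snd) {c<..} =
          emeasure (distr (density m (indicator (B \<times> UNIV))) borel snd) {c<..}"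
        using key[OF B, of c] by (subst (1 2) *) (auto simp: sets)
    qed auto
    then show "emeasure ?law (B \<times> A) = emeasure m (B \<times> A)"
      using *[of ?law A] *[OF sets A] A by simp
  qed (auto simp: sets)
  then show thesis using ym that by blast
qed

text \<open>For a dense sequence \<open>d\<close>, \<open>code\<close> records which balls of radius
  (1/2) ^ k around the points \<open>d i\<close> contain the given point. Decoding takes for each
  \<open>k\<close> the first such ball; the centres converge to the point.\<close>

lemma ex_borel_code:
  obtains code :: "'a::polish_space \<Rightarrow> real" and decode :: "real \<Rightarrow> 'a"
  where "code \<in> borel_measurable borel" "decode \<in> borel_measurable borel"
    "\<And>a. decode (code a) = a" "\<And>a. 0 \<le> code a" "\<And>a. code a \<le> 1"
proof -
  obtain D :: "'a set" where D: "countable D" "\<And>X. open X \<Longrightarrow> X \<noteq> {} \<Longrightarrow> \<exists>d\<in>D. d \<in> X"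
    using countable_dense_setE by metis
  have "D \<noteq> {}" using D(2)[of UNIV] by auto
  define d where "d = from_nat_into D"
  have dense: "\<exists>i. dist a (d i) < e" if e: "0 < e" for a e
  proof -
    obtain x where "x \<in> D" "x \<in> ball a e" using D(2)[of "ball a e"] e by auto
    moreover have "range d = D" unfolding d_def by (rule range_from_nat_into) (use D \<open>D \<noteq> {}\<close> in auto)
    ultimately show ?thesis by (auto simp: ball_def)
  qed
  define b where "b a n = (dist a (d (fst (prod_decode n))) < (1/2) ^ snd (prod_decode n))" for a n
  define code where "code a = ternary_code (b a)" for a
  define w where "w k y = d (LEAST i. 1/3 \<le> ternary_tail (prod_encode (i, k)) y)" for k y
  \<comment> \<open>Outside the range of \<open>code\<close> the centres may fail to converge. The
    constant \<open>d 0\<close> is substituted there, so that the limit exists for every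
    \<open>y\<close> and \<open>decode\<close> is a pointwise limit of measurable functions.\<close>
  define w' where "w' k y = (if Cauchy (\<lambda>k. w k y) then w k y else d 0)" for k y
  define decode where "decode y = lim (\<lambda>k. w' k y)" for y
  have w: "dist a (w k (code a)) < (1/2) ^ k" for a k
  proof -
    have "1/3 \<le> ternary_tail (prod_encode (i, k)) (code a) \<longleftrightarrow> dist a (d i) < (1/2) ^ k" for i
      unfolding code_def ternary_digit_code by (simp add: b_def)
    then have "w k (code a) = d (LEAST i. dist a (d i) < (1/2) ^ k)"
      unfolding w_def by presburger
    then show ?thesis using LeastI_ex[OF dense[of "(1/2) ^ k" a]] by simp
  qed
  have lim: "(\<lambda>k. w k (code a)) \<longlonglongrightarrow> a" for a
  proof (rule metric_LIMSEQ_I)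
    fix e :: real assume "0 < e"
    then obtain n where n: "(1/2) ^ n < e" using real_arch_pow_inv[of e "1/2"] by auto
    have "dist (w k (code a)) a < e" if "n \<le> k" for k
    proof -
      have "dist (w k (code a)) a < (1/2) ^ k" using w[of a k] by (simp add: dist_commute)
      also have "\<dots> \<le> (1/2) ^ n" using that by (intro power_decreasing) auto
      finally show ?thesis using n by simp
    qed
    then show "\<exists>no. \<forall>n\<ge>no. dist (w n (code a)) a < e" by auto
  qed
  show thesis
  proof
    show "code \<in> borel_measurable borel" unfolding code_def b_def by measurable
    have [measurable]: "w k \<in> borel_measurable borel" for k
    proof -
      have "(\<lambda>y. LEAST i. 1/3 \<le> ternary_tail (prod_encode (i, k)) y) \<in> borel \<rightarrow>\<^sub>M count_space UNIV"
        by measurable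
      then show ?thesis unfolding w_def by (rule measurable_compose) simp
    qed
    show "decode \<in> borel_measurable borel"
    proof (rule borel_measurable_LIMSEQ_metric)
      show "w' k \<in> borel_measurable borel" for k unfolding w'_def by measurable
      fix y
      have "convergent (\<lambda>k. w' k y)"
        by (cases "Cauchy (\<lambda>k. w k y)") (auto simp: w'_def convergent_const Cauchy_convergent_iff)
      then show "(\<lambda>k. w' k y) \<longlonglongrightarrow> decode y" unfolding decode_def by (simp add: convergent_LIMSEQ_iff)
    qed
    show "decode (code a) = a" for a
      using lim[of a] LIMSEQ_imp_Cauchy[OF lim[of a]] by (simp add: decode_def w'_def limI)
    show "0 \<le> code a" "code a \<le> 1" for a
      using ternary_code_nonneg[of "b a"] ternary_code_le[of "b a"] by (auto simp: code_def)
  qed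
qed

text \<open>The state space carries no topology, so only the action coordinate is coded into [0, 1];
  it is represented there by the quantile function and decoded afterwards.\<close>

theorem ex_noise_representation:
  fixes m :: "('x \<times> 'a::polish_space) measure"
  assumes "prob_space m" and sets: "sets m = sets (S \<Otimes>\<^sub>M borel)" and marg: "distr m S fst = S"
  obtains a where "a \<in> borel_measurable (S \<Otimes>\<^sub>M borel)"
    "distr (S \<Otimes>\<^sub>M noise) (S \<Otimes>\<^sub>M borel) (\<lambda>p. (fst p, a p)) = m"
proof -
  interpret m: prob_space m by fact
  obtain code :: "'a \<Rightarrow> real" and decode :: "real \<Rightarrow> 'a" where
    [measurable]: "code \<in> borel_measurable borel" "decode \<in> borel_measurable borel" and
    code: "\<And>a. decode (code a) = a" "\<And>a. 0 \<le> code a" "\<And>a. code a \<le> 1"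
    using ex_borel_code by metis
  have [measurable]: "fst \<in> m \<rightarrow>\<^sub>M S" "snd \<in> m \<rightarrow>\<^sub>M borel"
    using measurable_cong_sets[OF sets refl] by auto
  let ?c = "\<lambda>p. (fst p, code (snd p))"
  define m' where "m' = distr m (S \<Otimes>\<^sub>M borel) ?c"
  have c: "?c \<in> m \<rightarrow>\<^sub>M S \<Otimes>\<^sub>M borel" by measurable
  have "prob_space m'" unfolding m'_def by (rule m.prob_space_distr[OF c])
  moreover have "distr m' S fst = S"
    unfolding m'_def by (subst distr_distr) (use marg in \<open>auto simp: comp_def\<close>)
  moreover have "AE p in m'. 0 \<le> snd p \<and> snd p \<le> 1"
    unfolding m'_def by (subst AE_distr_iff[OF c]) (use code in auto)
  ultimately obtain y where y[measurable]: "y \<in> borel_measurable (S \<Otimes>\<^sub>M borel)" and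
    law: "distr (S \<Otimes>\<^sub>M noise) (S \<Otimes>\<^sub>M borel) (\<lambda>p. (fst p, y p)) = m'"
    using ex_quantile_representation[of m' S] by (auto simp: m'_def)
  have sets_SN: "sets (S \<Otimes>\<^sub>M noise) = sets (S \<Otimes>\<^sub>M borel)"
    by (intro sets_pair_measure_cong) auto
  have [measurable]: "y \<in> borel_measurable (S \<Otimes>\<^sub>M noise)"
    using y measurable_cong_sets[OF sets_SN refl] by blast
  show thesis
  proof
    show "(\<lambda>p. decode (y p)) \<in> borel_measurable (S \<Otimes>\<^sub>M borel)" by measurable
    have "distr (S \<Otimes>\<^sub>M noise) (S \<Otimes>\<^sub>M borel) (\<lambda>p. (fst p, decode (y p))) =
        distr (distr (S \<Otimes>\<^sub>M noise) (S \<Otimes>\<^sub>M borel) (\<lambda>p. (fst p, y p))) (S \<Otimes>\<^sub>M borel) (\<lambda>p. (fst p, decode (snd p)))"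
      by (subst distr_distr) (auto simp: comp_def)
    also have "\<dots> = distr m (S \<Otimes>\<^sub>M borel) (\<lambda>p. p)"
      unfolding law m'_def by (subst distr_distr) (auto simp: comp_def code)
    also have "\<dots> = m" by (rule distr_id2) (simp add: sets)
    finally show "distr (S \<Otimes>\<^sub>M noise) (S \<Otimes>\<^sub>M borel) (\<lambda>p. (fst p, decode (y p))) = m" .
  qed
qed

section \<open>Laws of state-action pairs\<close>

text \<open>The semidirect product of \<open>S\<close> and \<open>\<kappa>\<close>, written with
  \<open>bind\<close> to match the recursion \<open>traj\<close> and to compose with
  \<open>Q\<close> by associativity.\<close>

definition joint_law :: "'x measure \<Rightarrow> 'a::polish_space set \<Rightarrow> 'x measure \<Rightarrow> ('x \<Rightarrow> 'a measure) \<Rightarrow> ('x \<times> 'a) measure" where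
  "joint_law X SA S \<kappa> = S \<bind> (\<lambda>x. \<kappa> x \<bind> (\<lambda>a. return (XA X SA) (x, a)))"

lemma space_XA: "space (XA X SA) = space X \<times> SA"
  by (simp add: XA_def ActM_def space_pair_measure space_restrict_space)

lemma space_ActM: "space (ActM SA) = SA"
  by (simp add: ActM_def space_restrict_space)

lemma measurable_fst_XA[measurable]: "fst \<in> XA X SA \<rightarrow>\<^sub>M X"
  and measurable_snd_XA[measurable]: "snd \<in> XA X SA \<rightarrow>\<^sub>M ActM SA"
  by (simp_all add: XA_def)

lemma measurable_Pair_XA[measurable (raw)]:
  "f \<in> M \<rightarrow>\<^sub>M X \<Longrightarrow> g \<in> M \<rightarrow>\<^sub>M ActM SA \<Longrightarrow> (\<lambda>x. (f x, g x)) \<in> M \<rightarrow>\<^sub>M XA X SA"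
  by (simp add: XA_def)

lemma measurable_return_Pair:
  "(\<lambda>(x, a). return (XA X SA) (x, a)) \<in> X \<Otimes>\<^sub>M ActM SA \<rightarrow>\<^sub>M prob_algebra (XA X SA)"
  unfolding XA_def by simp

lemma measurable_inner_joint:
  assumes "\<kappa> \<in> X \<rightarrow>\<^sub>M prob_algebra (ActM SA)"
  shows "(\<lambda>x. \<kappa> x \<bind> (\<lambda>a. return (XA X SA) (x, a))) \<in> X \<rightarrow>\<^sub>M prob_algebra (XA X SA)"
  by (rule measurable_bind_prob_space2[OF assms measurable_return_Pair])

lemma measurable_joint_law:
  assumes "S \<in> M \<rightarrow>\<^sub>M prob_algebra X" "\<kappa> \<in> X \<rightarrow>\<^sub>M prob_algebra (ActM SA)"
  shows "(\<lambda>z. joint_law X SA (S z) \<kappa>) \<in> M \<rightarrow>\<^sub>M prob_algebra (XA X SA)"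
  unfolding joint_law_def
  by (rule measurable_bind_prob_space[OF assms(1) measurable_inner_joint[OF assms(2)]])

lemma joint_law_in_prob_algebra:
  assumes "S \<in> space (prob_algebra X)" "\<kappa> \<in> X \<rightarrow>\<^sub>M prob_algebra (ActM SA)"
  shows "joint_law X SA S \<kappa> \<in> space (prob_algebra (XA X SA))"
  using measurable_space[OF measurable_joint_law[where M = "count_space UNIV", OF measurable_const[OF assms(1)] assms(2)]]
  by simp

lemma kernel_cong_sets:
  assumes "M \<in> space (prob_algebra N)" shows "(f \<in> M \<rightarrow>\<^sub>M L) = (f \<in> N \<rightarrow>\<^sub>M L)"
  using assms by (intro arg_cong2[where f = "(\<in>)"] measurable_cong_sets refl) (auto simp: space_prob_algebra)

lemma nn_integral_bind_prob:
  assumes M: "M \<in> space (prob_algebra L)" and K: "K \<in> L \<rightarrow>\<^sub>M prob_algebra N" and f: "f \<in> borel_measurable N"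
  shows "(\<integral>\<^sup>+x. f x \<partial>(M \<bind> K)) = (\<integral>\<^sup>+y. (\<integral>\<^sup>+x. f x \<partial>K y) \<partial>M)"
  using measurable_prob_algebraD[OF K] f
  by (intro nn_integral_bind) (simp_all add: kernel_cong_sets[OF M])

lemma space_prob_algebra_space: "M \<in> space (prob_algebra N) \<Longrightarrow> space M = space N"
  by (auto simp: space_prob_algebra dest: sets_eq_imp_space_eq)

lemma bind_in_prob_algebra:
  assumes "M \<in> space (prob_algebra L)" "K \<in> L \<rightarrow>\<^sub>M prob_algebra N"
  shows "M \<bind> K \<in> space (prob_algebra N)"
  using prob_space_bind'[OF assms] sets_bind'[OF assms] by (simp add: space_prob_algebra)

lemma nn_integral_inner_joint:
  assumes K: "K \<in> space (prob_algebra (ActM SA))" and x: "x \<in> space X" and f: "f \<in> borel_measurable (XA X SA)"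
  shows "(\<integral>\<^sup>+z. f z \<partial>(K \<bind> (\<lambda>a. return (XA X SA) (x, a)))) = (\<integral>\<^sup>+a. f (x, a) \<partial>K)"
proof -
  have "(\<lambda>a. return (XA X SA) (x, a)) \<in> ActM SA \<rightarrow>\<^sub>M prob_algebra (XA X SA)"
    using x by measurable
  then have "(\<integral>\<^sup>+z. f z \<partial>(K \<bind> (\<lambda>a. return (XA X SA) (x, a)))) =
      (\<integral>\<^sup>+a. \<integral>\<^sup>+z. f z \<partial>return (XA X SA) (x, a) \<partial>K)"
    by (rule nn_integral_bind_prob[OF K _ f])
  also have "\<dots> = (\<integral>\<^sup>+a. f (x, a) \<partial>K)"
    using space_prob_algebra_space[OF K] x f
    by (intro nn_integral_cong nn_integral_return) (auto simp: space_XA space_ActM)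
  finally show ?thesis .
qed

lemma nn_integral_joint_law:
  assumes S: "S \<in> space (prob_algebra X)" and \<kappa>: "\<kappa> \<in> X \<rightarrow>\<^sub>M prob_algebra (ActM SA)"
    and f: "f \<in> borel_measurable (XA X SA)"
  shows "(\<integral>\<^sup>+z. f z \<partial>joint_law X SA S \<kappa>) = (\<integral>\<^sup>+x. \<integral>\<^sup>+a. f (x, a) \<partial>\<kappa> x \<partial>S)"
proof -
  have "(\<integral>\<^sup>+z. f z \<partial>joint_law X SA S \<kappa>) =
      (\<integral>\<^sup>+x. \<integral>\<^sup>+z. f z \<partial>(\<kappa> x \<bind> (\<lambda>a. return (XA X SA) (x, a))) \<partial>S)"
    unfolding joint_law_def by (rule nn_integral_bind_prob[OF S measurable_inner_joint[OF \<kappa>] f])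
  also have "\<dots> = (\<integral>\<^sup>+x. \<integral>\<^sup>+a. f (x, a) \<partial>\<kappa> x \<partial>S)"
    using measurable_space[OF \<kappa>] f space_prob_algebra_space[OF S]
    by (intro nn_integral_cong nn_integral_inner_joint) auto
  finally show ?thesis .
qed

lemma prob_algebra_eqI:
  assumes "M \<in> space (prob_algebra L)" "N \<in> space (prob_algebra L)"
    and "\<And>f. f \<in> borel_measurable L \<Longrightarrow> (\<integral>\<^sup>+x. f x \<partial>M) = (\<integral>\<^sup>+x. f x \<partial>N)"
  shows "M = N"
proof (rule measure_eqI)
  show "sets M = sets N" using assms by (simp add: space_prob_algebra)
  fix A assume "A \<in> sets M"
  then show "emeasure M A = emeasure N A"
    using assms(1,2) assms(3)[of "indicator A"] by (simp add: space_prob_algebra)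
qed

declare traj.simps[simp del]

section \<open>Trajectory laws and the one-time laws of state-action pairs\<close>

locale mdp =
  fixes X :: "'x measure" and SA :: "'a::polish_space set" and Adm :: "'x \<Rightarrow> 'a set"
    and Q :: "'x \<times> 'a \<Rightarrow> 'x measure" and \<eta> :: "'x measure"
    and r :: "'x \<times> 'a \<Rightarrow> real^'d::finite" and \<Delta> :: "'x set"
  assumes model: "mdp_model X SA Adm Q \<eta> r"
    and unif: "uniformly_absorbing X SA Adm Q \<eta> r \<Delta>"
begin

abbreviation "A \<equiv> ActM SA"
abbreviation "Z \<equiv> XA X SA"
abbreviation "HP n \<equiv> \<Pi>\<^sub>M i\<in>{..<n::nat}. Z"
abbreviation "tr \<equiv> traj X SA Q \<eta>"
abbreviation "joint \<equiv> joint_law X SA"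
abbreviation "kernels \<equiv> stoch_kernels X SA Adm"
abbreviation "pols \<equiv> policies X SA Adm"

definition prev_kernel :: "nat \<Rightarrow> (nat \<Rightarrow> 'x \<times> 'a) \<Rightarrow> 'x measure" where
  "prev_kernel t h = (if t = 0 then \<eta> else Q (h (t - 1)))"

definition law where "law \<pi> t = distr (tr \<pi> (Suc t)) Z (\<lambda>h. h t)"

definition state where "state \<pi> t = tr \<pi> t \<bind> prev_kernel t"

definition step_kernel where
  "step_kernel \<pi> t h = prev_kernel t h \<bind> (\<lambda>x. \<pi> t (h, x) \<bind> (\<lambda>a. return (HP (Suc t)) (h(t := (x, a)))))"

lemma traj_Suc_eq: "tr \<pi> (Suc t) = tr \<pi> t \<bind> step_kernel \<pi> t"
  by (simp add: traj.simps step_kernel_def[abs_def] prev_kernel_def)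

lemma Q_meas[measurable]: "Q \<in> Z \<rightarrow>\<^sub>M prob_algebra X"
  using model by (simp add: mdp_model_def)

lemma eta: "\<eta> \<in> space (prob_algebra X)"
  using model by (simp add: mdp_model_def space_prob_algebra)

lemma K_sets[measurable]: "{(x, a). x \<in> space X \<and> a \<in> Adm x} \<in> sets Z"
  using model by (simp add: mdp_model_def)

lemma Delta_sets[measurable]: "\<Delta> \<in> sets X"
  using unif by (simp add: uniformly_absorbing_def absorbing_def)

lemma r_meas[measurable]: "r \<in> borel_measurable Z"
  using model by (simp add: mdp_model_def)

lemma policy_measurable:
  "\<pi> \<in> pols \<Longrightarrow> \<pi> t \<in> HP t \<Otimes>\<^sub>M X \<rightarrow>\<^sub>M prob_algebra A"
  by (simp add: policies_def Hist_def)

lemma prev_kernel_measurable: "prev_kernel t \<in> HP t \<rightarrow>\<^sub>M prob_algebra X"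
proof (cases t)
  case 0
  then show ?thesis using eta by (simp add: prev_kernel_def[abs_def])
next
  case (Suc s)
  have "(\<lambda>h. h s) \<in> HP t \<rightarrow>\<^sub>M Z" using Suc by (intro measurable_component_singleton) auto
  then show ?thesis using Suc by (simp add: prev_kernel_def[abs_def])
qed

lemma extend_measurable:
  "(\<lambda>((h, x), a). h(t := (x, a))) \<in> (HP t \<Otimes>\<^sub>M X) \<Otimes>\<^sub>M A \<rightarrow>\<^sub>M HP (Suc t)"
  unfolding split_beta'
  by (rule measurable_fun_upd[where J = "{..<t}"]) auto

lemma inner_step_measurable:
  assumes "\<pi> \<in> pols"
  shows "(\<lambda>(h, x). \<pi> t (h, x) \<bind> (\<lambda>a. return (HP (Suc t)) (h(t := (x, a))))) \<in> HP t \<Otimes>\<^sub>M X \<rightarrow>\<^sub>M prob_algebra (HP (Suc t))"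
proof -
  have "(\<lambda>p. \<pi> t p \<bind> (\<lambda>a. return (HP (Suc t)) ((fst p)(t := (snd p, a))))) \<in> HP t \<Otimes>\<^sub>M X \<rightarrow>\<^sub>M prob_algebra (HP (Suc t))"
    by (rule measurable_bind_prob_space2[OF policy_measurable[OF assms]])
      (use measurable_compose[OF extend_measurable measurable_return_prob_space] in \<open>simp add: split_beta'\<close>)
  then show ?thesis by (simp add: split_beta')
qed

lemma step_kernel_measurable:
  assumes "\<pi> \<in> pols"
  shows "step_kernel \<pi> t \<in> HP t \<rightarrow>\<^sub>M prob_algebra (HP (Suc t))"
  unfolding step_kernel_def[abs_def]
  by (rule measurable_bind_prob_space2[OF prev_kernel_measurable inner_step_measurable[OF assms]])

lemma traj_in_prob_algebra:
  assumes "\<pi> \<in> pols" shows "tr \<pi> t \<in> space (prob_algebra (HP t))"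
proof (induction t)
  case 0
  have "(\<lambda>_. undefined) \<in> space (HP 0)" by (simp add: space_PiM)
  then show ?case by (simp add: traj.simps space_prob_algebra prob_space_return)
next
  case (Suc t)
  show ?case unfolding traj_Suc_eq by (rule bind_in_prob_algebra[OF Suc step_kernel_measurable[OF assms]])
qed

lemma extend_measurable':
  assumes "h \<in> space (HP t)"
  shows "(\<lambda>(x, a). h(t := (x, a))) \<in> X \<Otimes>\<^sub>M A \<rightarrow>\<^sub>M HP (Suc t)"
  unfolding split_beta'
  by (rule measurable_fun_upd[where J = "{..<t}"]) (use assms in \<open>auto simp: XA_def\<close>)

lemma nn_integral_step_kernel:
  assumes \<pi>: "\<pi> \<in> pols" and f: "f \<in> borel_measurable (HP (Suc t))" and h: "h \<in> space (HP t)"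
  shows "(\<integral>\<^sup>+g. f g \<partial>step_kernel \<pi> t h) = (\<integral>\<^sup>+x. \<integral>\<^sup>+a. f (h(t := (x, a))) \<partial>\<pi> t (h, x) \<partial>prev_kernel t h)"
proof -
  have pk: "prev_kernel t h \<in> space (prob_algebra X)"
    by (rule measurable_space[OF prev_kernel_measurable h])
  have "(\<lambda>x. (h, x)) \<in> X \<rightarrow>\<^sub>M HP t \<Otimes>\<^sub>M X" using h by measurable
  from measurable_compose[OF this inner_step_measurable[OF \<pi>]]
  have m: "(\<lambda>x. \<pi> t (h, x) \<bind> (\<lambda>a. return (HP (Suc t)) (h(t := (x, a))))) \<in> X \<rightarrow>\<^sub>M prob_algebra (HP (Suc t))"
    by simp
  have "(\<integral>\<^sup>+g. f g \<partial>step_kernel \<pi> t h) =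
      (\<integral>\<^sup>+x. \<integral>\<^sup>+g. f g \<partial>(\<pi> t (h, x) \<bind> (\<lambda>a. return (HP (Suc t)) (h(t := (x, a))))) \<partial>prev_kernel t h)"
    unfolding step_kernel_def by (rule nn_integral_bind_prob[OF pk m f])
  also have "\<dots> = (\<integral>\<^sup>+x. \<integral>\<^sup>+a. f (h(t := (x, a))) \<partial>\<pi> t (h, x) \<partial>prev_kernel t h)"
  proof (rule nn_integral_cong)
    fix x assume "x \<in> space (prev_kernel t h)"
    then have x: "x \<in> space X" using space_prob_algebra_space[OF pk] by simp
    have \<pi>h: "\<pi> t (h, x) \<in> space (prob_algebra A)"
      using measurable_space[OF policy_measurable[OF \<pi>, of t]] h x by (simp add: space_pair_measure)
    have e: "(\<lambda>a. h(t := (x, a))) \<in> A \<rightarrow>\<^sub>M HP (Suc t)"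
      using measurable_compose[OF measurable_Pair1'[OF x] extend_measurable'[OF h]] by simp
    have "(\<integral>\<^sup>+g. f g \<partial>(\<pi> t (h, x) \<bind> (\<lambda>a. return (HP (Suc t)) (h(t := (x, a)))))) =
       (\<integral>\<^sup>+a. \<integral>\<^sup>+g. f g \<partial>return (HP (Suc t)) (h(t := (x, a))) \<partial>\<pi> t (h, x))"
      by (rule nn_integral_bind_prob[OF \<pi>h measurable_compose[OF e measurable_return_prob_space] f])
    also have "\<dots> = (\<integral>\<^sup>+a. f (h(t := (x, a))) \<partial>\<pi> t (h, x))"
      using measurable_space[OF e] space_prob_algebra_space[OF \<pi>h] f
      by (intro nn_integral_cong nn_integral_return) auto
    finally show "(\<integral>\<^sup>+g. f g \<partial>(\<pi> t (h, x) \<bind> (\<lambda>a. return (HP (Suc t)) (h(t := (x, a)))))) =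
       (\<integral>\<^sup>+a. f (h(t := (x, a))) \<partial>\<pi> t (h, x))" .
  qed
  finally show ?thesis .
qed

lemma nn_integral_traj_Suc:
  assumes \<pi>: "\<pi> \<in> pols" and f: "f \<in> borel_measurable (HP (Suc t))"
  shows "(\<integral>\<^sup>+g. f g \<partial>tr \<pi> (Suc t)) =
    (\<integral>\<^sup>+h. \<integral>\<^sup>+x. \<integral>\<^sup>+a. f (h(t := (x, a))) \<partial>\<pi> t (h, x) \<partial>prev_kernel t h \<partial>tr \<pi> t)"
  unfolding traj_Suc_eq
  using space_prob_algebra_space[OF traj_in_prob_algebra[OF \<pi>, of t]]
  by (subst nn_integral_bind_prob[OF traj_in_prob_algebra[OF \<pi>] step_kernel_measurable[OF \<pi>] f])
    (intro nn_integral_cong nn_integral_step_kernel[OF \<pi> f], simp)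

lemma component_measurable: "(\<lambda>h. h t) \<in> HP (Suc t) \<rightarrow>\<^sub>M Z"
  by (rule measurable_component_singleton) simp

lemma law_in_prob_algebra: "\<pi> \<in> pols \<Longrightarrow> law \<pi> t \<in> space (prob_algebra Z)"
  unfolding law_def
  using measurable_space[OF measurable_distr_prob_space[OF component_measurable] traj_in_prob_algebra] by blast

lemma nn_integral_law:
  assumes \<pi>: "\<pi> \<in> pols" and f: "f \<in> borel_measurable Z"
  shows "(\<integral>\<^sup>+z. f z \<partial>law \<pi> t) =
    (\<integral>\<^sup>+h. \<integral>\<^sup>+x. \<integral>\<^sup>+a. f (x, a) \<partial>\<pi> t (h, x) \<partial>prev_kernel t h \<partial>tr \<pi> t)"
proof -
  have c: "(\<lambda>h. h t) \<in> tr \<pi> (Suc t) \<rightarrow>\<^sub>M Z"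
    using component_measurable by (simp only: kernel_cong_sets[OF traj_in_prob_algebra[OF \<pi>]])
  have "(\<integral>\<^sup>+z. f z \<partial>law \<pi> t) = (\<integral>\<^sup>+h. f (h t) \<partial>tr \<pi> (Suc t))"
    unfolding law_def using f by (simp add: nn_integral_distr[OF c])
  then show ?thesis
    using nn_integral_traj_Suc[OF \<pi> measurable_compose[OF component_measurable f]] by simp
qed

lemma state_in_prob_algebra: "\<pi> \<in> pols \<Longrightarrow> state \<pi> t \<in> space (prob_algebra X)"
  unfolding state_def by (rule bind_in_prob_algebra[OF traj_in_prob_algebra prev_kernel_measurable])

lemma nn_integral_state:
  assumes "\<pi> \<in> pols" "f \<in> borel_measurable X"
  shows "(\<integral>\<^sup>+x. f x \<partial>state \<pi> t) = (\<integral>\<^sup>+h. \<integral>\<^sup>+x. f x \<partial>prev_kernel t h \<partial>tr \<pi> t)"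
  unfolding state_def by (rule nn_integral_bind_prob[OF traj_in_prob_algebra[OF assms(1)] prev_kernel_measurable assms(2)])

lemma state_0: "\<pi> \<in> pols \<Longrightarrow> state \<pi> 0 = \<eta>"
  unfolding state_def prev_kernel_def using traj_in_prob_algebra[of \<pi> 0] eta
  by (simp add: bind_const' space_prob_algebra prob_space_imp_subprob_space)

text \<open>The next state law depends on the history only through the law of the current pair. This
  is why a Markov policy whose kernels disintegrate the pair laws, each over its own state law,
  reproduces all of them.\<close>

lemma state_Suc:
  assumes \<pi>: "\<pi> \<in> pols" shows "state \<pi> (Suc t) = law \<pi> t \<bind> Q"
proof -
  have c: "(\<lambda>h. h t) \<in> tr \<pi> (Suc t) \<rightarrow>\<^sub>M Z"
    using component_measurable by (simp only: kernel_cong_sets[OF traj_in_prob_algebra[OF \<pi>]])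
  have "space (tr \<pi> (Suc t)) \<noteq> {}"
    using traj_in_prob_algebra[OF \<pi>] by (auto simp: space_prob_algebra intro!: prob_space.not_empty)
  then have "law \<pi> t \<bind> Q = tr \<pi> (Suc t) \<bind> (\<lambda>h. Q (h t))"
    unfolding law_def by (intro bind_distr[OF c measurable_prob_algebraD[OF Q_meas]])
  then show ?thesis by (simp add: state_def prev_kernel_def[abs_def])
qed

lemma nn_integral_const_policy:
  assumes "\<pi> \<in> pols" "h \<in> space (HP t)" "x \<in> space X"
  shows "(\<integral>\<^sup>+a. c \<partial>\<pi> t (h, x)) = c"
proof -
  have "prob_space (\<pi> t (h, x))"
    using measurable_space[OF policy_measurable[OF assms(1), of t], of "(h, x)"] assms
    by (simp add: space_pair_measure space_prob_algebra)
  then show ?thesis by (simp add: prob_space.emeasure_space_1)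
qed

lemma prev_kernel_space:
  assumes "\<pi> \<in> pols" "h \<in> space (tr \<pi> t)"
  shows "h \<in> space (HP t)" "space (prev_kernel t h) = space X"
proof -
  show h: "h \<in> space (HP t)" using assms space_prob_algebra_space[OF traj_in_prob_algebra] by blast
  show "space (prev_kernel t h) = space X"
    by (rule space_prob_algebra_space[OF measurable_space[OF prev_kernel_measurable h]])
qed

text \<open>Makes \<open>state \<pi> t\<close> the base measure over which
  \<open>ex_noise_kernel\<close> disintegrates \<open>law \<pi> t\<close>.\<close>

lemma distr_fst_law:
  assumes \<pi>: "\<pi> \<in> pols" shows "distr (law \<pi> t) X fst = state \<pi> t"
proof (rule prob_algebra_eqI)
  show "distr (law \<pi> t) X fst \<in> space (prob_algebra X)"
    using measurable_space[OF measurable_distr_prob_space[OF measurable_fst_XA] law_in_prob_algebra[OF \<pi>]] .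
  show "state \<pi> t \<in> space (prob_algebra X)" by (rule state_in_prob_algebra[OF \<pi>])
  fix f :: "'x \<Rightarrow> ennreal" assume f: "f \<in> borel_measurable X"
  have m: "fst \<in> law \<pi> t \<rightarrow>\<^sub>M X"
    using measurable_fst_XA by (simp only: kernel_cong_sets[OF law_in_prob_algebra[OF \<pi>]])
  have "(\<integral>\<^sup>+x. f x \<partial>distr (law \<pi> t) X fst) = (\<integral>\<^sup>+z. f (fst z) \<partial>law \<pi> t)"
    using f by (simp add: nn_integral_distr[OF m])
  also have "\<dots> = (\<integral>\<^sup>+h. \<integral>\<^sup>+x. \<integral>\<^sup>+a. f x \<partial>\<pi> t (h, x) \<partial>prev_kernel t h \<partial>tr \<pi> t)"
    using nn_integral_law[OF \<pi> measurable_compose[OF measurable_fst_XA f]] by simp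
  also have "\<dots> = (\<integral>\<^sup>+h. \<integral>\<^sup>+x. f x \<partial>prev_kernel t h \<partial>tr \<pi> t)"
    using prev_kernel_space[OF \<pi>] by (intro nn_integral_cong nn_integral_const_policy[OF \<pi>]) auto
  finally show "(\<integral>\<^sup>+x. f x \<partial>distr (law \<pi> t) X fst) = (\<integral>\<^sup>+x. f x \<partial>state \<pi> t)"
    by (simp add: nn_integral_state[OF \<pi> f])
qed

text \<open>At the level of laws admissibility survives as an almost sure property; together with
  the marginal, this is what \<open>ex_noise_kernel\<close> has to know about the law.\<close>

lemma AE_law_admissible:
  assumes \<pi>: "\<pi> \<in> pols" shows "AE z in law \<pi> t. snd z \<in> Adm (fst z)"
proof -
  let ?K = "{(x, a). x \<in> space X \<and> a \<in> Adm x}"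
  have "(\<integral>\<^sup>+z. indicator (- ?K) z \<partial>law \<pi> t) =
    (\<integral>\<^sup>+h. \<integral>\<^sup>+x. \<integral>\<^sup>+a. indicator (- ?K) (x, a) \<partial>\<pi> t (h, x) \<partial>prev_kernel t h \<partial>tr \<pi> t)"
    by (rule nn_integral_law[OF \<pi>]) measurable
  also have "\<dots> = (\<integral>\<^sup>+h. \<integral>\<^sup>+x. 0 \<partial>prev_kernel t h \<partial>tr \<pi> t)"
  proof (intro nn_integral_cong)
    fix h x assume h: "h \<in> space (tr \<pi> t)" and x': "x \<in> space (prev_kernel t h)"
    then have x: "x \<in> space X" and hs: "h \<in> space (HP t)" using prev_kernel_space[OF \<pi> h] by auto
    have \<pi>h: "\<pi> t (h, x) \<in> space (prob_algebra A)"
      using measurable_space[OF policy_measurable[OF \<pi>, of t], of "(h, x)"] hs x by (simp add: space_pair_measure)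
    interpret prob_space "\<pi> t (h, x)" using \<pi>h by (simp add: space_prob_algebra)
    have "emeasure (\<pi> t (h, x)) (Adm x) = 1"
      using \<pi> hs x by (auto simp: policies_def Hist_def space_pair_measure)
    then have "prob (Adm x) = 1" by (simp add: measure_def)
    then have "AE a in \<pi> t (h, x). a \<in> Adm x" by (rule AE_prob_1)
    then have "AE a in \<pi> t (h, x). indicator (- ?K) (x, a) = (0 :: ennreal)"
      by eventually_elim (use x in \<open>auto simp: indicator_def\<close>)
    from nn_integral_cong_AE[OF this] show "(\<integral>\<^sup>+a. indicator (- ?K) (x, a) \<partial>\<pi> t (h, x)) = 0" by simp
  qed
  also have "\<dots> = 0" by simp
  finally have "(\<integral>\<^sup>+z. indicator (- ?K) z \<partial>law \<pi> t) = 0" .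
  moreover have "(indicator (- ?K) :: _ \<Rightarrow> ennreal) \<in> borel_measurable (law \<pi> t)"
    unfolding kernel_cong_sets[OF law_in_prob_algebra[OF \<pi>]] by measurable
  ultimately have "AE z in law \<pi> t. indicator (- ?K) z = (0::ennreal)"
    by (simp add: nn_integral_0_iff_AE)
  then show ?thesis by eventually_elim (auto simp: indicator_def split: if_splits)
qed

end

lemma sums_enn2real:
  assumes "(\<Sum>t. a t) < (\<infinity>::ennreal)"
  shows "(\<lambda>t. enn2real (a t)) sums enn2real (\<Sum>t. a t)"
proof -
  have "a t < \<infinity>" for t
    using assms ennreal_suminf_lessD[of a \<infinity>] by auto
  then have "ennreal (enn2real (a t)) = a t" for t by (simp add: less_top)
  moreover have "ennreal (enn2real (\<Sum>t. a t)) = (\<Sum>t. a t)" using assms by (simp add: less_top)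
  ultimately have "(\<lambda>t. ennreal (enn2real (a t))) sums ennreal (enn2real (\<Sum>t. a t))"
    by (simp add: summable_sums)
  then show ?thesis by (subst (asm) sums_ennreal) auto
qed

section \<open>Absorption and total rewards in terms of one-time laws\<close>

context mdp
begin

lemma AE_Q_absorbing:
  assumes "z \<in> space Z" "fst z \<in> \<Delta>"
  shows "AE y in Q z. y \<in> \<Delta>"
proof -
  have Qz: "Q z \<in> space (prob_algebra X)" by (rule measurable_space[OF Q_meas assms(1)])
  interpret prob_space "Q z" using Qz by (simp add: space_prob_algebra)
  have "emeasure (Q z) \<Delta> = 1"
    using unif assms by (cases z) (auto simp: uniformly_absorbing_def absorbing_def space_XA space_ActM)
  then have "prob \<Delta> = 1" by (simp add: measure_def)
  then show ?thesis by (rule AE_prob_1)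
qed

lemma r_zero: "z \<in> space Z \<Longrightarrow> fst z \<in> \<Delta> \<Longrightarrow> r z = 0"
  using unif by (cases z) (auto simp: uniformly_absorbing_def absorbing_def space_XA space_ActM)

text \<open>Escape from \<Delta>: absorption excludes it almost surely but not for every history,
  since \<open>Q\<close> only gives \<Delta> full measure.\<close>

definition returned :: "nat \<Rightarrow> (nat \<Rightarrow> 'x \<times> 'a) set" where
  "returned t = {h\<in>space (HP (Suc t)). fst (h t) \<notin> \<Delta> \<and> (\<exists>s\<in>{..<t}. fst (h s) \<in> \<Delta>)}"

lemma Delta_pred: "s \<le> t \<Longrightarrow> {h\<in>space (HP (Suc t)). fst (h s) \<in> \<Delta>} \<in> sets (HP (Suc t))"
proof -
  assume "s \<le> t"
  then have [measurable]: "(\<lambda>h. h s) \<in> HP (Suc t) \<rightarrow>\<^sub>M Z" by (intro measurable_component_singleton) auto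
  show ?thesis by measurable
qed

lemma returned_sets: "returned t \<in> sets (HP (Suc t))"
  unfolding returned_def
  by (intro sets.sets_Collect_conj sets.sets_Collect_neg sets.sets_Collect_finite_Ex Delta_pred) auto

text \<open>Induction on \<open>t\<close>. If the state at time \<open>t\<close> is in \<Delta>, the
  next one is almost surely in \<Delta> as well; otherwise the induction hypothesis excludes any
  earlier visit.\<close>

lemma AE_not_returned:
  assumes \<pi>: "\<pi> \<in> pols"
  shows "AE h in tr \<pi> (Suc t). h \<notin> returned t"
proof (induction t)
  case 0
  show ?case by (simp add: returned_def)
next
  case (Suc t)
  let ?I = "\<lambda>h. \<integral>\<^sup>+x. \<integral>\<^sup>+a. indicator (returned (Suc t)) (h(Suc t := (x, a))) \<partial>\<pi> (Suc t) (h, x) \<partial>prev_kernel (Suc t) h"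
  have "emeasure (tr \<pi> (Suc (Suc t))) (returned (Suc t)) = (\<integral>\<^sup>+h. indicator (returned (Suc t)) h \<partial>tr \<pi> (Suc (Suc t)))"
    using returned_sets[of "Suc t"] traj_in_prob_algebra[OF \<pi>, of "Suc (Suc t)"]
    by (intro nn_integral_indicator[symmetric]) (simp add: space_prob_algebra)
  also have "\<dots> = (\<integral>\<^sup>+h. ?I h \<partial>tr \<pi> (Suc t))"
    using returned_sets[of "Suc t"] by (intro nn_integral_traj_Suc[OF \<pi>]) auto
  also have "\<dots> = (\<integral>\<^sup>+h. 0 \<partial>tr \<pi> (Suc t))"
  proof (rule nn_integral_cong_AE)
    show "AE h in tr \<pi> (Suc t). ?I h = 0"
      using Suc AE_space
    proof eventually_elim
      case (elim h)
      have h: "h \<in> space (HP (Suc t))" using prev_kernel_space(1)[OF \<pi> elim(2)] .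
      then have z: "h t \<in> space Z" using measurable_space[OF component_measurable] by blast
      have "AE x in prev_kernel (Suc t) h.
          (\<integral>\<^sup>+a. indicator (returned (Suc t)) (h(Suc t := (x, a))) \<partial>\<pi> (Suc t) (h, x)) = 0"
      proof (cases "fst (h t) \<in> \<Delta>")
        case True
        have "AE x in prev_kernel (Suc t) h. x \<in> \<Delta>"
        proof -
          have "prev_kernel (Suc t) h = Q (h t)" by (simp add: prev_kernel_def)
          then show ?thesis using AE_Q_absorbing[OF z True] by metis
        qed
        then show ?thesis by eventually_elim (simp add: returned_def)
      next
        case False
        then have "\<not> (\<exists>s\<in>{..<Suc t}. fst (h s) \<in> \<Delta>)"
          using elim(1) h by (auto simp: returned_def less_Suc_eq)
        then have "h(Suc t := (x, a)) \<notin> returned (Suc t)" for x a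
          by (auto simp: returned_def)
        then show ?thesis by simp
      qed
      from nn_integral_cong_AE[OF this] show ?case by simp
    qed
  qed
  also have "\<dots> = 0" by simp
  finally have "returned (Suc t) \<in> null_sets (tr \<pi> (Suc (Suc t)))"
    using returned_sets[of "Suc t"] traj_in_prob_algebra[OF \<pi>, of "Suc (Suc t)"]
    by (simp add: null_sets_def space_prob_algebra)
  then show ?case by (rule AE_not_in)
qed

text \<open>As \<open>\<Delta>\<close> is absorbing, \<open>T\<^sub>\<Delta> > t\<close> depends on \<open>X\<^sub>t\<close> only, and the laws of the single pairs
  \<open>(X\<^sub>t, A\<^sub>t)\<close> carry all the information needed.\<close>
lemma AE_not_absorbed_iff:
  assumes \<pi>: "\<pi> \<in> pols"
  shows "AE h in tr \<pi> (Suc t). (\<forall>s\<le>t. fst (h s) \<notin> \<Delta>) \<longleftrightarrow> fst (h t) \<notin> \<Delta>"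
  using AE_not_returned[OF \<pi>, of t] AE_space
proof eventually_elim
  case (elim h)
  then have "h \<in> space (HP (Suc t))" using space_prob_algebra_space[OF traj_in_prob_algebra[OF \<pi>]] by blast
  then show ?case using elim(1) by (auto simp: returned_def le_less)
qed

lemma component_measurable_traj: "\<pi> \<in> pols \<Longrightarrow> (\<lambda>h. h t) \<in> tr \<pi> (Suc t) \<rightarrow>\<^sub>M Z"
  using component_measurable by (simp only: kernel_cong_sets[OF traj_in_prob_algebra])

lemma alive_sets: "{h\<in>space (HP (Suc t)). \<forall>s\<in>{..t}. fst (h s) \<notin> \<Delta>} \<in> sets (HP (Suc t))"
  by (intro sets.sets_Collect_neg sets.sets_Collect_finite_All Delta_pred) auto

lemma prob_not_absorbed_eq:
  assumes \<pi>: "\<pi> \<in> pols"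
  shows "prob_not_absorbed X SA Q \<eta> \<Delta> \<pi> t = (\<integral>\<^sup>+z. indicator (space X - \<Delta>) (fst z) \<partial>law \<pi> t)"
proof -
  have sp: "space (tr \<pi> (Suc t)) = space (HP (Suc t))" and st: "sets (tr \<pi> (Suc t)) = sets (HP (Suc t))"
    using traj_in_prob_algebra[OF \<pi>, of "Suc t"] by (auto simp: space_prob_algebra dest: sets_eq_imp_space_eq)
  have c: "{h \<in> space (HP (Suc t)). fst (h t) \<notin> \<Delta>} \<in> sets (HP (Suc t))"
    by (intro sets.sets_Collect_neg Delta_pred) auto
  have "prob_not_absorbed X SA Q \<eta> \<Delta> \<pi> t = emeasure (tr \<pi> (Suc t)) {h \<in> space (HP (Suc t)). fst (h t) \<notin> \<Delta>}"
    unfolding prob_not_absorbed_def sp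
    using AE_not_absorbed_iff[OF \<pi>, of t] alive_sets[of t] c st
    by (intro emeasure_eq_AE) (auto simp: Ball_def elim!: eventually_mono)
  also have "\<dots> = (\<integral>\<^sup>+h. indicator {h \<in> space (HP (Suc t)). fst (h t) \<notin> \<Delta>} h \<partial>tr \<pi> (Suc t))"
    using c st by simp
  also have "\<dots> = (\<integral>\<^sup>+h. indicator (space X - \<Delta>) (fst (h t)) \<partial>tr \<pi> (Suc t))"
    using measurable_space[OF component_measurable, of _ t]
    by (intro nn_integral_cong) (fastforce simp: sp indicator_def space_XA)
  also have "\<dots> = (\<integral>\<^sup>+z. indicator (space X - \<Delta>) (fst z) \<partial>law \<pi> t)"
    unfolding law_def by (rule nn_integral_distr[symmetric, OF component_measurable_traj[OF \<pi>]]) simp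
  finally show ?thesis .
qed

lemma ex_reward_bound: "\<exists>R\<ge>0. \<forall>z\<in>space Z. norm (r z) \<le> R"
proof -
  obtain R where "\<forall>z\<in>space Z. norm (r z) \<le> R"
    using model unfolding mdp_model_def bounded_iff by auto
  then show ?thesis by (intro exI[of _ "max 0 R"]) auto
qed

definition R where "R = (SOME R. 0 \<le> R \<and> (\<forall>z\<in>space Z. norm (r z) \<le> R))"

lemma R: "0 \<le> R" "z \<in> space Z \<Longrightarrow> norm (r z) \<le> R"
  using someI_ex[OF ex_reward_bound] unfolding R_def by auto

text \<open>Positive and negative parts of the components of \<open>r\<close>: \<open>ennreal\<close> truncates at \<open>0\<close>.\<close>
definition g :: "'d \<times> bool \<Rightarrow> 'x \<times> 'a \<Rightarrow> ennreal" where
  "g k z = ennreal (if snd k then r z $ fst k else - (r z $ fst k))"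

lemma g_meas[measurable]: "g k \<in> borel_measurable Z"
proof -
  have "(\<lambda>z. r z $ j) \<in> borel_measurable Z" for j
    by (intro measurable_compose[OF r_meas] borel_measurable_continuous_onI continuous_intros)
  then show ?thesis unfolding g_def[abs_def] by (cases "snd k") auto
qed

lemma g_zero: "z \<in> space Z \<Longrightarrow> fst z \<in> \<Delta> \<Longrightarrow> g k z = 0"
  by (simp add: g_def r_zero)

lemma g_le: "z \<in> space Z \<Longrightarrow> g k z \<le> ennreal R * indicator (space X - \<Delta>) (fst z)"
proof (cases "fst z \<in> \<Delta>")
  case False
  assume z: "z \<in> space Z"
  have "\<bar>r z $ fst k\<bar> \<le> R" using component_le_norm_cart[of "r z" "fst k"] R(2)[OF z] by linarith
  then have "g k z \<le> ennreal R" unfolding g_def by (intro ennreal_leI) auto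
  then show ?thesis using False z by (auto simp: space_XA indicator_def)
qed (simp add: g_zero)

text \<open>The argument is a sequence of laws and not a policy, so that the same notion serves
  \<open>law \<pi>\<close> and \<open>mlaw \<sigma>\<close>.\<close>

definition total :: "(nat \<Rightarrow> ('x \<times> 'a) measure) \<Rightarrow> 'd \<times> bool \<Rightarrow> ennreal" where
  "total L k = (\<Sum>t. \<integral>\<^sup>+z. g k z \<partial>L t)"

text \<open>The link through which uniform absorption, a statement on survival probabilities,
  controls the tails of the rewards.\<close>

lemma nn_integral_g_law_le:
  assumes \<pi>: "\<pi> \<in> pols"
  shows "(\<integral>\<^sup>+z. g k z \<partial>law \<pi> t) \<le> ennreal R * prob_not_absorbed X SA Q \<eta> \<Delta> \<pi> t"
proof -
  have sp: "space (law \<pi> t) = space Z" by (rule space_prob_algebra_space[OF law_in_prob_algebra[OF \<pi>]])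
  have m: "(\<lambda>z. indicator (space X - \<Delta>) (fst z) :: ennreal) \<in> borel_measurable (law \<pi> t)"
    unfolding kernel_cong_sets[OF law_in_prob_algebra[OF \<pi>]] by measurable
  have "(\<integral>\<^sup>+z. g k z \<partial>law \<pi> t) \<le> (\<integral>\<^sup>+z. ennreal R * indicator (space X - \<Delta>) (fst z) \<partial>law \<pi> t)"
    by (intro nn_integral_mono g_le) (simp add: sp)
  also have "\<dots> = ennreal R * prob_not_absorbed X SA Q \<eta> \<Delta> \<pi> t"
    unfolding prob_not_absorbed_eq[OF \<pi>] by (rule nn_integral_cmult[OF m])
  finally show ?thesis .
qed

lemma total_finite:
  assumes \<pi>: "\<pi> \<in> pols" shows "total (law \<pi>) k < \<infinity>"
proof -
  have "total (law \<pi>) k \<le> (\<Sum>t. ennreal R * prob_not_absorbed X SA Q \<eta> \<Delta> \<pi> t)"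
    unfolding total_def by (intro suminf_le nn_integral_g_law_le[OF \<pi>]) auto
  also have "\<dots> = ennreal R * (\<Sum>t. prob_not_absorbed X SA Q \<eta> \<Delta> \<pi> t)" by simp
  also have "\<dots> < \<infinity>"
    using unif \<pi> by (auto simp: uniformly_absorbing_def absorbing_def ennreal_mult_less_top)
  finally show ?thesis .
qed

lemma occ_reward_component:
  assumes \<pi>: "\<pi> \<in> pols"
  shows "occ_reward X SA Q \<eta> \<Delta> r \<pi> =
    (\<chi> j. enn2real (total (law \<pi>) (j, True)) - enn2real (total (law \<pi>) (j, False)))" (is "_ = ?v")
proof -
  have sp: "space (tr \<pi> (Suc t)) = space (HP (Suc t))" and st: "sets (tr \<pi> (Suc t)) = sets (HP (Suc t))" for t
    using traj_in_prob_algebra[OF \<pi>, of "Suc t"] by (auto simp: space_prob_algebra dest: sets_eq_imp_space_eq)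
  have rm: "r \<in> borel_measurable (law \<pi> t)" for t
    unfolding kernel_cong_sets[OF law_in_prob_algebra[OF \<pi>]] by measurable
  have int: "integrable (law \<pi> t) r" for t
  proof -
    interpret prob_space "law \<pi> t" using law_in_prob_algebra[OF \<pi>] by (simp add: space_prob_algebra)
    show ?thesis
      using R space_prob_algebra_space[OF law_in_prob_algebra[OF \<pi>]] rm
      by (intro integrable_const_bound[of _ R]) auto
  qed
  have eq: "(\<integral>h. indicator {h. \<forall>s\<le>t. fst (h s) \<notin> \<Delta>} h *\<^sub>R r (h t) \<partial>tr \<pi> (Suc t)) = (\<integral>z. r z \<partial>law \<pi> t)" for t
  proof -
    have rc: "(\<lambda>h. r (h t)) \<in> borel_measurable (tr \<pi> (Suc t))"
      by (rule measurable_compose[OF component_measurable_traj[OF \<pi>] r_meas])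
    have ind: "(indicator {h. \<forall>s\<le>t. fst (h s) \<notin> \<Delta>} :: _ \<Rightarrow> real) \<in> borel_measurable (tr \<pi> (Suc t))"
    proof -
      have "{h. \<forall>s\<le>t. fst (h s) \<notin> \<Delta>} \<inter> space (tr \<pi> (Suc t)) = {h\<in>space (HP (Suc t)). \<forall>s\<in>{..t}. fst (h s) \<notin> \<Delta>}"
        by (auto simp: sp)
      then show ?thesis unfolding borel_measurable_indicator_iff using alive_sets[of t] by (simp add: st)
    qed
    have "(\<integral>h. indicator {h. \<forall>s\<le>t. fst (h s) \<notin> \<Delta>} h *\<^sub>R r (h t) \<partial>tr \<pi> (Suc t)) = (\<integral>h. r (h t) \<partial>tr \<pi> (Suc t))"
    proof (rule integral_cong_AE)
      show "AE h in tr \<pi> (Suc t). indicator {h. \<forall>s\<le>t. fst (h s) \<notin> \<Delta>} h *\<^sub>R r (h t) = r (h t)"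
        using AE_not_absorbed_iff[OF \<pi>, of t] AE_space
      proof eventually_elim
        case (elim h)
        have "h t \<in> space Z" using measurable_space[OF component_measurable_traj[OF \<pi>] elim(2)] .
        then show ?case using elim(1) r_zero[of "h t"] by (auto simp: indicator_def)
      qed
    qed (rule borel_measurable_scaleR[OF ind rc], rule rc)
    also have "\<dots> = (\<integral>z. r z \<partial>law \<pi> t)"
      unfolding law_def by (rule integral_distr[symmetric, OF component_measurable_traj[OF \<pi>] r_meas])
    finally show ?thesis .
  qed
  have comp: "(\<integral>z. r z \<partial>law \<pi> t) $ j =
      enn2real (\<integral>\<^sup>+z. g (j, True) z \<partial>law \<pi> t) - enn2real (\<integral>\<^sup>+z. g (j, False) z \<partial>law \<pi> t)" for t j
  proof -
    have "(\<integral>z. r z \<partial>law \<pi> t) $ j = (\<integral>z. r z $ j \<partial>law \<pi> t)"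
      by (rule integral_bounded_linear[symmetric, OF bounded_linear_vec_nth int])
    also have "\<dots> = enn2real (\<integral>\<^sup>+z. g (j, True) z \<partial>law \<pi> t) - enn2real (\<integral>\<^sup>+z. g (j, False) z \<partial>law \<pi> t)"
      unfolding g_def by (simp add: real_lebesgue_integral_def[OF integrable_bounded_linear[OF bounded_linear_vec_nth int]])
    finally show ?thesis .
  qed
  have "(\<lambda>t. \<integral>z. r z \<partial>law \<pi> t) sums ?v"
    unfolding sums_def
  proof (rule vec_tendstoI)
    fix j
    have "(\<lambda>t. enn2real (\<integral>\<^sup>+z. g (j, True) z \<partial>law \<pi> t) - enn2real (\<integral>\<^sup>+z. g (j, False) z \<partial>law \<pi> t)) sums (?v $ j)"
      using total_finite[OF \<pi>] unfolding total_def
      by (simp only: vec_lambda_beta) (intro sums_diff sums_enn2real)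
    then show "(\<lambda>n. (\<Sum>t<n. \<integral>z. r z \<partial>law \<pi> t) $ j) \<longlonglongrightarrow> ?v $ j"
      by (simp add: sums_def sum_component comp)
  qed
  then show ?thesis unfolding occ_reward_def eq by (rule sums_unique[symmetric])
qed

lemma occ_reward_cong:
  "\<pi> \<in> pols \<Longrightarrow> \<pi>' \<in> pols \<Longrightarrow> total (law \<pi>) = total (law \<pi>') \<Longrightarrow>
    occ_reward X SA Q \<eta> \<Delta> r \<pi> = occ_reward X SA Q \<eta> \<Delta> r \<pi>'"
  by (simp add: occ_reward_component)

section \<open>Markov policies and the effect of changing one kernel\<close>

primrec mstate :: "(nat \<Rightarrow> 'x \<Rightarrow> 'a measure) \<Rightarrow> nat \<Rightarrow> 'x measure" where
  "mstate \<sigma> 0 = \<eta>"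
| "mstate \<sigma> (Suc t) = joint (mstate \<sigma> t) (\<sigma> t) \<bind> Q"

definition mlaw where "mlaw \<sigma> t = joint (mstate \<sigma> t) (\<sigma> t)"

abbreviation "markov \<sigma> \<equiv> (\<lambda>n h. \<sigma> (n::nat) (snd h))"

lemma kernel_measurable: "\<kappa> \<in> kernels \<Longrightarrow> \<kappa> \<in> X \<rightarrow>\<^sub>M prob_algebra A"
  by (simp add: stoch_kernels_def)

lemma kernel_space: "\<kappa> \<in> kernels \<Longrightarrow> x \<in> space X \<Longrightarrow> \<kappa> x \<in> space (prob_algebra A)"
  by (rule measurable_space[OF kernel_measurable])

lemma mstate_in_prob_algebra: "(\<And>t. \<sigma> t \<in> kernels) \<Longrightarrow> mstate \<sigma> t \<in> space (prob_algebra X)"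
  by (induction t) (auto intro!: eta bind_in_prob_algebra[OF joint_law_in_prob_algebra Q_meas] kernel_measurable)

lemma mlaw_in_prob_algebra: "(\<And>t. \<sigma> t \<in> kernels) \<Longrightarrow> mlaw \<sigma> t \<in> space (prob_algebra Z)"
  unfolding mlaw_def by (intro joint_law_in_prob_algebra mstate_in_prob_algebra kernel_measurable)

lemma markov_in_policies:
  assumes "\<And>t. \<sigma> t \<in> kernels" shows "markov \<sigma> \<in> pols"
  using assms measurable_compose[OF measurable_snd kernel_measurable[OF assms]]
  unfolding policies_def stoch_kernels_def by (auto simp: Hist_def space_pair_measure)

text \<open>Here \<pi> may depend on the whole history. By \<open>state_Suc\<close> its state laws
  nevertheless follow the recursion of \<open>mstate\<close>.\<close>

lemma state_eq_mstate:
  assumes \<pi>: "\<pi> \<in> pols" and eq: "\<And>t. law \<pi> t = joint (state \<pi> t) (\<sigma> t)"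
  shows "state \<pi> t = mstate \<sigma> t"
  by (induction t) (simp_all add: state_0[OF \<pi>] state_Suc[OF \<pi>] eq)

lemma law_eq_mlaw:
  assumes \<pi>: "\<pi> \<in> pols" and eq: "\<And>t. law \<pi> t = joint (state \<pi> t) (\<sigma> t)"
  shows "law \<pi> t = mlaw \<sigma> t"
  by (simp add: eq mlaw_def state_eq_mstate[OF \<pi> eq])

lemma law_markov_eq_joint:
  assumes \<sigma>: "\<And>t. \<sigma> t \<in> kernels" shows "law (markov \<sigma>) t = joint (state (markov \<sigma>) t) (\<sigma> t)"
proof -
  have \<pi>: "markov \<sigma> \<in> pols" by (rule markov_in_policies[OF \<sigma>])
  show ?thesis
  proof (rule prob_algebra_eqI[OF law_in_prob_algebra[OF \<pi>] joint_law_in_prob_algebra[OF state_in_prob_algebra[OF \<pi>] kernel_measurable[OF \<sigma>]]])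
    fix f :: "'x \<times> 'a \<Rightarrow> ennreal" assume f[measurable]: "f \<in> borel_measurable Z"
    have [measurable]: "\<sigma> t \<in> X \<rightarrow>\<^sub>M subprob_algebra A"
      by (rule measurable_prob_algebraD[OF kernel_measurable[OF \<sigma>]])
    have "(\<lambda>x. \<integral>\<^sup>+a. f (x, a) \<partial>\<sigma> t x) \<in> borel_measurable X"
      by (rule nn_integral_measurable_subprob_algebra2[where N = A]) (auto simp flip: XA_def)
    from nn_integral_state[OF \<pi> this, of t]
    show "(\<integral>\<^sup>+z. f z \<partial>law (markov \<sigma>) t) = (\<integral>\<^sup>+z. f z \<partial>joint (state (markov \<sigma>) t) (\<sigma> t))"
      by (simp add: nn_integral_law[OF \<pi> f] nn_integral_joint_law[OF state_in_prob_algebra[OF \<pi>] kernel_measurable[OF \<sigma>] f])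
  qed
qed

lemma law_markov: "(\<And>t. \<sigma> t \<in> kernels) \<Longrightarrow> law (markov \<sigma>) t = mlaw \<sigma> t"
  by (intro law_eq_mlaw markov_in_policies law_markov_eq_joint)

lemma state_markov: "(\<And>t. \<sigma> t \<in> kernels) \<Longrightarrow> state (markov \<sigma>) t = mstate \<sigma> t"
  by (intro state_eq_mstate markov_in_policies law_markov_eq_joint)

text \<open>The law of the pair \<open>m\<close> steps after time \<open>n\<close>, given the pair
  at time \<open>n\<close>. Only kernels at times after \<open>n\<close> enter, so it is invariant
  under replacing \<open>\<sigma> n\<close>.\<close>

primrec down :: "(nat \<Rightarrow> 'x \<Rightarrow> 'a measure) \<Rightarrow> nat \<Rightarrow> nat \<Rightarrow> 'x \<times> 'a \<Rightarrow> ('x \<times> 'a) measure" where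
  "down \<sigma> n 0 = return Z"
| "down \<sigma> n (Suc m) = (\<lambda>z. down \<sigma> n m z \<bind> (\<lambda>z. joint (Q z) (\<sigma> (Suc (n + m)))))"

lemma transition_measurable: "\<kappa> \<in> kernels \<Longrightarrow> (\<lambda>z. joint (Q z) \<kappa>) \<in> Z \<rightarrow>\<^sub>M prob_algebra Z"
  by (rule measurable_joint_law[OF Q_meas kernel_measurable])

lemma down_measurable: "(\<And>t. \<sigma> t \<in> kernels) \<Longrightarrow> down \<sigma> n m \<in> Z \<rightarrow>\<^sub>M prob_algebra Z"
  by (induction m) (auto intro: measurable_bind_prob_space[OF _ transition_measurable])

lemma bind_assoc_prob:
  assumes "M \<in> space (prob_algebra L)" "f \<in> L \<rightarrow>\<^sub>M prob_algebra N" "h \<in> N \<rightarrow>\<^sub>M prob_algebra K"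
  shows "(M \<bind> f) \<bind> h = M \<bind> (\<lambda>x. f x \<bind> h)"
  using measurable_prob_algebraD[OF assms(2)] measurable_prob_algebraD[OF assms(3)]
  by (intro bind_assoc[where N = N and R = K]) (simp_all add: kernel_cong_sets[OF assms(1)])

lemma mlaw_Suc:
  assumes "\<And>t. \<sigma> t \<in> kernels" shows "mlaw \<sigma> (Suc t) = mlaw \<sigma> t \<bind> (\<lambda>z. joint (Q z) (\<sigma> (Suc t)))"
  unfolding mlaw_def[of _ "Suc t"] mstate.simps mlaw_def[symmetric]
  unfolding joint_law_def
  by (rule bind_assoc_prob[OF mlaw_in_prob_algebra Q_meas measurable_inner_joint[OF kernel_measurable]]) (auto intro: assms)

lemma mlaw_add:
  assumes \<sigma>: "\<And>t. \<sigma> t \<in> kernels" shows "mlaw \<sigma> (n + m) = mlaw \<sigma> n \<bind> down \<sigma> n m"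
proof (induction m)
  case 0
  have "sets (mlaw \<sigma> n) = sets Z" using mlaw_in_prob_algebra[of \<sigma> n, OF \<sigma>] by (simp add: space_prob_algebra)
  then show ?case by (simp add: bind_return'')
next
  case (Suc m)
  then show ?case
    by (simp add: mlaw_Suc[OF \<sigma>] bind_assoc_prob[OF mlaw_in_prob_algebra[OF \<sigma>] down_measurable[OF \<sigma>] transition_measurable[OF \<sigma>]])
qed

lemma down_cong: "(\<And>t. n < t \<Longrightarrow> \<sigma> t = \<sigma>' t) \<Longrightarrow> down \<sigma> n m = down \<sigma>' n m"
  by (induction m) auto

lemma mstate_cong: "(\<And>s. s < t \<Longrightarrow> \<sigma> s = \<sigma>' s) \<Longrightarrow> mstate \<sigma> t = mstate \<sigma>' t"
  by (induction t) auto

lemma AE_transition_absorbing: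
  assumes "\<kappa> \<in> kernels" "z \<in> space Z" "fst z \<in> \<Delta>"
  shows "AE z' in joint (Q z) \<kappa>. fst z' \<in> \<Delta>"
proof -
  have Qz: "Q z \<in> space (prob_algebra X)" by (rule measurable_space[OF Q_meas assms(2)])
  note J = joint_law_in_prob_algebra[OF Qz kernel_measurable[OF assms(1)]]
  have m: "(\<lambda>z'. indicator (- \<Delta>) (fst z') :: ennreal) \<in> borel_measurable Z" by measurable
  have "(\<integral>\<^sup>+z'. indicator (- \<Delta>) (fst z') \<partial>joint (Q z) \<kappa>) = (\<integral>\<^sup>+x. \<integral>\<^sup>+a. indicator (- \<Delta>) x \<partial>\<kappa> x \<partial>Q z)"
    using nn_integral_joint_law[OF Qz kernel_measurable[OF assms(1)] m] by simp
  also have "\<dots> = (\<integral>\<^sup>+x. 0 \<partial>Q z)"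
    using AE_Q_absorbing[OF assms(2,3)] by (intro nn_integral_cong_AE) (auto elim!: eventually_mono)
  finally have "(\<integral>\<^sup>+z'. indicator (- \<Delta>) (fst z') \<partial>joint (Q z) \<kappa>) = 0" by simp
  then have "AE z' in joint (Q z) \<kappa>. indicator (- \<Delta>) (fst z') = (0 :: ennreal)"
    using m by (simp add: nn_integral_0_iff_AE kernel_cong_sets[OF J])
  then show ?thesis by eventually_elim (auto simp: indicator_def split: if_splits)
qed

lemma AE_down_absorbing:
  assumes \<sigma>: "\<And>t. \<sigma> t \<in> kernels" and z: "z \<in> space Z" "fst z \<in> \<Delta>"
  shows "AE z' in down \<sigma> n m z. fst z' \<in> \<Delta>"
proof (induction m)
  case 0
  have "Measurable.pred Z (\<lambda>z. fst z \<in> \<Delta>)" by measurable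
  then show ?case unfolding down.simps using z by (simp add: AE_return)
next
  case (Suc m)
  have D: "down \<sigma> n m z \<in> space (prob_algebra Z)" by (rule measurable_space[OF down_measurable[OF \<sigma>] z(1)])
  have N: "(\<lambda>z. joint (Q z) (\<sigma> (Suc (n + m)))) \<in> down \<sigma> n m z \<rightarrow>\<^sub>M subprob_algebra Z"
    unfolding kernel_cong_sets[OF D] by (rule measurable_prob_algebraD[OF transition_measurable[OF \<sigma>]])
  have "AE z' in down \<sigma> n m z. AE z'' in joint (Q z') (\<sigma> (Suc (n + m))). fst z'' \<in> \<Delta>"
    using Suc AE_space
    by eventually_elim (use space_prob_algebra_space[OF D] in \<open>auto intro!: AE_transition_absorbing \<sigma>\<close>)
  then show ?case unfolding down.simps by (subst AE_bind[OF N]) measurable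
qed

text \<open>The action-value function at time \<open>n\<close>; the term with m = 0 is the immediate
  reward \<open>g k z\<close>.\<close>

definition tail_reward where
  "tail_reward \<sigma> n k z = (\<Sum>m. \<integral>\<^sup>+z'. g k z' \<partial>down \<sigma> n m z)"

lemma tail_reward_measurable[measurable]:
  "(\<And>t. \<sigma> t \<in> kernels) \<Longrightarrow> tail_reward \<sigma> n k \<in> borel_measurable Z"
  unfolding tail_reward_def[abs_def]
  by (intro borel_measurable_suminf_order measurable_compose[OF measurable_prob_algebraD[OF down_measurable]
      nn_integral_measurable_subprob_algebra[OF g_meas]]) auto

text \<open>Confines the densities used in Lyapunov's theorem to the complement of \<Delta>, which
  is where the atomless condition speaks.\<close>

lemma tail_reward_zero:
  assumes \<sigma>: "\<And>t. \<sigma> t \<in> kernels" and z: "z \<in> space Z" "fst z \<in> \<Delta>"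
  shows "tail_reward \<sigma> n k z = 0"
proof -
  have "(\<integral>\<^sup>+z'. g k z' \<partial>down \<sigma> n m z) = 0" for m
  proof -
    have D: "down \<sigma> n m z \<in> space (prob_algebra Z)" by (rule measurable_space[OF down_measurable[OF \<sigma>] z(1)])
    have "AE z' in down \<sigma> n m z. g k z' = 0"
      using AE_down_absorbing[OF \<sigma> z] AE_space
      by eventually_elim (use space_prob_algebra_space[OF D] in \<open>auto intro!: g_zero\<close>)
    from nn_integral_cong_AE[OF this] show ?thesis by simp
  qed
  then show ?thesis by (simp add: tail_reward_def)
qed

text \<open>The new kernel occurs in one integral only, because the laws before time
  \<open>n\<close> and the continuation \<open>tail_reward\<close> are those of
  \<open>\<sigma>\<close>. This is the affine dependence on the kernel at time
  \<open>n\<close>.\<close>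

lemma total_update:
  assumes \<sigma>: "\<And>t. \<sigma> t \<in> kernels" and \<kappa>: "\<kappa> \<in> kernels"
  shows "total (mlaw (\<sigma>(n := \<kappa>))) k = (\<integral>\<^sup>+x. \<integral>\<^sup>+a. tail_reward \<sigma> n k (x, a) \<partial>\<kappa> x \<partial>mstate \<sigma> n)
     + (\<Sum>t<n. \<integral>\<^sup>+z. g k z \<partial>mlaw \<sigma> t)"
proof -
  define \<tau> where "\<tau> = \<sigma>(n := \<kappa>)"
  have \<tau>: "\<tau> t \<in> kernels" for t using assms by (simp add: \<tau>_def)
  have eq: "mstate \<tau> t = mstate \<sigma> t" if "t \<le> n" for t
    using that by (intro mstate_cong) (auto simp: \<tau>_def)
  have d: "down \<tau> n m = down \<sigma> n m" for m by (rule down_cong) (auto simp: \<tau>_def)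
  have "total (mlaw \<tau>) k = (\<Sum>m. \<integral>\<^sup>+z. g k z \<partial>mlaw \<tau> (m + n)) + (\<Sum>t<n. \<integral>\<^sup>+z. g k z \<partial>mlaw \<tau> t)"
    unfolding total_def by (rule suminf_offset) auto
  also have "(\<Sum>t<n. \<integral>\<^sup>+z. g k z \<partial>mlaw \<tau> t) = (\<Sum>t<n. \<integral>\<^sup>+z. g k z \<partial>mlaw \<sigma> t)"
    by (intro sum.cong refl) (auto simp: mlaw_def eq \<tau>_def[THEN fun_cong])
  also have "(\<Sum>m. \<integral>\<^sup>+z. g k z \<partial>mlaw \<tau> (m + n)) = (\<Sum>m. \<integral>\<^sup>+z. \<integral>\<^sup>+z'. g k z' \<partial>down \<sigma> n m z \<partial>mlaw \<tau> n)"
    unfolding add.commute[of _ n] mlaw_add[OF \<tau>] d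
    by (simp only: nn_integral_bind_prob[OF mlaw_in_prob_algebra[OF \<tau>] down_measurable[OF \<sigma>] g_meas])
  also have "(\<Sum>m. \<integral>\<^sup>+z. \<integral>\<^sup>+z'. g k z' \<partial>down \<sigma> n m z \<partial>mlaw \<tau> n) = (\<integral>\<^sup>+z. tail_reward \<sigma> n k z \<partial>mlaw \<tau> n)"
    unfolding tail_reward_def
    by (intro nn_integral_suminf[symmetric])
      (simp add: kernel_cong_sets[OF mlaw_in_prob_algebra[OF \<tau>]] measurable_compose[OF measurable_prob_algebraD[OF down_measurable[OF \<sigma>]]
      nn_integral_measurable_subprob_algebra[OF g_meas]])
  also have "\<dots> = (\<integral>\<^sup>+x. \<integral>\<^sup>+a. tail_reward \<sigma> n k (x, a) \<partial>\<kappa> x \<partial>mstate \<sigma> n)"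
    unfolding mlaw_def eq[OF order_refl]
    by (subst nn_integral_joint_law[OF mstate_in_prob_algebra[OF \<sigma>] kernel_measurable[OF \<tau>] tail_reward_measurable[OF \<sigma>]])
      (simp add: \<tau>_def)
  finally show ?thesis unfolding \<tau>_def .
qed

end

section \<open>Replacing one kernel at a time\<close>

text \<open>Caratheodory with a fixed number of terms, as \<open>chattering\<close> prescribes the
  number of selectors: shorter combinations are padded with weight 0 and an arbitrary element of
  \<open>D\<close>.\<close>

lemma convex_hull_image_indexed:
  fixes f :: "'b \<Rightarrow> 'e::euclidean_space"
  assumes "v \<in> convex hull (f ` D)"
  obtains \<phi> :: "nat \<Rightarrow> 'b" and \<beta> :: "nat \<Rightarrow> real" where "\<And>i. \<phi> i \<in> D" "\<And>i. 0 \<le> \<beta> i"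
    "(\<Sum>i<DIM('e) + 1. \<beta> i) = 1" "(\<Sum>i<DIM('e) + 1. \<beta> i *\<^sub>R f (\<phi> i)) = v"
proof -
  obtain T where T: "finite T" "T \<subseteq> f ` D" "card T \<le> DIM('e) + 1" "v \<in> convex hull T"
    using assms[unfolded caratheodory[of "f ` D"] mem_Collect_eq] by blast
  obtain w where w: "\<And>x. x \<in> T \<Longrightarrow> 0 \<le> w x" "sum w T = 1" "(\<Sum>x\<in>T. w x *\<^sub>R x) = v"
    using T(4)[unfolded convex_hull_finite[OF T(1)] mem_Collect_eq] by blast
  obtain e where e: "bij_betw e {..<card T} T"
    using ex_bij_betw_nat_finite[OF T(1)] by (auto simp: atLeast0LessThan)
  have eT: "e i \<in> T" if "i < card T" for i using bij_betwE[OF e] that by blast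
  have "T \<noteq> {}" using w(2) by auto
  then obtain d where d: "d \<in> D" using T(2) by auto
  define \<phi> where "\<phi> i = (if i < card T then (SOME b. b \<in> D \<and> f b = e i) else d)" for i
  define \<beta> where "\<beta> i = (if i < card T then w (e i) else 0)" for i
  have \<phi>: "\<phi> i \<in> D \<and> f (\<phi> i) = e i" if "i < card T" for i
  proof -
    have "\<exists>b. b \<in> D \<and> f b = e i" using eT[OF that] T(2) by (metis imageE subsetD)
    from someI_ex[OF this] show ?thesis using that by (simp add: \<phi>_def)
  qed
  have sub: "{..<card T} \<subseteq> {..<DIM('e) + 1}" using T(3) by auto
  show thesis
  proof
    show "\<phi> i \<in> D" for i using \<phi>[of i] d by (cases "i < card T") (auto simp: \<phi>_def)
    show "0 \<le> \<beta> i" for i using w(1)[OF eT] by (auto simp: \<beta>_def)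
    have "(\<Sum>i<DIM('e) + 1. \<beta> i) = (\<Sum>i<card T. w (e i))"
      using sub by (intro sum.mono_neutral_cong_right) (auto simp: \<beta>_def)
    also have "\<dots> = 1" using sum.reindex_bij_betw[OF e, of w] w(2) by simp
    finally show "(\<Sum>i<DIM('e) + 1. \<beta> i) = 1" .
    have "(\<Sum>i<DIM('e) + 1. \<beta> i *\<^sub>R f (\<phi> i)) = (\<Sum>i<card T. w (e i) *\<^sub>R e i)"
      using sub \<phi> by (intro sum.mono_neutral_cong_right) (auto simp: \<beta>_def)
    also have "\<dots> = v" using sum.reindex_bij_betw[OF e, of "\<lambda>x. w x *\<^sub>R x"] w(3) by simp
    finally show "(\<Sum>i<DIM('e) + 1. \<beta> i *\<^sub>R f (\<phi> i)) = v" .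
  qed
qed

lemma integrable_vecI:
  fixes F :: "'b \<Rightarrow> real^'k::finite"
  assumes "\<And>k. integrable M (\<lambda>u. F u $ k)"
  shows "integrable M F"
proof -
  have eq: "(\<Sum>k\<in>UNIV. (F u $ k) *\<^sub>R axis k 1) = F u" for u
    using basis_expansion[of "F u"] by (simp add: scalar_mult_eq_scaleR)
  have "integrable M (\<lambda>u. \<Sum>k\<in>UNIV. (F u $ k) *\<^sub>R axis k 1 :: real^'k)"
    by (intro Bochner_Integration.integrable_sum integrable_scaleR_left assms)
  then show ?thesis by (simp only: eq)
qed

section \<open>Kernels realised by auxiliary randomness, and reduction to Markov policies\<close>

context mdp
begin

abbreviation "selectors \<equiv> deterministic X SA Adm"

lemma selector_measurable: "\<phi> \<in> selectors \<Longrightarrow> \<phi> \<in> X \<rightarrow>\<^sub>M A"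
  by (simp add: deterministic_def)

text \<open>Applied to two sources of randomness: the uniform noise for arbitrary pair laws, and a
  law on finitely many indices for chattering kernels.\<close>

definition mix :: "'u measure \<Rightarrow> ('x \<times> 'u \<Rightarrow> 'a) \<Rightarrow> 'x \<Rightarrow> 'a measure" where
  "mix N a x = distr N A (\<lambda>u. a (x, u))"

context
  fixes N :: "'u measure" and a :: "'x \<times> 'u \<Rightarrow> 'a"
  assumes N: "prob_space N" and a: "a \<in> X \<Otimes>\<^sub>M N \<rightarrow>\<^sub>M A"
    and adm: "\<And>x u. x \<in> space X \<Longrightarrow> u \<in> space N \<Longrightarrow> a (x, u) \<in> Adm x"
begin

lemma section_measurable: "x \<in> space X \<Longrightarrow> (\<lambda>u. a (x, u)) \<in> N \<rightarrow>\<^sub>M A"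
  using measurable_compose[OF measurable_Pair1' a] .

lemma mix_in_kernels: "mix N a \<in> kernels"
proof -
  have "(\<lambda>x. distr N A (\<lambda>u. a (x, u))) \<in> X \<rightarrow>\<^sub>M prob_algebra A"
    using a N by (intro measurable_distr_prob_space2[where M = N])
      (auto simp: space_prob_algebra split_beta')
  moreover have "emeasure (mix N a x) (Adm x) = 1" if x: "x \<in> space X" for x
  proof -
    have "Adm x \<in> sets A" using model x by (simp add: mdp_model_def)
    then have "emeasure (mix N a x) (Adm x) = emeasure N ((\<lambda>u. a (x, u)) -` Adm x \<inter> space N)"
      unfolding mix_def by (rule emeasure_distr[OF section_measurable[OF x]])
    also have "(\<lambda>u. a (x, u)) -` Adm x \<inter> space N = space N" using adm[OF x] by auto
    finally show ?thesis by (simp add: prob_space.emeasure_space_1[OF N])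
  qed
  ultimately show ?thesis by (auto simp: stoch_kernels_def mix_def[abs_def])
qed

lemma nn_integral_mix:
  assumes x: "x \<in> space X" and f: "f \<in> borel_measurable Z"
  shows "(\<integral>\<^sup>+y. f (x, y) \<partial>mix N a x) = (\<integral>\<^sup>+u. f (x, a (x, u)) \<partial>N)"
proof -
  have "(\<lambda>y. f (x, y)) \<in> borel_measurable A"
    using f x by (simp add: XA_def)
  then show ?thesis unfolding mix_def by (simp add: nn_integral_distr[OF section_measurable[OF x]])
qed

lemma graph_measurable:
  assumes "S \<in> space (prob_algebra X)"
  shows "(\<lambda>p. (fst p, a p)) \<in> S \<Otimes>\<^sub>M N \<rightarrow>\<^sub>M Z"
proof -
  have "sets (S \<Otimes>\<^sub>M N) = sets (X \<Otimes>\<^sub>M N)"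
    using assms by (intro sets_pair_measure_cong) (auto simp: space_prob_algebra)
  from measurable_cong_sets[OF this refl] show ?thesis
    using measurable_Pair_XA[OF measurable_fst a] by blast
qed

lemma nn_integral_joint_mix:
  assumes S: "S \<in> space (prob_algebra X)" and f: "f \<in> borel_measurable Z"
  shows "(\<integral>\<^sup>+z. f z \<partial>joint S (mix N a)) = (\<integral>\<^sup>+x. \<integral>\<^sup>+u. f (x, a (x, u)) \<partial>N \<partial>S)"
  unfolding nn_integral_joint_law[OF S kernel_measurable[OF mix_in_kernels] f]
  using space_prob_algebra_space[OF S] by (intro nn_integral_cong nn_integral_mix[OF _ f]) auto

lemma joint_mix:
  assumes S: "S \<in> space (prob_algebra X)"
  shows "joint S (mix N a) = distr (S \<Otimes>\<^sub>M N) Z (\<lambda>p. (fst p, a p))"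
proof (rule prob_algebra_eqI)
  interpret N: prob_space N by (rule N)
  show "joint S (mix N a) \<in> space (prob_algebra Z)"
    by (rule joint_law_in_prob_algebra[OF S kernel_measurable[OF mix_in_kernels]])
  have "prob_space (S \<Otimes>\<^sub>M N)" using S N by (auto simp: space_prob_algebra intro!: prob_space_pair)
  then show "distr (S \<Otimes>\<^sub>M N) Z (\<lambda>p. (fst p, a p)) \<in> space (prob_algebra Z)"
    using prob_space.prob_space_distr[OF _ graph_measurable[OF S]] by (simp add: space_prob_algebra)
  fix f :: "'x \<times> 'a \<Rightarrow> ennreal" assume f: "f \<in> borel_measurable Z"
  have "(\<lambda>p. f (fst p, a p)) \<in> borel_measurable (S \<Otimes>\<^sub>M N)"
    by (rule measurable_compose[OF graph_measurable[OF S] f])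
  from N.nn_integral_fst[OF this]
  show "(\<integral>\<^sup>+z. f z \<partial>joint S (mix N a)) = (\<integral>\<^sup>+z. f z \<partial>distr (S \<Otimes>\<^sub>M N) Z (\<lambda>p. (fst p, a p)))"
    using f by (simp add: nn_integral_joint_mix[OF S f] nn_integral_distr[OF graph_measurable[OF S]])
qed

end

lemma ex_default_selector: "\<exists>\<theta>. \<theta> \<in> selectors"
  using model by (auto simp: mdp_model_def deterministic_def)

text \<open>\<open>ex_noise_representation\<close> yields actions in the whole Polish type which are
  admissible only almost surely. Policies must be admissible at every state, and later every section
  in \<open>u\<close> has to be a selector; two corrections by the default selector \<theta> achieve
  this without changing the law.\<close>

lemma ex_noise_kernel:
  assumes S: "S \<in> space (prob_algebra X)" and m: "m \<in> space (prob_algebra Z)"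
    and marg: "distr m X fst = S" and adm: "AE z in m. snd z \<in> Adm (fst z)"
  obtains a where "a \<in> X \<Otimes>\<^sub>M noise \<rightarrow>\<^sub>M A" "\<And>x u. x \<in> space X \<Longrightarrow> a (x, u) \<in> Adm x"
    "m = joint S (mix noise a)"
proof -
  interpret m: prob_space m using m by (simp add: space_prob_algebra)
  obtain \<theta> where \<theta>: "\<theta> \<in> selectors" using ex_default_selector ..
  have \<theta>m[measurable]: "\<theta> \<in> X \<rightarrow>\<^sub>M A" by (rule selector_measurable[OF \<theta>])
  have SA[measurable]: "SA \<in> sets borel" using model by (simp add: mdp_model_def)
  have incl: "(\<lambda>y. y) \<in> A \<rightarrow>\<^sub>M borel" unfolding ActM_def by (intro measurable_restrict_space1) simp
  have sS: "sets S = sets X" using S by (simp add: space_prob_algebra)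
  have sm: "sets m = sets Z" using m by (simp add: space_prob_algebra)
  have sp: "space m = space Z" by (rule space_prob_algebra_space[OF m])
  have S_borel: "sets (S \<Otimes>\<^sub>M (borel :: 'a measure)) = sets (X \<Otimes>\<^sub>M borel)"
    by (intro sets_pair_measure_cong sS refl)
  have ZB: "(\<lambda>z. z) \<in> Z \<rightarrow>\<^sub>M X \<Otimes>\<^sub>M borel"
    using measurable_Pair[OF measurable_fst_XA measurable_compose[OF measurable_snd_XA incl]] by simp
  then have mB: "(\<lambda>z. z) \<in> m \<rightarrow>\<^sub>M S \<Otimes>\<^sub>M borel"
    using measurable_cong_sets[OF sm S_borel] by simp
  define m' where "m' = distr m (S \<Otimes>\<^sub>M borel) (\<lambda>z. z)"
  have "prob_space m'" unfolding m'_def by (rule m.prob_space_distr[OF mB])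
  moreover have "distr m' S fst = S"
    unfolding m'_def by (subst distr_distr[OF _ mB]) (use marg in \<open>auto simp: comp_def cong: distr_cong simp: distr_cong[OF refl sS[symmetric] refl, symmetric]\<close>)
  ultimately obtain a' where a': "a' \<in> borel_measurable (S \<Otimes>\<^sub>M borel)"
    and law: "distr (S \<Otimes>\<^sub>M noise) (S \<Otimes>\<^sub>M borel) (\<lambda>p. (fst p, a' p)) = m'"
    using ex_noise_representation[of m' S] by (auto simp: m'_def)
  \<comment> \<open>First correction: values outside \<open>SA\<close> are replaced by \<theta>,
    which gives measurability into \<open>A\<close>. On the space of \<open>m\<close> all actions
    lie in \<open>SA\<close> and are left as they are.\<close>
  define \<rho> where "\<rho> p = (if snd p \<in> SA then snd p else \<theta> (fst p))" for p
  have \<rho>: "\<rho> \<in> X \<Otimes>\<^sub>M borel \<rightarrow>\<^sub>M A"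
    unfolding ActM_def
  proof (rule measurable_restrict_space2)
    have "(\<lambda>p. \<theta> (fst p)) \<in> X \<Otimes>\<^sub>M (borel :: 'a measure) \<rightarrow>\<^sub>M borel"
      using measurable_compose[OF measurable_compose[OF measurable_fst \<theta>m] incl] .
    then show "\<rho> \<in> X \<Otimes>\<^sub>M borel \<rightarrow>\<^sub>M borel" unfolding \<rho>_def by measurable
    show "\<rho> \<in> space (X \<Otimes>\<^sub>M borel) \<rightarrow> SA"
      using measurable_space[OF \<theta>m] by (auto simp: \<rho>_def space_pair_measure space_ActM)
  qed
  define b where "b p = \<rho> (fst p, a' p)" for p
  \<comment> \<open>Second correction: as the set of admissible pairs is measurable, \<theta> can
    take over where \<open>b\<close> is inadmissible, which happens only on a null set.\<close>
  define a where "a p = (if (fst p, b p) \<in> {(x, a). x \<in> space X \<and> a \<in> Adm x} then b p else \<theta> (fst p))" for p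
  have XN: "sets (X \<Otimes>\<^sub>M noise) = sets (X \<Otimes>\<^sub>M borel)" "sets (S \<Otimes>\<^sub>M noise) = sets (X \<Otimes>\<^sub>M borel)"
    "sets (S \<Otimes>\<^sub>M (borel :: real measure)) = sets (X \<Otimes>\<^sub>M borel)"
    by (auto intro!: sets_pair_measure_cong sS)
  have a'm: "a' \<in> X \<Otimes>\<^sub>M borel \<rightarrow>\<^sub>M borel"
    using a' measurable_cong_sets[OF XN(3) refl] by blast
  have bm[measurable]: "b \<in> X \<Otimes>\<^sub>M borel \<rightarrow>\<^sub>M A"
    unfolding b_def using a'm by (intro measurable_compose[OF _ \<rho>]) measurable
  have "a \<in> X \<Otimes>\<^sub>M borel \<rightarrow>\<^sub>M A" unfolding a_def by measurable
  then have am: "a \<in> X \<Otimes>\<^sub>M noise \<rightarrow>\<^sub>M A" using measurable_cong_sets[OF XN(1) refl] by blast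
  have aadm: "a (x, u) \<in> Adm x" if "x \<in> space X" for x u
    using \<theta> that by (auto simp: a_def deterministic_def)
  have gb: "(\<lambda>p. (fst p, b p)) \<in> S \<Otimes>\<^sub>M noise \<rightarrow>\<^sub>M Z"
    unfolding measurable_cong_sets[OF XN(2) refl] by measurable
  have ga: "(\<lambda>p. (fst p, a p)) \<in> S \<Otimes>\<^sub>M noise \<rightarrow>\<^sub>M Z"
    by (rule graph_measurable[OF prob_space_noise am aadm S])
  have ga': "(\<lambda>p. (fst p, a' p)) \<in> S \<Otimes>\<^sub>M noise \<rightarrow>\<^sub>M S \<Otimes>\<^sub>M borel"
    unfolding measurable_cong_sets[OF XN(2) S_borel] using a'm by measurable
  have gr: "(\<lambda>p. (fst p, \<rho> p)) \<in> S \<Otimes>\<^sub>M borel \<rightarrow>\<^sub>M Z"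
    unfolding measurable_cong_sets[OF S_borel refl] using \<rho> by measurable
  have "distr (S \<Otimes>\<^sub>M noise) Z (\<lambda>p. (fst p, b p)) = distr m' Z (\<lambda>p. (fst p, \<rho> p))"
    unfolding law[symmetric] by (subst distr_distr[OF gr ga']) (simp add: comp_def b_def)
  also have "\<dots> = distr m Z (\<lambda>z. (fst z, \<rho> z))"
    unfolding m'_def by (subst distr_distr[OF gr mB]) (simp add: comp_def)
  also have "\<dots> = distr m Z (\<lambda>z. z)"
    by (intro distr_cong refl) (auto simp: sp space_XA \<rho>_def)
  also have "\<dots> = m" by (rule distr_id2) (simp add: sm)
  finally have lawb: "distr (S \<Otimes>\<^sub>M noise) Z (\<lambda>p. (fst p, b p)) = m" .
  have "AE p in S \<Otimes>\<^sub>M noise. b p \<in> Adm (fst p)"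
    using AE_distrD[OF gb, of "\<lambda>z. snd z \<in> Adm (fst z)"] adm unfolding lawb by simp
  then have "AE p in S \<Otimes>\<^sub>M noise. (fst p, a p) = (fst p, b p)"
    using AE_space
  proof eventually_elim
    case (elim p)
    have "fst p \<in> space S" using elim(2) unfolding space_pair_measure by (rule mem_Times_iff[THEN iffD1, THEN conjunct1])
    then have "fst p \<in> space X" unfolding sets_eq_imp_space_eq[OF sS] .
    then show ?case using elim(1) by (simp add: a_def)
  qed
  then have "distr (S \<Otimes>\<^sub>M noise) Z (\<lambda>p. (fst p, a p)) = m"
    unfolding lawb[symmetric] by (intro distr_cong_AE refl ga gb)
  then have "m = joint S (mix noise a)"
    using joint_mix[OF prob_space_noise am aadm S] by simp
  then show thesis using am aadm that by blast
qed

text \<open>Each pair law is disintegrated separately over its own state law;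
  \<open>law_eq_mlaw\<close> shows that the resulting kernels fit together in one Markov
  policy.\<close>

lemma ex_markov_policy:
  assumes \<pi>: "\<pi> \<in> pols"
  obtains \<sigma> where "\<And>t. \<sigma> t \<in> kernels" "\<And>t. law \<pi> t = mlaw \<sigma> t"
proof -
  have "\<forall>t. \<exists>\<kappa>. \<kappa> \<in> kernels \<and> law \<pi> t = joint (state \<pi> t) \<kappa>"
  proof
    fix t
    obtain a where a: "a \<in> X \<Otimes>\<^sub>M noise \<rightarrow>\<^sub>M A" "\<And>x u. x \<in> space X \<Longrightarrow> a (x, u) \<in> Adm x"
      and eq: "law \<pi> t = joint (state \<pi> t) (mix noise a)"
      by (rule ex_noise_kernel[OF state_in_prob_algebra[OF \<pi>, of t] law_in_prob_algebra[OF \<pi>, of t]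
            distr_fst_law[OF \<pi>, of t] AE_law_admissible[OF \<pi>, of t]]) (rule that)
    have "mix noise a \<in> kernels" by (rule mix_in_kernels[OF prob_space_noise a])
    with eq show "\<exists>\<kappa>. \<kappa> \<in> kernels \<and> law \<pi> t = joint (state \<pi> t) \<kappa>" by (intro exI conjI)
  qed
  from choice[OF this] obtain \<sigma> where \<sigma>: "\<forall>t. \<sigma> t \<in> kernels \<and> law \<pi> t = joint (state \<pi> t) (\<sigma> t)" ..
  show thesis
  proof (rule that)
    show "\<sigma> t \<in> kernels" for t using \<sigma> by simp
    show "law \<pi> t = mlaw \<sigma> t" for t by (rule law_eq_mlaw[OF \<pi>]) (use \<sigma> in simp)
  qed
qed

lemma total_mlaw: "(\<And>t. \<sigma> t \<in> kernels) \<Longrightarrow> total (mlaw \<sigma>) = total (law (markov \<sigma>))"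
  unfolding total_def[abs_def] by (simp add: law_markov)

lemma total_mlaw_finite: "(\<And>t. \<sigma> t \<in> kernels) \<Longrightarrow> total (mlaw \<sigma>) k < \<infinity>"
  using total_finite[OF markov_in_policies[of \<sigma>], of k] total_mlaw[of \<sigma>] by simp

text \<open>The bound is the same for all \<open>\<sigma>\<close>. This matters because in the
  replacement argument the policy whose tail is estimated changes with \<open>n\<close>.\<close>

lemma total_tail_le:
  assumes \<sigma>: "\<And>t. \<sigma> t \<in> kernels"
  shows "(\<Sum>t. \<integral>\<^sup>+z. g k z \<partial>mlaw \<sigma> (t + n)) \<le>
    ennreal R * (SUP \<pi>\<in>pols. \<Sum>t. prob_not_absorbed X SA Q \<eta> \<Delta> \<pi> (t + n))"
proof -
  note \<pi> = markov_in_policies[of \<sigma>, OF \<sigma>]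
  have "(\<Sum>t. \<integral>\<^sup>+z. g k z \<partial>mlaw \<sigma> (t + n)) \<le>
      (\<Sum>t. ennreal R * prob_not_absorbed X SA Q \<eta> \<Delta> (markov \<sigma>) (t + n))"
    using nn_integral_g_law_le[OF \<pi>] by (intro suminf_le) (auto simp: law_markov[of \<sigma>, OF \<sigma>])
  also have "\<dots> = ennreal R * (\<Sum>t. prob_not_absorbed X SA Q \<eta> \<Delta> (markov \<sigma>) (t + n))" by simp
  also have "\<dots> \<le> ennreal R * (SUP \<pi>\<in>pols. \<Sum>t. prob_not_absorbed X SA Q \<eta> \<Delta> \<pi> (t + n))"
    by (intro mult_left_mono SUP_upper[OF \<pi>]) simp
  finally show ?thesis .
qed

text \<open>Replacing one kernel at a time never changes the total rewards; by uniform absorption the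
  tails of the intermediate policies vanish, so the limit policy has the same total rewards too.\<close>
lemma ex_policy_by_successive_replacement:
  assumes P: "P \<subseteq> kernels" and \<sigma>: "\<And>t. \<sigma> t \<in> kernels"
    and step: "\<And>\<tau> n. (\<And>t. \<tau> t \<in> kernels) \<Longrightarrow> \<exists>\<kappa>\<in>P. total (mlaw (\<tau>(n := \<kappa>))) = total (mlaw \<tau>)"
  obtains \<gamma> where "\<And>n. \<gamma> n \<in> P" "total (mlaw \<gamma>) = total (mlaw \<sigma>)"
proof -
  have "\<forall>p. \<exists>\<kappa>. (\<forall>t. fst p t \<in> kernels) \<longrightarrow>
      \<kappa> \<in> P \<and> total (mlaw ((fst p)(snd p := \<kappa>))) = total (mlaw (fst p))"
  proof
    fix p
    show "\<exists>\<kappa>. (\<forall>t. fst p t \<in> kernels) \<longrightarrow>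
      \<kappa> \<in> P \<and> total (mlaw ((fst p)(snd p := \<kappa>))) = total (mlaw (fst p))"
    proof (cases "\<forall>t. fst p t \<in> kernels")
      case True
      have "\<exists>\<kappa>\<in>P. total (mlaw ((fst p)(snd p := \<kappa>))) = total (mlaw (fst p))"
        by (rule step) (use True in simp)
      then show ?thesis by (elim bexE) (intro exI impI conjI)
    next
      case False
      then show ?thesis by (intro exI impI) (rule notE)
    qed
  qed
  from choice[OF this] obtain c' where c': "\<forall>p. (\<forall>t. fst p t \<in> kernels) \<longrightarrow>
      c' p \<in> P \<and> total (mlaw ((fst p)(snd p := c' p))) = total (mlaw (fst p))" ..
  define c where "c \<tau> n = c' (\<tau>, n)" for \<tau> n
  have c: "c \<tau> n \<in> P" "total (mlaw (\<tau>(n := c \<tau> n))) = total (mlaw \<tau>)"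
    if "\<And>t. \<tau> t \<in> kernels" for \<tau> n
    using c'[rule_format, of "(\<tau>, n)"] that by (auto simp: c_def)
  \<comment> \<open>\<open>\<tau> n\<close> is the policy after the kernels at times below
    \<open>n\<close> have been replaced.\<close>
  define \<tau> where "\<tau> = rec_nat \<sigma> (\<lambda>n \<tau>. \<tau>(n := c \<tau> n))"
  have \<tau>0: "\<tau> 0 = \<sigma>" and \<tau>S: "\<tau> (Suc n) = (\<tau> n)(n := c (\<tau> n) n)" for n
    by (simp_all add: \<tau>_def)
  have ker: "\<tau> n t \<in> kernels" for n t
  proof (induction n arbitrary: t)
    case (Suc n)
    have "c (\<tau> n) n \<in> kernels" using c(1)[of "\<tau> n" n, OF Suc] P by blast
    then show ?case using Suc[of t] by (simp add: \<tau>S)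
  qed (simp add: \<tau>0 \<sigma>)
  have tot: "total (mlaw (\<tau> n)) = total (mlaw \<sigma>)" for n
  proof (induction n)
    case (Suc n)
    show ?case unfolding \<tau>S using c(2)[of "\<tau> n" n, OF ker] Suc by (rule trans)
  qed (simp add: \<tau>0)
  \<comment> \<open>The diagonal: stage \<open>Suc n\<close> fixes the kernel at time
    \<open>n\<close>, and later stages leave it alone.\<close>
  define \<gamma> where "\<gamma> n = \<tau> (Suc n) n" for n
  have \<gamma>P: "\<gamma> n \<in> P" for n using c(1)[of "\<tau> n" n, OF ker] by (simp add: \<gamma>_def \<tau>S)
  then have \<gamma>k: "\<gamma> n \<in> kernels" for n using P by auto
  have agree: "\<tau> n t = \<gamma> t" if "t < n" for n t
    using that
  proof (induction n)
    case (Suc n)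
    then show ?case by (cases "t = n") (auto simp: \<gamma>_def \<tau>S)
  qed simp
  have "total (mlaw \<gamma>) k = total (mlaw \<sigma>) k" for k
  proof -
    let ?tail = "\<lambda>n. \<Sum>t. \<integral>\<^sup>+z. g k z \<partial>mlaw (\<tau> n) (t + n)"
    let ?head = "\<lambda>n. \<Sum>t<n. \<integral>\<^sup>+z. g k z \<partial>mlaw \<gamma> t"
    \<comment> \<open>The head already belongs to the limit policy, because \<open>\<tau> n\<close>
      and \<open>\<gamma>\<close> agree before time \<open>n\<close>; only the tail still depends on
      the stage.\<close>
    have split: "total (mlaw \<sigma>) k = ?tail n + ?head n" for n
    proof -
      have "total (mlaw \<sigma>) k = ?tail n + (\<Sum>t<n. \<integral>\<^sup>+z. g k z \<partial>mlaw (\<tau> n) t)"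
        unfolding tot[of n, symmetric] total_def by (rule suminf_offset) auto
      also have "(\<Sum>t<n. \<integral>\<^sup>+z. g k z \<partial>mlaw (\<tau> n) t) = ?head n"
      proof (intro sum.cong refl)
        fix t assume "t \<in> {..<n}"
        then have "mstate (\<tau> n) t = mstate \<gamma> t" "\<tau> n t = \<gamma> t"
          by (auto intro!: mstate_cong agree)
        then show "(\<integral>\<^sup>+z. g k z \<partial>mlaw (\<tau> n) t) = (\<integral>\<^sup>+z. g k z \<partial>mlaw \<gamma> t)" by (simp add: mlaw_def)
      qed
      finally show ?thesis .
    qed
    let ?b = "\<lambda>n. ennreal R * (SUP \<pi>\<in>pols. \<Sum>t. prob_not_absorbed X SA Q \<eta> \<Delta> \<pi> (t + n))"
    have "?b \<longlonglongrightarrow> ennreal R * 0"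
      using unif unfolding uniformly_absorbing_def by (intro ennreal_tendsto_cmult) auto
    then have b: "?b \<longlonglongrightarrow> 0" by simp
    have "?tail \<longlonglongrightarrow> 0"
    proof (rule tendsto_sandwich[OF _ _ tendsto_const b])
      show "\<forall>\<^sub>F n in sequentially. 0 \<le> ?tail n" by simp
      show "\<forall>\<^sub>F n in sequentially. ?tail n \<le> ?b n"
      proof (rule always_eventually, rule allI)
        show "?tail n \<le> ?b n" for n by (rule total_tail_le) (rule ker)
      qed
    qed
    moreover have "?head \<longlonglongrightarrow> total (mlaw \<gamma>) k"
      unfolding total_def by (intro summable_LIMSEQ) simp
    ultimately have "(\<lambda>n. ?tail n + ?head n) \<longlonglongrightarrow> 0 + total (mlaw \<gamma>) k" by (rule tendsto_add)
    then have "(\<lambda>n::nat. total (mlaw \<sigma>) k) \<longlonglongrightarrow> total (mlaw \<gamma>) k"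
      unfolding split[symmetric] by simp
    then show ?thesis using LIMSEQ_unique[OF tendsto_const] by metis
  qed
  then show thesis using \<gamma>P that by blast
qed

lemma dirac_in_kernels:
  assumes \<phi>: "\<phi> \<in> selectors" shows "(\<lambda>x. return A (\<phi> x)) \<in> kernels"
proof -
  have "(\<lambda>x. return A (\<phi> x)) \<in> X \<rightarrow>\<^sub>M prob_algebra A"
    by (rule measurable_compose[OF selector_measurable[OF \<phi>] measurable_return_prob_space])
  moreover have "emeasure (return A (\<phi> x)) (Adm x) = 1" if "x \<in> space X" for x
    using \<phi> model that by (simp add: mdp_model_def deterministic_def)
  ultimately show ?thesis by (simp add: stoch_kernels_def)
qed

section \<open>Value vectors of kernels and selectors at a fixed time\<close>

context
  fixes \<sigma> :: "nat \<Rightarrow> 'x \<Rightarrow> 'a measure" and n :: nat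
  assumes \<sigma>: "\<And>t. \<sigma> t \<in> kernels"
begin

abbreviation "S \<equiv> mstate \<sigma> n"
abbreviation "H \<equiv> tail_reward \<sigma> n"

lemma S: "S \<in> space (prob_algebra X)"
  by (rule mstate_in_prob_algebra[of \<sigma>, OF \<sigma>])

lemma sets_S: "sets S = sets X" and space_S: "space S = space X"
  using S by (auto simp: space_prob_algebra dest: sets_eq_imp_space_eq)

lemma H_measurable: "H k \<in> borel_measurable Z"
  by (rule tail_reward_measurable[of \<sigma>, OF \<sigma>])

lemma H_selector_measurable: "\<phi> \<in> selectors \<Longrightarrow> (\<lambda>x. H k (x, \<phi> x)) \<in> borel_measurable S"
  unfolding measurable_cong_sets[OF sets_S refl]
  by (rule measurable_compose[OF measurable_Pair_XA H_measurable]) (auto intro: selector_measurable)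

definition kernel_value :: "('x \<Rightarrow> 'a measure) \<Rightarrow> 'd \<times> bool \<Rightarrow> ennreal" where
  "kernel_value \<kappa> k = (\<integral>\<^sup>+x. \<integral>\<^sup>+a. H k (x, a) \<partial>\<kappa> x \<partial>S)"

definition selector_value :: "('x \<Rightarrow> 'a) \<Rightarrow> 'd \<times> bool \<Rightarrow> ennreal" where
  "selector_value \<phi> k = (\<integral>\<^sup>+x. H k (x, \<phi> x) \<partial>S)"

text \<open>The index type \<open>'d \<times> bool\<close> has 2d elements, which fixes the
  dimension for Caratheodory. For selectors \<open>enn2real\<close> loses nothing, by
  \<open>selector_value_finite\<close>.\<close>

definition selector_vec :: "('x \<Rightarrow> 'a) \<Rightarrow> real^('d \<times> bool)" where
  "selector_vec \<phi> = (\<chi> k. enn2real (selector_value \<phi> k))"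

definition target_vec :: "real^('d \<times> bool)" where
  "target_vec = (\<chi> k. enn2real (kernel_value (\<sigma> n) k))"

text \<open>Replacing the kernel gives another Markov policy. Its total is finite by absorption, and
  \<open>kernel_value\<close> is a nonnegative summand of that total.\<close>

lemma kernel_value_finite: "\<kappa> \<in> kernels \<Longrightarrow> kernel_value \<kappa> k < \<infinity>"
proof -
  assume \<kappa>: "\<kappa> \<in> kernels"
  then have "(\<sigma>(n := \<kappa>)) t \<in> kernels" for t using \<sigma> by simp
  from total_mlaw_finite[of "\<sigma>(n := \<kappa>)" k, OF this]
  show ?thesis unfolding total_update[of \<sigma>, OF \<sigma> \<kappa>] kernel_value_def by simp
qed

lemma kernel_value_dirac:
  assumes \<phi>: "\<phi> \<in> selectors" shows "kernel_value (\<lambda>x. return A (\<phi> x)) k = selector_value \<phi> k"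
  unfolding kernel_value_def selector_value_def
proof (rule nn_integral_cong)
  fix x assume "x \<in> space S"
  then have x: "x \<in> space X" by (simp add: space_S)
  have "(\<lambda>a. H k (x, a)) \<in> borel_measurable A"
    using H_measurable x by (simp add: XA_def)
  then show "(\<integral>\<^sup>+a. H k (x, a) \<partial>return A (\<phi> x)) = H k (x, \<phi> x)"
    using measurable_space[OF selector_measurable[OF \<phi>] x] by (rule nn_integral_return[rotated])
qed

lemma selector_value_finite: "\<phi> \<in> selectors \<Longrightarrow> selector_value \<phi> k < \<infinity>"
  using kernel_value_finite[OF dirac_in_kernels] by (simp add: kernel_value_dirac)

lemma total_update_eq:
  assumes \<kappa>: "\<kappa> \<in> kernels" and eq: "\<And>k. kernel_value \<kappa> k = kernel_value (\<sigma> n) k"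
  shows "total (mlaw (\<sigma>(n := \<kappa>))) = total (mlaw \<sigma>)"
proof
  fix k
  show "total (mlaw (\<sigma>(n := \<kappa>))) k = total (mlaw \<sigma>) k"
    using total_update[of \<sigma> \<kappa> n k, OF \<sigma> \<kappa>] total_update[of \<sigma> "\<sigma> n" n k, OF \<sigma> \<sigma>] eq[of k]
    by (simp add: kernel_value_def)
qed

text \<open>With the kernel realised by noise \<open>u\<close>, its value is the average over \<open>u\<close> of the values of the
  selectors \<open>x \<mapsto> a(x, u)\<close>.\<close>
lemma target_in_convex_hull: "target_vec \<in> convex hull (selector_vec ` selectors)"
proof -
  note \<pi> = markov_in_policies[of \<sigma>, OF \<sigma>]
  have law: "law (markov \<sigma>) n = mlaw \<sigma> n" and state: "state (markov \<sigma>) n = S"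
    by (rule law_markov state_markov, rule \<sigma>)+
  obtain a where a: "a \<in> X \<Otimes>\<^sub>M noise \<rightarrow>\<^sub>M A" "\<And>x u. x \<in> space X \<Longrightarrow> a (x, u) \<in> Adm x"
    and m: "mlaw \<sigma> n = joint S (mix noise a)"
    by (rule ex_noise_kernel[OF S law_in_prob_algebra[OF \<pi>, of n, unfolded law]
        distr_fst_law[OF \<pi>, of n, unfolded law state] AE_law_admissible[OF \<pi>, of n, unfolded law]]) (rule that)
  \<comment> \<open>Admissibility of \<open>a\<close> for every \<open>u\<close>, and not just
    almost every one, makes each section a selector.\<close>
  have sel: "(\<lambda>x. a (x, u)) \<in> selectors" for u
    using a(2) measurable_compose[OF measurable_Pair2' a(1), of u] by (auto simp: deterministic_def)
  interpret noise: prob_space noise by (rule prob_space_noise)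
  interpret S: prob_space S using S by (simp add: space_prob_algebra)
  interpret P: pair_sigma_finite S noise ..
  have Hm: "(\<lambda>p. H k (fst p, a p)) \<in> borel_measurable (S \<Otimes>\<^sub>M noise)" for k
    by (rule measurable_compose[OF graph_measurable[OF prob_space_noise a S] H_measurable])
  have Hm': "(\<lambda>(x, u). H k (x, a (x, u))) \<in> borel_measurable (S \<Otimes>\<^sub>M noise)" for k
    using Hm by (simp add: split_beta')
  have target: "kernel_value (\<sigma> n) k = (\<integral>\<^sup>+u. selector_value (\<lambda>x. a (x, u)) k \<partial>noise)" for k
  proof -
    have "kernel_value (\<sigma> n) k = (\<integral>\<^sup>+z. H k z \<partial>mlaw \<sigma> n)"
      unfolding kernel_value_def mlaw_def
      by (rule nn_integral_joint_law[OF S kernel_measurable[OF \<sigma>] H_measurable, symmetric])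
    also have "\<dots> = (\<integral>\<^sup>+x. \<integral>\<^sup>+u. H k (x, a (x, u)) \<partial>noise \<partial>S)"
      unfolding m by (rule nn_integral_joint_mix[OF prob_space_noise a S H_measurable])
    also have "\<dots> = (\<integral>\<^sup>+u. \<integral>\<^sup>+x. H k (x, a (x, u)) \<partial>S \<partial>noise)"
      using P.Fubini'[OF Hm'] by simp
    finally show ?thesis by (simp add: selector_value_def)
  qed
  define F where "F u = selector_vec (\<lambda>x. a (x, u))" for u
  have vm: "(\<lambda>u. selector_value (\<lambda>x. a (x, u)) k) \<in> borel_measurable noise" for k
    unfolding selector_value_def
    using S.borel_measurable_nn_integral[of "\<lambda>u x. H k (x, a (x, u))" noise] measurable_pair_swap[OF Hm[of k]]
    by simp
  have nn: "(\<integral>\<^sup>+u. ennreal (F u $ k) \<partial>noise) = kernel_value (\<sigma> n) k" for k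
    unfolding target using selector_value_finite[OF sel]
    by (intro nn_integral_cong) (simp add: F_def selector_vec_def less_top)
  have Fm: "(\<lambda>u. F u $ k) \<in> borel_measurable noise" for k
    using vm[of k] by (simp add: F_def selector_vec_def)
  have Fi: "integrable noise (\<lambda>u. F u $ k)" for k
  proof (rule integrableI_nonneg[OF Fm])
    show "AE u in noise. 0 \<le> F u $ k" by (simp add: F_def selector_vec_def)
    show "(\<integral>\<^sup>+u. ennreal (F u $ k) \<partial>noise) < \<infinity>" unfolding nn by (rule kernel_value_finite[OF \<sigma>])
  qed
  have "integral\<^sup>L noise F = target_vec"
  proof (rule vec_eq_iff[THEN iffD2], rule allI)
    fix k
    have "integral\<^sup>L noise F $ k = (\<integral>u. F u $ k \<partial>noise)"
      by (rule integral_bounded_linear[symmetric, OF bounded_linear_vec_nth integrable_vecI[OF Fi]])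
    also have "\<dots> = enn2real (\<integral>\<^sup>+u. ennreal (F u $ k) \<partial>noise)"
      by (rule integral_eq_nn_integral[OF Fm]) (simp add: F_def selector_vec_def)
    finally show "integral\<^sup>L noise F $ k = target_vec $ k" unfolding nn by (simp add: target_vec_def)
  qed
  moreover have "integral\<^sup>L noise F \<in> convex hull (selector_vec ` selectors)"
    by (rule mean_in_convex_set[OF prob_space_noise integrable_vecI[OF Fi] convex_convex_hull])
      (use sel in \<open>auto simp: F_def intro!: hull_inc\<close>)
  ultimately show ?thesis by simp
qed

text \<open>The mixture of selectors is realised as \<open>mix\<close> with a random index. By
  linearity of the integral its value is the convex combination of the selector vectors, hence the
  target vector.\<close>

lemma ex_chattering_replacement:
  "\<exists>\<kappa>\<in>chattering X SA Adm (2 * CARD('d) + 1). total (mlaw (\<sigma>(n := \<kappa>))) = total (mlaw \<sigma>)"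
proof -
  define q where "q = 2 * CARD('d) + 1"
  have q: "DIM(real^('d \<times> bool)) + 1 = q" by (simp add: q_def)
  obtain \<phi> \<beta> where \<phi>: "\<And>i. \<phi> i \<in> selectors" and \<beta>: "\<And>i. 0 \<le> \<beta> i" "(\<Sum>i<q. \<beta> i) = 1"
    and v: "(\<Sum>i<q. \<beta> i *\<^sub>R selector_vec (\<phi> i)) = target_vec"
    by (rule convex_hull_image_indexed[OF target_in_convex_hull, unfolded q]) (rule that)
  \<comment> \<open>Weights from \<open>q\<close> on are set to 0, so that this law on all natural
    numbers is carried by the \<open>q\<close> indices of the selectors.\<close>
  define p where "p = embed_pmf (\<lambda>i. if i < q then \<beta> i else 0)"
  have "(\<integral>\<^sup>+i. ennreal (if i < q then \<beta> i else 0) \<partial>count_space UNIV) = (\<Sum>i<q. ennreal (\<beta> i))"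
    by (subst nn_integral_count_space'[where A = "{..<q}"]) auto
  also have "\<dots> = 1" using \<beta> by (simp add: sum_ennreal)
  finally have pmf: "pmf p i = (if i < q then \<beta> i else 0)" for i
    unfolding p_def using \<beta>(1) by (subst pmf_embed_pmf) auto
  have supp: "set_pmf p \<subseteq> {..<q}" by (auto simp: set_pmf_eq pmf)
  have int: "(\<integral>\<^sup>+i. f i \<partial>measure_pmf p) = (\<Sum>i<q. f i * ennreal (\<beta> i))" for f :: "nat \<Rightarrow> ennreal"
  proof -
    have "(\<integral>\<^sup>+i. f i \<partial>measure_pmf p) = (\<Sum>i<q. f i * ennreal (pmf p i))"
      by (rule nn_integral_measure_pmf_support) (use supp in auto)
    also have "\<dots> = (\<Sum>i<q. f i * ennreal (\<beta> i))" by (intro sum.cong) (auto simp: pmf)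
    finally show ?thesis .
  qed
  define a where "a p = \<phi> (snd p) (fst p)" for p :: "'x \<times> nat"
  have a_count: "a \<in> X \<Otimes>\<^sub>M count_space UNIV \<rightarrow>\<^sub>M A"
    unfolding a_def
    by (rule measurable_compose_countable[where f = "\<lambda>i p. \<phi> i (fst p)" and g = snd])
      (auto intro!: measurable_compose[OF measurable_fst] selector_measurable \<phi>)
  have "sets (X \<Otimes>\<^sub>M measure_pmf p) = sets (X \<Otimes>\<^sub>M count_space UNIV)"
    by (intro sets_pair_measure_cong) auto
  from measurable_cong_sets[OF this refl, of A] a_count have am: "a \<in> X \<Otimes>\<^sub>M measure_pmf p \<rightarrow>\<^sub>M A"
    by simp
  have aadm: "x \<in> space X \<Longrightarrow> a (x, i) \<in> Adm x" for x i
    using \<phi>[of i] by (simp add: a_def deterministic_def)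
  define \<kappa> where "\<kappa> = mix (measure_pmf p) a"
  have pp: "prob_space (measure_pmf p)" by (rule measure_pmf.prob_space_axioms)
  have \<kappa>: "\<kappa> \<in> kernels" unfolding \<kappa>_def by (rule mix_in_kernels[OF pp am aadm])
  have chat: "\<kappa> \<in> chattering X SA Adm q"
    unfolding chattering_def
  proof (intro CollectI conjI \<kappa> exI[of _ \<phi>] exI[of _ "\<lambda>i _. \<beta> i"] allI impI ballI)
    fix x B assume x: "x \<in> space X" and B: "B \<in> sets A"
    interpret pk: prob_space "\<kappa> x" using kernel_space[OF \<kappa> x] by (simp add: space_prob_algebra)
    have "emeasure (\<kappa> x) B = (\<integral>\<^sup>+y. indicator B y \<partial>\<kappa> x)"
      using B kernel_space[OF \<kappa> x] by (intro nn_integral_indicator[symmetric]) (simp add: space_prob_algebra)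
    also have "\<dots> = (\<integral>\<^sup>+i. indicator B (a (x, i)) \<partial>measure_pmf p)"
      unfolding \<kappa>_def mix_def using B
      by (subst nn_integral_distr[OF section_measurable[OF pp am aadm x]]) auto
    also have "\<dots> = ennreal (\<Sum>i<q. \<beta> i * indicator B (\<phi> i x))"
      unfolding int using \<beta>(1)
      by (subst sum_ennreal[symmetric]) (auto intro!: sum.cong simp: a_def indicator_def)
    finally show "measure (\<kappa> x) B = (\<Sum>i<q. \<beta> i * indicator B (\<phi> i x))"
      using \<beta>(1) by (simp add: measure_def sum_nonneg)
  qed (use \<phi> \<beta> in \<open>auto intro: selector_measurable\<close>)
  have "kernel_value \<kappa> k = kernel_value (\<sigma> n) k" for k
  proof -
    have "kernel_value \<kappa> k = (\<integral>\<^sup>+x. \<integral>\<^sup>+i. H k (x, a (x, i)) \<partial>measure_pmf p \<partial>S)"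
      unfolding kernel_value_def \<kappa>_def
      by (intro nn_integral_cong nn_integral_mix[OF pp am aadm _ H_measurable]) (auto simp: space_S)
    also have "\<dots> = (\<integral>\<^sup>+x. (\<Sum>i<q. H k (x, \<phi> i x) * ennreal (\<beta> i)) \<partial>S)"
      unfolding int by (simp add: a_def)
    also have "\<dots> = (\<Sum>i<q. selector_value (\<phi> i) k * ennreal (\<beta> i))"
      unfolding selector_value_def using H_selector_measurable[OF \<phi>]
      by (subst nn_integral_sum) (auto simp: nn_integral_multc intro!: borel_measurable_times_ennreal)
    also have "\<dots> = (\<Sum>i<q. ennreal (\<beta> i * selector_vec (\<phi> i) $ k))"
      using selector_value_finite[OF \<phi>] \<beta>(1)
      by (intro sum.cong) (simp_all add: selector_vec_def ennreal_mult less_top mult.commute)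
    also have "\<dots> = ennreal (\<Sum>i<q. \<beta> i * selector_vec (\<phi> i) $ k)"
      using \<beta>(1) by (intro sum_ennreal) (simp add: selector_vec_def)
    also have "(\<Sum>i<q. \<beta> i * selector_vec (\<phi> i) $ k) = target_vec $ k"
      unfolding v[symmetric] by (simp add: sum_component)
    also have "ennreal \<dots> = kernel_value (\<sigma> n) k"
      using kernel_value_finite[OF \<sigma>] by (simp add: target_vec_def less_top)
    finally show ?thesis .
  qed
  then have "total (mlaw (\<sigma>(n := \<kappa>))) = total (mlaw \<sigma>)" by (rule total_update_eq[OF \<kappa>])
  then show ?thesis using chat unfolding q_def by (rule bexI)
qed

text \<open>A nonempty level set of \<open>U\<close> lies in a single class of \<open>G\<close>, and
  each class is null outside \<Delta>.\<close>

lemma AE_level_null: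
  fixes U :: "'x \<Rightarrow> real"
  assumes M: "M \<in> space (prob_algebra X)" and G: "countable G" "G \<subseteq> sets X"
    and U: "U \<in> borel_measurable X" "\<And>x y B. U x = U y \<Longrightarrow> B \<in> G \<Longrightarrow> x \<in> B \<longleftrightarrow> y \<in> B"
    and null: "\<And>x. x \<in> space X \<Longrightarrow>
      emeasure M ({y\<in>space X. \<forall>B\<in>G. y \<in> B \<longleftrightarrow> x \<in> B} \<inter> (space X - \<Delta>)) = 0"
  shows "AE y in M. y \<notin> \<Delta> \<longrightarrow> U y \<noteq> c"
proof (cases "\<exists>x\<in>space X. U x = c")
  case False
  then have no: "U y \<noteq> c" if "y \<in> space M" for y using that space_prob_algebra_space[OF M] by blast
  show ?thesis using AE_space by eventually_elim (simp add: no)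
next
  case True
  then obtain x where x: "x \<in> space X" "U x = c" by auto
  define E where "E = {y\<in>space X. \<forall>B\<in>G. y \<in> B \<longleftrightarrow> x \<in> B}"
  have "E \<in> sets X" unfolding E_def by (rule sets.same_members_in_sets[OF G])
  then have "E \<inter> (space X - \<Delta>) \<in> null_sets M"
    using null[OF x(1)] M by (auto simp: E_def[symmetric] null_sets_def space_prob_algebra)
  then have "AE y in M. y \<notin> E \<inter> (space X - \<Delta>)" by (rule AE_not_in)
  then show ?thesis using AE_space
  proof eventually_elim
    case (elim y)
    have "y \<in> space X" using elim(2) space_prob_algebra_space[OF M] by simp
    moreover have "y \<in> E" if "U y = c" using U(2)[of y x] that x \<open>y \<in> space X\<close> by (auto simp: E_def)
    ultimately show ?case using elim(1) by auto
  qed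
qed

text \<open>At time 0 the state law is \<eta>, and a separating family has to be constructed from
  atomlessness alone. At later times the state law is a mixture of the measures \<open>Q z\<close>;
  the countable family of the model serves all of them at once, so null level sets pass to the
  mixture.\<close>

lemma ex_diffuse_coordinate:
  assumes atomless: "atomless_model X SA Q \<eta> \<Delta>"
  obtains U :: "'x \<Rightarrow> real" where "U \<in> borel_measurable X" "\<And>c. AE x in S. x \<notin> \<Delta> \<longrightarrow> U x \<noteq> c"
proof (cases n)
  case 0
  interpret \<eta>: prob_space \<eta> using eta by (simp add: space_prob_algebra)
  have s\<eta>: "sets \<eta> = sets X" using eta by (simp add: space_prob_algebra)
  have D: "space X - \<Delta> \<in> sets \<eta>" unfolding s\<eta> by measurable
  define \<nu> where "\<nu> = density \<eta> (indicator (space X - \<Delta>))"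
  have \<nu>: "emeasure \<nu> B = emeasure \<eta> (B \<inter> (space X - \<Delta>))" if "B \<in> sets X" for B
  proof -
    have "emeasure \<nu> B = (\<integral>\<^sup>+x. indicator (space X - \<Delta>) x * indicator B x \<partial>\<eta>)"
      unfolding \<nu>_def using D that s\<eta> by (intro emeasure_density) auto
    also have "\<dots> = (\<integral>\<^sup>+x. indicator (B \<inter> (space X - \<Delta>)) x \<partial>\<eta>)"
      by (intro nn_integral_cong) (auto simp: indicator_def)
    finally show ?thesis using D that s\<eta> by simp
  qed
  have s\<nu>: "sets \<nu> = sets X" "space \<nu> = space X" using s\<eta> sets_eq_imp_space_eq[OF s\<eta>] by (auto simp: \<nu>_def)
  have "finite_measure \<nu>"
    using \<nu>[OF sets.top] by (intro finite_measureI) (simp add: s\<nu>)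
  moreover have "atomless_on (sets \<nu>) (emeasure \<nu>)"
  proof -
    have "atomless_on (sets X) (emeasure \<nu>) = atomless_on (sets X) (\<lambda>B. emeasure \<eta> (B \<inter> (space X - \<Delta>)))"
      by (rule atomless_on_cong) (rule \<nu>)
    then show ?thesis unfolding s\<nu> using atomless by (simp add: atomless_model_def)
  qed
  ultimately obtain G where G: "countable G" "G \<subseteq> sets \<nu>"
    "\<And>x. x \<in> space \<nu> \<Longrightarrow> emeasure \<nu> {y\<in>space \<nu>. \<forall>B\<in>G. y \<in> B \<longleftrightarrow> x \<in> B} = 0"
    by (rule atomless_imp_ex_separating_family) (rule that)
  note G' = G[unfolded s\<nu>]
  obtain U :: "'x \<Rightarrow> real" where U: "U \<in> borel_measurable X" "\<And>x y B. U x = U y \<Longrightarrow> B \<in> G \<Longrightarrow> x \<in> B \<longleftrightarrow> y \<in> B"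
    by (rule ex_code_of_countable_family[OF G'(1,2)]) (rule that)
  have "AE x in S. x \<notin> \<Delta> \<longrightarrow> U x \<noteq> c" for c
  proof (rule AE_level_null[OF S G'(1,2) U])
    fix x assume x: "x \<in> space X"
    show "emeasure S ({y\<in>space X. \<forall>B\<in>G. y \<in> B \<longleftrightarrow> x \<in> B} \<inter> (space X - \<Delta>)) = 0"
      using G'(3)[OF x] \<nu>[OF sets.same_members_in_sets[OF G'(1,2)], of x] 0 by simp
  qed
  from U(1) this show thesis by (rule that)
next
  case (Suc m)
  obtain G where G: "countable G" "G \<subseteq> sets X" and
    at: "\<And>x a. x \<in> space X - \<Delta> \<Longrightarrow> a \<in> space A \<Longrightarrow>
      atomless_on (sigma_sets (space X) G) (\<lambda>B. emeasure (Q (x, a)) (B \<inter> (space X - \<Delta>)))"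
    using atomless unfolding atomless_model_def by blast
  have Gp: "G \<subseteq> Pow (space X)" using G(2) sets.space_closed by blast
  obtain U :: "'x \<Rightarrow> real" where U: "U \<in> borel_measurable X" "\<And>x y B. U x = U y \<Longrightarrow> B \<in> G \<Longrightarrow> x \<in> B \<longleftrightarrow> y \<in> B"
    by (rule ex_code_of_countable_family[OF G]) (rule that)
  have "AE x in S. x \<notin> \<Delta> \<longrightarrow> U x \<noteq> c" for c
  proof -
    note m = mlaw_in_prob_algebra[of \<sigma> m, OF \<sigma>]
    have Seq: "S = mlaw \<sigma> m \<bind> Q" by (simp add: Suc mlaw_def)
    have QN: "Q \<in> mlaw \<sigma> m \<rightarrow>\<^sub>M subprob_algebra X"
      unfolding kernel_cong_sets[OF m] by (rule measurable_prob_algebraD[OF Q_meas])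
    have AE_Q: "AE y in Q z. y \<notin> \<Delta> \<longrightarrow> U y \<noteq> c" if z: "z \<in> space Z" for z
    proof (cases "fst z \<in> \<Delta>")
      case True
      from AE_Q_absorbing[OF z this] show ?thesis by eventually_elim simp
    next
      case False
      show ?thesis
      proof (rule AE_level_null[OF measurable_space[OF Q_meas z] G U])
        fix x assume x: "x \<in> space X"
        have "atomless_on (sigma_sets (space X) G) (\<lambda>B. emeasure (Q z) (B \<inter> (space X - \<Delta>)))"
          using at[of "fst z" "snd z"] False z by (auto simp: space_XA space_ActM)
        from atomless_generated_imp_null_class[OF G(1) Gp _ this x]
        show "emeasure (Q z) ({y\<in>space X. \<forall>B\<in>G. y \<in> B \<longleftrightarrow> x \<in> B} \<inter> (space X - \<Delta>)) = 0" by simp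
      qed
    qed
    have "AE z in mlaw \<sigma> m. AE y in Q z. y \<notin> \<Delta> \<longrightarrow> U y \<noteq> c"
      by (rule AE_I2, rule AE_Q) (simp add: space_prob_algebra_space[OF m])
    moreover have "Measurable.pred X (\<lambda>y. y \<notin> \<Delta> \<longrightarrow> U y \<noteq> c)" using U(1) by measurable
    ultimately show ?thesis unfolding Seq by (simp only: AE_bind[OF QN])
  qed
  from U(1) this show thesis by (rule that)
qed

text \<open>Lyapunov's theorem is applied to the tail rewards of both selectors together, at most 4d
  densities, and gives one set \<open>B\<close> of fraction \<open>s\<close> for all of them.
  Following \<phi> on \<open>B\<close> and \<psi> elsewhere realises the convex combination.\<close>

lemma convex_selector_vec:
  assumes atomless: "atomless_model X SA Q \<eta> \<Delta>"
  shows "convex (selector_vec ` selectors)"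
proof (rule convexI)
  fix v1 v2 and s t :: real
  assume "v1 \<in> selector_vec ` selectors" "v2 \<in> selector_vec ` selectors" and st: "0 \<le> s" "0 \<le> t" "s + t = 1"
  then obtain \<phi> \<psi> where \<phi>: "\<phi> \<in> selectors" "v1 = selector_vec \<phi>" and \<psi>: "\<psi> \<in> selectors" "v2 = selector_vec \<psi>"
    by auto
  obtain U :: "'x \<Rightarrow> real" where U: "U \<in> borel_measurable X" "\<And>c. AE x in S. x \<notin> \<Delta> \<longrightarrow> U x \<noteq> c"
    by (rule ex_diffuse_coordinate[OF atomless]) (rule that)
  define h where "h \<phi> k x = H k (x, \<phi> x)" for \<phi> k x
  let ?F = "h \<phi> ` UNIV \<union> h \<psi> ` UNIV"
  have hm: "h \<xi> k \<in> borel_measurable S" if "\<xi> \<in> selectors" for \<xi> k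
    unfolding h_def[abs_def] by (rule H_selector_measurable[OF that])
  have hi: "(\<integral>\<^sup>+x. h \<xi> k x \<partial>S) = selector_value \<xi> k" for \<xi> k by (simp add: h_def selector_value_def)
  \<comment> \<open>Inside \<Delta> the tail rewards vanish, so a level set of \<open>U\<close>
    could carry mass only outside \<Delta>, where \<open>U\<close> is diffuse.\<close>
  have hn: "AE x in S. U x = c \<longrightarrow> h \<xi> k x = 0" if \<xi>: "\<xi> \<in> selectors" for \<xi> k c
    using U(2)[of c] AE_space
  proof eventually_elim
    case (elim x)
    have "(x, \<xi> x) \<in> space Z" using elim(2) measurable_space[OF selector_measurable[OF \<xi>], of x]
      by (auto simp: space_S space_XA space_ActM)
    then show ?case using elim(1) tail_reward_zero[of \<sigma> "(x, \<xi> x)" n k, OF \<sigma>] by (auto simp: h_def)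
  qed
  have US: "U \<in> borel_measurable S" using U(1) measurable_cong_sets[OF sets_S refl] by blast
  obtain B where B: "B \<in> sets S" and
    Bm: "\<And>f. f \<in> ?F \<Longrightarrow> measure (density S f) B = s * measure (density S f) (space S)"
  proof (rule lyapunov[of ?F S U s])
    show "finite ?F" by simp
    show "f \<in> borel_measurable S" if "f \<in> ?F" for f using that hm \<phi>(1) \<psi>(1) by auto
    show "(\<integral>\<^sup>+x. f x \<partial>S) < \<infinity>" if "f \<in> ?F" for f
      using that hi selector_value_finite \<phi>(1) \<psi>(1) by auto
    show "AE x in S. U x = c \<longrightarrow> f x = 0" if "f \<in> ?F" for f c
      using that hn \<phi>(1) \<psi>(1) by auto
  qed (use st US in auto)
  have BX: "B \<in> sets X" using B by (simp add: sets_S)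
  define \<omega> where "\<omega> x = (if x \<in> B then \<phi> x else \<psi> x)" for x
  have \<omega>: "\<omega> \<in> selectors"
  proof -
    have "\<omega> \<in> X \<rightarrow>\<^sub>M A"
      unfolding \<omega>_def using BX
      by (intro measurable_If_set selector_measurable \<phi>(1) \<psi>(1)) simp
    then show ?thesis using \<phi>(1) \<psi>(1) by (auto simp: deterministic_def \<omega>_def)
  qed
  have fin: "finite_measure (density S (h \<xi> k))" if "\<xi> \<in> selectors" for \<xi> k
  proof (rule finite_measureI)
    have "emeasure (density S (h \<xi> k)) (space (density S (h \<xi> k))) = (\<integral>\<^sup>+x. h \<xi> k x * indicator (space S) x \<partial>S)"
      using hm[OF that] by (simp add: emeasure_density)
    also have "\<dots> = selector_value \<xi> k" unfolding hi[symmetric] by (intro nn_integral_cong) simp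
    finally show "emeasure (density S (h \<xi> k)) (space (density S (h \<xi> k))) \<noteq> \<infinity>"
      using selector_value_finite[OF that, of k] by simp
  qed
  have whole: "measure (density S (h \<xi> k)) (space S) = selector_vec \<xi> $ k" if "\<xi> \<in> selectors" for \<xi> k
  proof -
    have "emeasure (density S (h \<xi> k)) (space S) = (\<integral>\<^sup>+x. h \<xi> k x * indicator (space S) x \<partial>S)"
      using hm[OF that] by (simp add: emeasure_density)
    also have "\<dots> = selector_value \<xi> k" unfolding hi[symmetric] by (intro nn_integral_cong) simp
    finally show ?thesis by (simp add: measure_def selector_vec_def)
  qed
  have "selector_vec \<omega> $ k = s * selector_vec \<phi> $ k + t * selector_vec \<psi> $ k" for k
  proof -
    interpret D1: finite_measure "density S (h \<phi> k)" by (rule fin[OF \<phi>(1)])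
    interpret D2: finite_measure "density S (h \<psi> k)" by (rule fin[OF \<psi>(1)])
    have "selector_value \<omega> k = (\<integral>\<^sup>+x. h \<phi> k x * indicator B x + h \<psi> k x * indicator (space S - B) x \<partial>S)"
      unfolding selector_value_def
      by (intro nn_integral_cong) (auto simp: h_def \<omega>_def indicator_def)
    also have "\<dots> = (\<integral>\<^sup>+x. h \<phi> k x * indicator B x \<partial>S) + (\<integral>\<^sup>+x. h \<psi> k x * indicator (space S - B) x \<partial>S)"
      using hm[OF \<phi>(1)] hm[OF \<psi>(1)] B by (intro nn_integral_add) auto
    also have "\<dots> = emeasure (density S (h \<phi> k)) B + emeasure (density S (h \<psi> k)) (space S - B)"
      using hm[OF \<phi>(1)] hm[OF \<psi>(1)] B by (simp add: emeasure_density)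
    finally have "selector_value \<omega> k =
        ennreal (measure (density S (h \<phi> k)) B + measure (density S (h \<psi> k)) (space S - B))"
      by (simp add: D1.emeasure_eq_measure D2.emeasure_eq_measure)
    then have "selector_vec \<omega> $ k = measure (density S (h \<phi> k)) B + measure (density S (h \<psi> k)) (space S - B)"
      by (simp add: selector_vec_def enn2real_plus)
    also have "measure (density S (h \<psi> k)) (space S - B) =
        measure (density S (h \<psi> k)) (space S) - measure (density S (h \<psi> k)) B"
      using B D2.finite_measure_Diff[of "space S" B] sets.sets_into_space[OF B] by simp
    finally have "selector_vec \<omega> $ k = s * selector_vec \<phi> $ k + (selector_vec \<psi> $ k - s * selector_vec \<psi> $ k)"
      using Bm[of "h \<phi> k"] Bm[of "h \<psi> k"] whole \<phi>(1) \<psi>(1) by simp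
    moreover have "t = 1 - s" using st by simp
    ultimately show ?thesis by (simp only: left_diff_distrib mult_1_left)
  qed
  then have "s *\<^sub>R v1 + t *\<^sub>R v2 = selector_vec \<omega>" by (simp add: vec_eq_iff \<phi> \<psi>)
  then show "s *\<^sub>R v1 + t *\<^sub>R v2 \<in> selector_vec ` selectors" using \<omega> by blast
qed

lemma ex_deterministic_replacement:
  assumes "atomless_model X SA Q \<eta> \<Delta>"
  shows "\<exists>\<kappa>\<in>{\<lambda>x. return A (\<phi> x) |\<phi>. \<phi> \<in> selectors}. total (mlaw (\<sigma>(n := \<kappa>))) = total (mlaw \<sigma>)"
proof -
  have "target_vec \<in> selector_vec ` selectors"
    using target_in_convex_hull unfolding hull_same[of convex, OF convex_selector_vec[OF assms]] .
  then obtain \<phi> where \<phi>: "\<phi> \<in> selectors" "target_vec = selector_vec \<phi>" by auto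
  have eq: "kernel_value (\<lambda>x. return A (\<phi> x)) k = kernel_value (\<sigma> n) k" for k
  proof -
    have "enn2real (kernel_value (\<sigma> n) k) = enn2real (selector_value \<phi> k)"
      using arg_cong[OF \<phi>(2), of "\<lambda>v. v $ k"] by (simp add: target_vec_def selector_vec_def)
    moreover have "kernel_value (\<sigma> n) k = ennreal (enn2real (kernel_value (\<sigma> n) k))"
      using kernel_value_finite[OF \<sigma>[of n], of k] by (simp add: less_top)
    moreover have "selector_value \<phi> k = ennreal (enn2real (selector_value \<phi> k))"
      using selector_value_finite[OF \<phi>(1), of k] by (simp add: less_top)
    ultimately show ?thesis by (simp add: kernel_value_dirac[OF \<phi>(1)])
  qed
  have "total (mlaw (\<sigma>(n := \<lambda>x. return A (\<phi> x)))) = total (mlaw \<sigma>)"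
    by (rule total_update_eq[OF dirac_in_kernels[OF \<phi>(1)] eq])
  moreover have "(\<lambda>x. return A (\<phi> x)) \<in> {\<lambda>x. return A (\<phi> x) |\<phi>. \<phi> \<in> selectors}" using \<phi>(1) by blast
  ultimately show ?thesis by (rule bexI)
qed

end

text \<open>The common conclusion of both parts of the theorem, with \<open>P\<close> the class of
  chattering kernels or the class of Dirac kernels of selectors.\<close>

lemma ex_equivalent_markov_policy:
  assumes \<pi>: "\<pi> \<in> pols" and P: "P \<subseteq> kernels"
    and step: "\<forall>\<tau> n. (\<forall>t. \<tau> t \<in> kernels) \<longrightarrow> (\<exists>\<kappa>\<in>P. total (mlaw (\<tau>(n := \<kappa>))) = total (mlaw \<tau>))"
  obtains \<gamma> where "\<And>n. \<gamma> n \<in> P" "markov \<gamma> \<in> pols"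
    "occ_reward X SA Q \<eta> \<Delta> r \<pi> = occ_reward X SA Q \<eta> \<Delta> r (markov \<gamma>)"
proof -
  obtain \<sigma> where \<sigma>: "\<And>t. \<sigma> t \<in> kernels" "\<And>t. law \<pi> t = mlaw \<sigma> t"
    by (rule ex_markov_policy[OF \<pi>]) (rule that)
  obtain \<gamma> where \<gamma>: "\<And>n. \<gamma> n \<in> P" "total (mlaw \<gamma>) = total (mlaw \<sigma>)"
    by (rule ex_policy_by_successive_replacement[of P \<sigma>, OF P \<sigma>(1) step[rule_format]])
      (simp, rule that)
  have \<gamma>k: "\<gamma> n \<in> kernels" for n using \<gamma>(1) P by auto
  have \<gamma>\<pi>: "markov \<gamma> \<in> pols" by (rule markov_in_policies[of \<gamma>, OF \<gamma>k])
  have "law \<pi> = mlaw \<sigma>" using \<sigma>(2) by (rule ext)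
  then have "total (law \<pi>) = total (law (markov \<gamma>))"
    using \<gamma>(2) total_mlaw[of \<gamma>, OF \<gamma>k] by simp
  from \<gamma>(1) \<gamma>\<pi> occ_reward_cong[OF \<pi> \<gamma>\<pi> this] show thesis by (rule that)
qed

end

theorem mainTheorem9:
  fixes X :: "'x measure" and SA :: "'a::polish_space set" and Adm :: "'x \<Rightarrow> 'a set"
    and Q :: "'x \<times> 'a \<Rightarrow> 'x measure" and \<eta> :: "'x measure"
    and r :: "'x \<times> 'a \<Rightarrow> real^'d::finite" and \<Delta> :: "'x set"
  assumes model: "mdp_model X SA Adm Q \<eta> r"
    and unif: "uniformly_absorbing X SA Adm Q \<eta> r \<Delta>"
  shows "(\<forall>\<pi>\<in>policies X SA Adm. \<exists>\<gamma>.
            (\<forall>n. \<gamma> n \<in> chattering X SA Adm (2 * CARD('d) + 1)) \<and>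
            (\<lambda>n h. \<gamma> n (snd h)) \<in> policies X SA Adm \<and>
            occ_reward X SA Q \<eta> \<Delta> r \<pi> = occ_reward X SA Q \<eta> \<Delta> r (\<lambda>n h. \<gamma> n (snd h)))
       \<and> (atomless_model X SA Q \<eta> \<Delta> \<longrightarrow>
          (\<forall>\<pi>\<in>policies X SA Adm. \<exists>\<Phi>.
            (\<forall>n. \<Phi> n \<in> deterministic X SA Adm) \<and>
            (\<lambda>n h. return (ActM SA) (\<Phi> n (snd h))) \<in> policies X SA Adm \<and>
            occ_reward X SA Q \<eta> \<Delta> r \<pi> =
              occ_reward X SA Q \<eta> \<Delta> r (\<lambda>n h. return (ActM SA) (\<Phi> n (snd h)))))"
proof -
  interpret mdp X SA Adm Q \<eta> r \<Delta> by (rule mdp.intro[OF model unif])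
  show ?thesis
  proof (intro conjI impI ballI)
    fix \<pi> assume \<pi>: "\<pi> \<in> policies X SA Adm"
    have "chattering X SA Adm (2 * CARD('d) + 1) \<subseteq> stoch_kernels X SA Adm"
      by (auto simp: chattering_def)
    moreover have "\<forall>\<tau> n. (\<forall>t. \<tau> t \<in> kernels) \<longrightarrow>
        (\<exists>\<kappa>\<in>chattering X SA Adm (2 * CARD('d) + 1). total (mlaw (\<tau>(n := \<kappa>))) = total (mlaw \<tau>))"
      by (intro allI impI ex_chattering_replacement) simp
    ultimately obtain \<gamma>
      where "\<And>n. \<gamma> n \<in> chattering X SA Adm (2 * CARD('d) + 1)" "markov \<gamma> \<in> policies X SA Adm"
        "occ_reward X SA Q \<eta> \<Delta> r \<pi> = occ_reward X SA Q \<eta> \<Delta> r (markov \<gamma>)"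
      by (rule ex_equivalent_markov_policy[OF \<pi>]) (rule that)
    then show "\<exists>\<gamma>. (\<forall>n. \<gamma> n \<in> chattering X SA Adm (2 * CARD('d) + 1)) \<and>
            (\<lambda>n h. \<gamma> n (snd h)) \<in> policies X SA Adm \<and>
            occ_reward X SA Q \<eta> \<Delta> r \<pi> = occ_reward X SA Q \<eta> \<Delta> r (\<lambda>n h. \<gamma> n (snd h))"
      by (intro exI conjI allI)
  next
    fix \<pi> assume at: "atomless_model X SA Q \<eta> \<Delta>" and \<pi>: "\<pi> \<in> policies X SA Adm"
    let ?P = "{\<lambda>x. return (ActM SA) (\<phi> x) |\<phi>. \<phi> \<in> deterministic X SA Adm}"
    have "?P \<subseteq> stoch_kernels X SA Adm"
      using dirac_in_kernels by blast
    moreover have "\<forall>\<tau> n. (\<forall>t. \<tau> t \<in> kernels) \<longrightarrow>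
        (\<exists>\<kappa>\<in>?P. total (mlaw (\<tau>(n := \<kappa>))) = total (mlaw \<tau>))"
      by (intro allI impI ex_deterministic_replacement at) simp
    ultimately obtain \<gamma>
      where \<gamma>: "\<And>n. \<gamma> n \<in> ?P" "markov \<gamma> \<in> policies X SA Adm"
        "occ_reward X SA Q \<eta> \<Delta> r \<pi> = occ_reward X SA Q \<eta> \<Delta> r (markov \<gamma>)"
      by (rule ex_equivalent_markov_policy[OF \<pi>]) (rule that)
    have "\<forall>n. \<exists>\<phi>. \<gamma> n = (\<lambda>x. return (ActM SA) (\<phi> x)) \<and> \<phi> \<in> deterministic X SA Adm"
      using \<gamma>(1) by simp
    from choice[OF this] obtain \<Phi>
      where \<Phi>: "\<forall>n. \<gamma> n = (\<lambda>x. return (ActM SA) (\<Phi> n x)) \<and> \<Phi> n \<in> deterministic X SA Adm" ..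
    then have "markov \<gamma> = (\<lambda>n h. return (ActM SA) (\<Phi> n (snd h)))" by simp
    with \<gamma>(2,3) \<Phi> show "\<exists>\<Phi>. (\<forall>n. \<Phi> n \<in> deterministic X SA Adm) \<and>
            (\<lambda>n h. return (ActM SA) (\<Phi> n (snd h))) \<in> policies X SA Adm \<and>
            occ_reward X SA Q \<eta> \<Delta> r \<pi> =
              occ_reward X SA Q \<eta> \<Delta> r (\<lambda>n h. return (ActM SA) (\<Phi> n (snd h)))"
      by (intro exI[of _ \<Phi>]) simp
  qed
qed

end
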